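(* For every positive integer $k$ there exists a conservative ergodic ($\sigma$-finite, infinite measure-preserving) Markov shift $T$, isomorphic to its inverse $T^{-1}$, such that the $k$-fold Cartesian product $T^{(k)}=T\times\cdots\times T$ is conservative and ergodic, while $T^{(k)}\times T^{-1}$ is neither conservative nor ergodic.
   Context: Markov shifts. Let $S$ be a countable set, $P=(p_{s,t})_{s,t\in S}$ a stochastic matrix, and $\lambda=(\lambda_s)_{s\in S}$ a vector with nonnegative entries such that $\lambda P=\lambda$ and $\sum_{s\in S}\lambda_s=\infty$. Let $X=S^{\mathbb{Z}}$ with the $\sigma$-algebra generated by the cylinders $[s_0\ldots s_n]_k=\{x\in X: x_{j+k}=s_j,\ 0\le j\le n\}$, let $\mu_\lambda$ be the measure determined by $\mu_\lambda([s_0\ldots s_n]_k)=\lambda_{s_0}p_{s_0,s_1}\cdots p_{s_{n-1},s_n}$, and let $T$ be the left shift on $X$. Then $T$ preserves $\mu_\lambda$, and $(X,\mu_\lambda,T)$ is called a $\sigma$-finite Markov shift. A transformation $R$ is conservative if $A\subset\bigcup_{n\ge1}R^{-n}(A)$ mod null sets for every measurable $A$, and ergodic if $R^{-1}(A)=A$ implies $A$ or $A^c$ is null. Products carry the product measure. Isomorphic means conjugate by an invertible measure-preserving map (mod null sets). *)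

theory Defs
  imports "HOL-Analysis.Analysis"
begin

definition left_shift :: "(int \<Rightarrow> 's) \<Rightarrow> int \<Rightarrow> 's" where
  "left_shift x = (\<lambda>j. x (j + 1))"

lemma bij_left_shift: "bij left_shift"
  by (rule o_bij[where g = "\<lambda>x j. x (j - 1)"]) (auto simp: left_shift_def fun_eq_iff)

lemma inv_left_shift: "inv left_shift = (\<lambda>x j. x (j - 1))"
  by (rule inv_unique_comp) (auto simp: left_shift_def fun_eq_iff)

text \<open>The cylinder \<open>[s\<^sub>0 \<dots> s\<^sub>n]\<^sub>k\<close> in the two-sided sequence space over \<open>S\<close>;
  only the values \<open>s 0, \<dots>, s n\<close> matter.\<close>

definition cylinder :: "'s set \<Rightarrow> int \<Rightarrow> nat \<Rightarrow> (nat \<Rightarrow> 's) \<Rightarrow> (int \<Rightarrow> 's) set" where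
  "cylinder S k n s = {x \<in> UNIV \<rightarrow>\<^sub>E S. \<forall>j\<le>n. x (int j + k) = s j}"

text \<open>\<open>M\<close> is the measure space of the Markov shift with state space \<open>S\<close>, transition matrix
  \<open>P\<close> and invariant vector \<open>lam\<close>. By \<open>sets_sequence_space\<close> below, the product \<open>\<sigma>\<close>-algebra is the
  one generated by the cylinders, so \<open>S\<close>, \<open>P\<close> and \<open>lam\<close> determine \<open>M\<close> uniquely.\<close>

locale markov_shift =
  fixes S :: "'s set" and P :: "'s \<Rightarrow> 's \<Rightarrow> real" and lam :: "'s \<Rightarrow> real"
    and M :: "(int \<Rightarrow> 's) measure"
  assumes countable_states: "countable S"
    and P_nonneg: "\<And>s t. s \<in> S \<Longrightarrow> t \<in> S \<Longrightarrow> 0 \<le> P s t"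
    and P_stochastic: "\<And>s. s \<in> S \<Longrightarrow> (P s has_sum 1) S"
    and lam_nonneg: "\<And>s. s \<in> S \<Longrightarrow> 0 \<le> lam s"
    and lam_invariant: "\<And>t. t \<in> S \<Longrightarrow> ((\<lambda>s. lam s * P s t) has_sum lam t) S"
    and lam_infinite: "(\<Sum>\<^sub>\<infinity>s\<in>S. ennreal (lam s)) = \<infinity>"
    and sets_M: "sets M = sets (\<Pi>\<^sub>M j\<in>(UNIV :: int set). count_space S)"
    and emeasure_cylinder: "\<And>k n s. (\<And>j. j \<le> n \<Longrightarrow> s j \<in> S) \<Longrightarrow>
      emeasure M (cylinder S k n s) = ennreal (lam (s 0) * (\<Prod>j<n. P (s j) (s (Suc j))))"

lemma sets_sequence_space:
  assumes "countable S"
  shows "sets (\<Pi>\<^sub>M j\<in>(UNIV :: int set). count_space S) =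
    sigma_sets (UNIV \<rightarrow>\<^sub>E S) {cylinder S k n s | k n s. \<forall>j\<le>n. s j \<in> S}" (is "?L = sigma_sets ?X ?C")
proof (rule antisym)
  have sub: "?C \<subseteq> Pow ?X" by (auto simp: cylinder_def)
  show "?L \<subseteq> sigma_sets ?X ?C"
    unfolding sets_PiM_single space_count_space
  proof (rule sigma_sets_mono, clarify)
    fix i :: int and A assume "A \<in> sets (count_space S)"
    then have A: "A \<subseteq> S" by simp
    have eq: "{f \<in> ?X. f i \<in> A} = (\<Union>a\<in>A. cylinder S i 0 (\<lambda>_. a))"
      by (auto simp: cylinder_def)
    have "(\<Union>a\<in>A. cylinder S i 0 (\<lambda>_. a)) \<in> sigma_sets ?X ?C"
    proof (rule sigma_sets_UNION)
      show "countable ((\<lambda>a. cylinder S i 0 (\<lambda>_. a)) ` A)"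
        using A assms countable_subset by blast
      fix B assume "B \<in> (\<lambda>a. cylinder S i 0 (\<lambda>_. a)) ` A"
      then show "B \<in> sigma_sets ?X ?C" using A by (blast intro: sigma_sets.Basic)
    qed
    then show "{f \<in> ?X. f i \<in> A} \<in> sigma_sets ?X ?C" by (simp only: eq)
  qed
  show "sigma_sets ?X ?C \<subseteq> ?L"
  proof -
    have "cylinder S k n s \<in> ?L" if "\<forall>j\<le>n. s j \<in> S" for k n s
    proof -
      let ?N = "\<Pi>\<^sub>M j\<in>(UNIV :: int set). count_space S"
      have one: "{x \<in> space ?N. x i = a} \<in> sets ?N" if "a \<in> S" for i :: int and a
      proof -
        have "(\<lambda>x. x i) -` {a} \<inter> space ?N \<in> sets ?N"
          by (rule measurable_sets[OF measurable_component_singleton]) (use that in auto)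
        moreover have "(\<lambda>x. x i) -` {a} \<inter> space ?N = {x \<in> space ?N. x i = a}" by blast
        ultimately show ?thesis by (simp only:)
      qed
      have "{x \<in> space ?N. \<forall>j\<in>{..n}. x (int j + k) = s j} \<in> sets ?N"
      proof (rule sets.sets_Collect_finite_All)
        fix j assume "j \<in> {..n}"
        then have "s j \<in> S" using that by blast
        then show "{x \<in> space ?N. x (int j + k) = s j} \<in> sets ?N" by (rule one)
      qed blast
      then show ?thesis by (simp only: cylinder_def space_PiM space_count_space Ball_def atMost_iff)
    qed
    then have "?C \<subseteq> ?L" by blast
    from sets.sigma_sets_subset[OF this] show ?thesis
      by (simp only: space_PiM space_count_space)
  qed
qed

definition preserves_measure :: "'a measure \<Rightarrow> ('a \<Rightarrow> 'a) \<Rightarrow> bool" where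
  "preserves_measure M R \<longleftrightarrow> R \<in> M \<rightarrow>\<^sub>M M \<and> distr M M R = M"

definition conservative :: "'a measure \<Rightarrow> ('a \<Rightarrow> 'a) \<Rightarrow> bool" where
  "conservative M R \<longleftrightarrow>
    (\<forall>A\<in>sets M. A - (\<Union>n\<in>{1..}. (R ^^ n) -` A \<inter> space M) \<in> null_sets M)"

definition ergodic :: "'a measure \<Rightarrow> ('a \<Rightarrow> 'a) \<Rightarrow> bool" where
  "ergodic M R \<longleftrightarrow>
    (\<forall>A\<in>sets M. R -` A \<inter> space M = A \<longrightarrow> A \<in> null_sets M \<or> space M - A \<in> null_sets M)"

text \<open>Isomorphism modulo null sets: \<open>\<phi>\<close> is the conjugating map and \<open>\<psi>\<close> its almost everywhere
  inverse.\<close>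

definition isomorphic :: "'a measure \<Rightarrow> ('a \<Rightarrow> 'a) \<Rightarrow> 'b measure \<Rightarrow> ('b \<Rightarrow> 'b) \<Rightarrow> bool" where
  "isomorphic M R N Q \<longleftrightarrow>
    (\<exists>\<phi> \<psi>. \<phi> \<in> M \<rightarrow>\<^sub>M N \<and> \<psi> \<in> N \<rightarrow>\<^sub>M M \<and> distr M N \<phi> = N \<and> distr N M \<psi> = M \<and>
      (AE x in M. \<psi> (\<phi> x) = x) \<and> (AE y in N. \<phi> (\<psi> y) = y) \<and>
      (AE x in M. \<phi> (R x) = Q (\<phi> x)))"

definition power_space :: "nat \<Rightarrow> 'a measure \<Rightarrow> (nat \<Rightarrow> 'a) measure" where
  "power_space k M = (\<Pi>\<^sub>M i\<in>{..<k}. M)"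

definition power_map :: "nat \<Rightarrow> ('a \<Rightarrow> 'a) \<Rightarrow> (nat \<Rightarrow> 'a) \<Rightarrow> nat \<Rightarrow> 'a" where
  "power_map k R = (\<lambda>x. \<lambda>i\<in>{..<k}. R (x i))"

end

theory Submission
  imports Defs "HOL-Probability.Probability"
begin

text \<open>The shift comes from a renewal process. A log-convex sequence \<open>u\<close> with \<open>u
  0 = 1\<close> that tends to \<open>0\<close> and is not summable is the renewal sequence of a
  probability distribution of gap lengths (Kaluza). The sequence \<open>u n = (n + 1) powr (- 1 /
  k)\<close> is of this kind, and it is chosen because \<open>\<Sum>n. u n ^ k\<close> is the harmonic
  series while \<open>\<Sum>n. u n ^ (k + 1)\<close> converges. The states of the chain are pairs of an
  age, the time since the last renewal, and a residual time: the chain runs deterministically through a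
  gap and draws a new gap at each renewal. The invariant weight of a state is the probability of the gap
  it belongs to, so the total mass is the mean gap length, which is infinite since \<open>u\<close>
  tends to \<open>0\<close>. Exchanging age and residual time reverses the chain
  (\<open>skew_balance\<close>), hence \<open>x \<mapsto> (\<lambda>j. flip (x (- j)))\<close> preserves
  the measure and conjugates the shift to its inverse.

  With the state \<open>(0, 0)\<close> as base, the measure of the set of paths that are in the base at the times
  \<open>0\<close> and \<open>n + 1\<close> is a constant times \<open>u n\<close>. The positive half of the theorem follows from a general
  criterion: if every state of positive weight is reached from the base and the expected number of
  returns to the base is infinite, then the two-sided shift is conservative and ergodic. The \<open>k\<close>-th
  power of the shift is the shift of the product chain, whose expected number of returns is, up to
  constants, \<open>\<Sum>n. u n ^ k\<close>.

  For conservativity, a last visit to the base has the same measure at all times; since the Markov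
  property makes the last visits after a visit at time \<open>0\<close> add up to a multiple of the infinite
  expected number of returns, last visits are null, and almost every path visits the base at
  arbitrarily late times. Translates of a wandering set meet the base event, which has finite
  measure, in disjoint sets, so by Borel--Cantelli the wandering set is null.

  For ergodicity, let \<open>E\<close> be an invariant set and \<open>D\<close> a set of paths in the base at time \<open>0\<close> that is
  determined by the past. Moving forward by \<open>m\<close> returns to the base does not change \<open>E\<close>, but moves any
  window into the future once \<open>m\<close> is large, and there the Markov property makes it independent of
  \<open>D\<close>. Approximation by windows, which survives since the return map does not increase measure,
  shows that \<open>E\<close> is independent of \<open>D\<close> given the base. Moving \<open>D\<close> instead, to the first visit after
  its window, gives independence of \<open>E\<close> from every window, and so from \<open>E\<close> itself.

  For the negative half, the set where all \<open>k + 1\<close> coordinates are in the base has finite positive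
  measure. The \<open>n\<close>-th returns to it have measure proportional to \<open>u n ^ (k + 1)\<close> also under the twisted
  map, since stationarity makes no difference between times \<open>n\<close> and \<open>- n\<close>. These measures are
  summable, so almost no point returns infinitely often, which contradicts conservativity. In an
  ergodic invertible system a wandering set of positive measure cannot be split, since the orbits of
  two disjoint pieces are disjoint invariant sets; here it would be concentrated on one value of the
  last coordinate, yet single paths have measure \<open>0\<close>.\<close>

section \<open>Two-sided paths and windows\<close>

abbreviation paths :: "'s set \<Rightarrow> (int \<Rightarrow> 's) set" where
  "paths S \<equiv> UNIV \<rightarrow>\<^sub>E S"

abbreviation path_space :: "'s set \<Rightarrow> (int \<Rightarrow> 's) measure" where
  "path_space S \<equiv> \<Pi>\<^sub>M j\<in>(UNIV :: int set). count_space S"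

definition shift_by :: "int \<Rightarrow> (int \<Rightarrow> 's) \<Rightarrow> int \<Rightarrow> 's" where
  "shift_by n x = (\<lambda>j. x (j + n))"

lemma shift_by_apply [simp]: "shift_by n x j = x (j + n)"
  by (simp add: shift_by_def)

lemma shift_by_shift_by [simp]: "shift_by m (shift_by n x) = shift_by (m + n) x"
  by (simp add: shift_by_def add.assoc)

lemma shift_by_0 [simp]: "shift_by 0 x = x"
  by (simp add: shift_by_def)

lemma shift_by_in_paths_iff [simp]: "shift_by n x \<in> paths S \<longleftrightarrow> x \<in> paths S"
proof -
  have "x j \<in> S" if "\<forall>i. x (i + n) \<in> S" for j
    using that[rule_format, of "j - n"] by simp
  then have "(\<forall>i. x (i + n) \<in> S) \<longleftrightarrow> (\<forall>j. x j \<in> S)" by blast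
  then show ?thesis by (simp add: PiE_UNIV_domain Pi_iff)
qed

lemma left_shift_eq_shift_by: "left_shift = shift_by 1"
  by (simp add: left_shift_def shift_by_def fun_eq_iff)

lemma left_shift_funpow: "left_shift ^^ n = shift_by (int n)"
  by (induction n) (auto simp: left_shift_eq_shift_by fun_eq_iff ac_simps)

lemma inv_left_shift_eq_shift_by: "inv left_shift = shift_by (- 1)"
  by (simp add: inv_left_shift shift_by_def fun_eq_iff)

lemma measurable_shift_by: "shift_by n \<in> path_space S \<rightarrow>\<^sub>M path_space S"
  unfolding shift_by_def by (rule measurable_PiM_single') (auto simp: space_PiM PiE_UNIV_domain)

text \<open>Two-sided time makes windows around \<open>0\<close> convenient: fixing all coordinates of an interval, with
  the values read off from a full path \<open>z\<close>, avoids any bookkeeping of words and offsets.\<close>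

definition window :: "'s set \<Rightarrow> int \<Rightarrow> int \<Rightarrow> (int \<Rightarrow> 's) \<Rightarrow> (int \<Rightarrow> 's) set" where
  "window S a b z = {x \<in> paths S. \<forall>i\<in>{a..b}. x i = z i}"

lemma coordinate_set_measurable:
  "{x \<in> paths S. x i = s} \<in> sets (path_space S)"
proof (cases "s \<in> S")
  case True
  then have "(\<lambda>x. x i) -` {s} \<inter> space (path_space S) \<in> sets (path_space S)"
    by (intro measurable_sets[OF measurable_component_singleton]) auto
  moreover have "(\<lambda>x. x i) -` {s} \<inter> space (path_space S) = {x \<in> paths S. x i = s}"
    by (auto simp: space_PiM)
  ultimately show ?thesis by simp
next
  case False
  then have "{x \<in> paths S. x i = s} = {}" by (auto simp: PiE_UNIV_domain)
  then show ?thesis by (simp only: sets.empty_sets)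
qed

lemma finite_window_measurable:
  assumes "finite I"
  shows "{x \<in> paths S. \<forall>i\<in>I. x i = z i} \<in> sets (path_space S)"
proof -
  have "{x \<in> space (path_space S). \<forall>i\<in>I. x i = z i} \<in> sets (path_space S)"
    using assms coordinate_set_measurable
    by (intro sets.sets_Collect_finite_All) (simp_all add: space_PiM)
  then show ?thesis by (simp add: space_PiM)
qed

lemma window_measurable [measurable]: "window S a b z \<in> sets (path_space S)"
  unfolding window_def by (rule finite_window_measurable) simp

text \<open>Two centered windows are nested or disjoint, so together with the empty set they form an
  intersection-stable generator. Radius at least \<open>1\<close> is required so that a translate by one step
  still contains the time \<open>0\<close>; this is used to prove stationarity before the weights of windows away
  from \<open>0\<close> are known.\<close>

definition centered_windows :: "'s set \<Rightarrow> (int \<Rightarrow> 's) set set" where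
  "centered_windows S = insert {} {window S (- n) n z | n z. 1 \<le> n \<and> z \<in> paths S}"

lemma centered_windows_Int_stable: "Int_stable (centered_windows S)"
proof -
  have "window S (- m) m y \<inter> window S (- n) n z \<in> centered_windows S"
    if "1 \<le> m" "m \<le> n" "z \<in> paths S" for m n y and z
  proof (cases "\<forall>i\<in>{- m..m}. y i = z i")
    case True
    then have "window S (- m) m y \<inter> window S (- n) n z = window S (- n) n z"
      using that by (auto simp: window_def)
    moreover have "1 \<le> n" using that by simp
    ultimately show ?thesis using that unfolding centered_windows_def by blast
  next
    case False
    then obtain i where i: "i \<in> {- m..m}" "y i \<noteq> z i" by blast
    then have "i \<in> {- n..n}" using that by auto
    then have "x i = y i \<and> x i = z i" if "x \<in> window S (- m) m y \<inter> window S (- n) n z" for x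
      using that i(1) unfolding window_def by blast
    then have "window S (- m) m y \<inter> window S (- n) n z = {}" using i(2) by fastforce
    then show ?thesis by (simp add: centered_windows_def)
  qed
  then have *: "window S (- m) m y \<inter> window S (- n) n z \<in> centered_windows S"
    if "1 \<le> m" "1 \<le> n" "y \<in> paths S" "z \<in> paths S" for m n y z
    using that by (metis Int_commute linear)
  show ?thesis
    unfolding Int_stable_def
  proof (intro ballI)
    fix A B assume "A \<in> centered_windows S" "B \<in> centered_windows S"
    then consider "A = {} \<or> B = {}"
      | m y n z where "A = window S (- m) m y" "1 \<le> m" "y \<in> paths S"
          "B = window S (- n) n z" "1 \<le> n" "z \<in> paths S"
      unfolding centered_windows_def by blast
    then show "A \<inter> B \<in> centered_windows S"
    proof cases
      case 1
      then show ?thesis by (auto simp: centered_windows_def)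
    next
      case 2
      then show ?thesis by (simp only: *)
    qed
  qed
qed

lemma countable_windows:
  assumes "countable S"
  shows "countable {window S a b z | z. z \<in> paths S}"
proof -
  have "{window S a b z | z. z \<in> paths S} \<subseteq> window S a b ` ({a..b} \<rightarrow>\<^sub>E S)"
  proof clarify
    fix z assume "z \<in> paths S"
    then have "window S a b z = window S a b (restrict z {a..b})" "restrict z {a..b} \<in> {a..b} \<rightarrow>\<^sub>E S"
      by (auto simp: window_def PiE_UNIV_domain)
    then show "window S a b z \<in> window S a b ` ({a..b} \<rightarrow>\<^sub>E S)" by blast
  qed
  moreover have "countable ({a..b} \<rightarrow>\<^sub>E S)"
    using assms by (intro countable_PiE) auto
  ultimately show ?thesis by (meson countable_image countable_subset)
qed

lemma sets_path_space_centered_windows: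
  assumes "countable S"
  shows "sets (path_space S) = sigma_sets (paths S) (centered_windows S)"
proof (rule antisym)
  show "sets (path_space S) \<subseteq> sigma_sets (paths S) (centered_windows S)"
    unfolding sets_PiM_single space_count_space
  proof (rule sigma_sets_mono, clarify)
    fix i :: int and A assume A: "A \<in> sets (count_space S)"
    define n where "n = max 1 \<bar>i\<bar>"
    let ?\<W> = "{W \<in> {window S (- n) n z | z. z \<in> paths S}. W \<subseteq> {f \<in> paths S. f i \<in> A}}"
    have "x \<in> \<Union>?\<W>" if "x \<in> paths S" "x i \<in> A" for x
    proof (intro UnionI CollectI conjI)
      show "x \<in> window S (- n) n x" using that by (simp add: window_def)
      show "window S (- n) n x \<subseteq> {f \<in> paths S. f i \<in> A}"
      proof
        fix y assume "y \<in> window S (- n) n x"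
        moreover have "i \<in> {- n..n}" by (auto simp: n_def)
        ultimately have "y \<in> paths S" "y i = x i" unfolding window_def by blast+
        then show "y \<in> {f \<in> paths S. f i \<in> A}" using that by simp
      qed
      show "\<exists>z. window S (- n) n x = window S (- n) n z \<and> z \<in> paths S" using that by blast
    qed
    then have eq: "{f \<in> paths S. f i \<in> A} = \<Union>?\<W>" by blast
    have "\<Union>?\<W> \<in> sigma_sets (paths S) (centered_windows S)"
    proof (rule sigma_sets_UNION)
      show "countable ?\<W>"
        by (rule countable_subset[OF _ countable_windows[OF assms, of "- n" n]]) blast
      fix B assume "B \<in> ?\<W>"
      then show "B \<in> sigma_sets (paths S) (centered_windows S)"
        using max.cobounded1[of 1 "\<bar>i\<bar>"] unfolding centered_windows_def n_def
        by (intro sigma_sets.Basic insertI2) blast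
    qed
    then show "{f \<in> paths S. f i \<in> A} \<in> sigma_sets (paths S) (centered_windows S)"
      by (subst eq)
  qed
  have "centered_windows S \<subseteq> sets (path_space S)"
    by (auto simp: centered_windows_def)
  from sets.sigma_sets_subset[OF this]
  show "sigma_sets (paths S) (centered_windows S) \<subseteq> sets (path_space S)"
    by (simp add: space_PiM)
qed

text \<open>All identities between measures on path space below are proved through this uniqueness
  principle; the windows of radius \<open>1\<close> provide the countable cover by sets of finite measure.\<close>

lemma measure_eqI_windows:
  assumes S: "countable S"
    and M: "sets M = sets (path_space S)" and N: "sets N = sets (path_space S)"
    and eq: "\<And>n z. 1 \<le> n \<Longrightarrow> z \<in> paths S \<Longrightarrow> emeasure M (window S (- n) n z) = emeasure N (window S (- n) n z)"
    and fin: "\<And>n z. 1 \<le> n \<Longrightarrow> z \<in> paths S \<Longrightarrow> emeasure M (window S (- n) n z) \<noteq> \<infinity>"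
  shows "M = N"
proof (rule measure_eqI_generator_eq_countable)
  let ?A = "{window S (- 1) 1 z | z. z \<in> paths S}"
  show "Int_stable (centered_windows S)" by (rule centered_windows_Int_stable)
  show "centered_windows S \<subseteq> Pow (paths S)" by (auto simp: centered_windows_def window_def)
  show "emeasure M X = emeasure N X" if "X \<in> centered_windows S" for X
    using that eq by (auto simp: centered_windows_def)
  show "sets M = sigma_sets (paths S) (centered_windows S)" "sets N = sigma_sets (paths S) (centered_windows S)"
    using M N sets_path_space_centered_windows[OF S] by simp_all
  show "?A \<subseteq> centered_windows S"
    unfolding centered_windows_def by (rule subset_insertI2) (use order_refl[of "1::int"] in blast)
  show "\<Union>?A = paths S"
  proof
    show "paths S \<subseteq> \<Union>?A"
    proof
      fix x assume x: "x \<in> paths S"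
      show "x \<in> \<Union>?A"
      proof (rule UnionI)
        show "window S (- 1) 1 x \<in> ?A" by (intro CollectI exI[of _ x] conjI refl x)
        show "x \<in> window S (- 1) 1 x" using x by (simp add: window_def)
      qed
    qed
  qed (auto simp: window_def)
  show "countable ?A" by (rule countable_windows[OF S])
  show "emeasure M a \<noteq> \<infinity>" if a: "a \<in> ?A" for a
  proof -
    from a obtain z where "a = window S (- 1) 1 z" "z \<in> paths S" by (elim CollectE exE conjE)
    then show ?thesis using fin[of 1 z] by simp
  qed
qed

lemma window_nth: "x \<in> window S a b z \<Longrightarrow> a \<le> i \<Longrightarrow> i \<le> b \<Longrightarrow> x i = z i"
  by (simp add: window_def)

lemma vimage_shift_window:
  "shift_by n -` window S a b z \<inter> paths S = window S (a + n) (b + n) (shift_by (- n) z)"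
proof -
  have "(\<forall>i\<in>{a..b}. x (i + n) = z i) \<longleftrightarrow> (\<forall>i\<in>{a + n..b + n}. x i = z (i - n))" for x
  proof (intro iffI ballI)
    fix i assume "\<forall>i\<in>{a..b}. x (i + n) = z i" "i \<in> {a + n..b + n}"
    then show "x i = z (i - n)" by (auto dest: bspec[of _ _ "i - n"])
  next
    fix i assume "\<forall>i\<in>{a + n..b + n}. x i = z (i - n)" "i \<in> {a..b}"
    then show "x (i + n) = z i" by (auto dest: bspec[of _ _ "i + n"])
  qed
  then show ?thesis by (auto simp: window_def)
qed

section \<open>Path measures and the Markov property\<close>

text \<open>The Markov measure of \<open>window S a b z\<close>.\<close>

definition path_weight :: "('s \<Rightarrow> 's \<Rightarrow> real) \<Rightarrow> ('s \<Rightarrow> real) \<Rightarrow> int \<Rightarrow> int \<Rightarrow> (int \<Rightarrow> 's) \<Rightarrow> real" where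
  "path_weight P lam a b z = lam (z a) * (\<Prod>i\<in>{a..<b}. P (z i) (z (i + 1)))"

lemma path_weight_split:
  assumes "a \<le> b" "b \<le> c" "lam (z b) \<noteq> 0"
  shows "path_weight P lam a c z = path_weight P lam a b z * path_weight P lam b c z / lam (z b)"
proof -
  have "{a..<c} = {a..<b} \<union> {b..<c}" using assms by auto
  then have "(\<Prod>i\<in>{a..<c}. P (z i) (z (i + 1))) =
      (\<Prod>i\<in>{a..<b}. P (z i) (z (i + 1))) * (\<Prod>i\<in>{b..<c}. P (z i) (z (i + 1)))"
    by (simp add: prod.union_disjoint ivl_disj_int)
  then show ?thesis using assms by (simp add: path_weight_def)
qed

lemma path_weight_shift:
  "path_weight P lam a b (shift_by n z) = path_weight P lam (a + n) (b + n) z"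
proof -
  have "(\<Prod>i\<in>{a..<b}. P (z (i + n)) (z (i + 1 + n))) = (\<Prod>i\<in>{a + n..<b + n}. P (z i) (z (i + 1)))"
    by (rule prod.reindex_bij_witness[of _ "\<lambda>i. i - n" "\<lambda>i. i + n"]) (auto simp: ac_simps)
  then show ?thesis by (simp add: path_weight_def)
qed

text \<open>The formula for windows determines the measure, and matrix and vector enter only through it; a
  product chain is an instance as soon as its windows are computed.\<close>

locale path_measure =
  fixes S :: "'s set" and P :: "'s \<Rightarrow> 's \<Rightarrow> real" and lam :: "'s \<Rightarrow> real"
    and M :: "(int \<Rightarrow> 's) measure"
  assumes countable_S: "countable S"
    and P_nonneg: "\<And>s t. s \<in> S \<Longrightarrow> t \<in> S \<Longrightarrow> 0 \<le> P s t"
    and lam_nonneg: "\<And>s. s \<in> S \<Longrightarrow> 0 \<le> lam s"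
    and sets_M: "sets M = sets (path_space S)"
    and emeasure_window: "\<And>a b z. a \<le> b \<Longrightarrow> z \<in> paths S \<Longrightarrow>
      emeasure M (window S a b z) = ennreal (path_weight P lam a b z)"
begin

lemma space_M: "space M = paths S"
  using sets_eq_imp_space_eq[OF sets_M] by (simp add: space_PiM)

lemma path_weight_nonneg: "z \<in> paths S \<Longrightarrow> 0 \<le> path_weight P lam a b z"
  unfolding path_weight_def
  by (intro mult_nonneg_nonneg lam_nonneg prod_nonneg P_nonneg ballI) (auto simp: PiE_UNIV_domain)

lemma measurable_shift_M [measurable]: "shift_by n \<in> M \<rightarrow>\<^sub>M M"
  using measurable_shift_by[of n S] measurable_cong_sets[OF sets_M sets_M] by blast

lemma window_in_sets [measurable]: "window S a b z \<in> sets M"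
  by (simp add: sets_M)

lemma distr_shift: "distr M M (shift_by n) = M"
proof (rule measure_eqI_windows[OF countable_S])
  fix m z assume "1 \<le> (m::int)" and z: "z \<in> paths S"
  have "emeasure (distr M M (shift_by n)) (window S (- m) m z) =
      emeasure M (window S (- m + n) (m + n) (shift_by (- n) z))"
    by (subst emeasure_distr) (simp_all add: space_M vimage_shift_window)
  also have "\<dots> = emeasure M (window S (- m) m z)"
    using \<open>1 \<le> m\<close> z
    by (subst (1 2) emeasure_window) (simp_all add: path_weight_shift)
  finally show "emeasure (distr M M (shift_by n)) (window S (- m) m z) = emeasure M (window S (- m) m z)" .
  then show "emeasure (distr M M (shift_by n)) (window S (- m) m z) \<noteq> \<infinity>"
    using \<open>1 \<le> m\<close> z by (simp add: emeasure_window)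
qed (simp_all add: sets_M)

lemma emeasure_vimage_shift:
  assumes "B \<in> sets M"
  shows "emeasure M (shift_by n -` B \<inter> space M) = emeasure M B"
  using emeasure_distr[OF measurable_shift_M[of n] assms] by (simp add: distr_shift)

lemma vimage_shift_in_sets:
  assumes "B \<in> sets M"
  shows "shift_by n -` B \<inter> space M \<in> sets M"
  using assms by (rule measurable_sets[OF measurable_shift_M])

abbreviation state_at :: "int \<Rightarrow> 's \<Rightarrow> (int \<Rightarrow> 's) set" where
  "state_at i s \<equiv> {x \<in> space M. x i = s}"

lemma state_at_in_sets [measurable]: "state_at i s \<in> sets M"
  using coordinate_set_measurable by (simp add: sets_M space_M)

lemma state_at_eq_window: "state_at i s = window S i i (\<lambda>_. s)"
  by (auto simp: window_def space_M)

lemma emeasure_state_at: "s \<in> S \<Longrightarrow> emeasure M (state_at i s) = ennreal (lam s)"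
  by (simp add: state_at_eq_window emeasure_window path_weight_def PiE_UNIV_domain)

lemma emeasure_state_at_finite: "s \<in> S \<Longrightarrow> emeasure M (state_at i s) < \<infinity>"
  by (simp add: emeasure_state_at)

lemma space_eq_Union_state_at: "space M = (\<Union>s\<in>S. state_at i s)"
  by (auto simp: space_M PiE_UNIV_domain)

lemma sigma_finite: "sigma_finite_measure M"
proof
  show "\<exists>A. countable A \<and> A \<subseteq> sets M \<and> \<Union>A = space M \<and> (\<forall>a\<in>A. emeasure M a \<noteq> \<infinity>)"
    using countable_S space_eq_Union_state_at[of 0]
    by (intro exI[of _ "state_at 0 ` S"]) (auto simp: emeasure_state_at)
qed

text \<open>Membership in \<open>B\<close> depends on the coordinates in \<open>I\<close> only. For measurable \<open>B\<close> this stands for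
  measurability with respect to the \<open>\<sigma>\<close>-algebra of these coordinates, and it is checked pointwise.\<close>

definition determined :: "int set \<Rightarrow> (int \<Rightarrow> 's) set \<Rightarrow> bool" where
  "determined I B \<longleftrightarrow> (\<forall>x\<in>space M. \<forall>y\<in>space M. (\<forall>i\<in>I. x i = y i) \<longrightarrow> (x \<in> B \<longleftrightarrow> y \<in> B))"

lemma determinedD:
  "determined I B \<Longrightarrow> x \<in> space M \<Longrightarrow> y \<in> space M \<Longrightarrow> (\<And>i. i \<in> I \<Longrightarrow> x i = y i) \<Longrightarrow> x \<in> B \<longleftrightarrow> y \<in> B"
  unfolding determined_def by blast

text \<open>Past and future are independent given the present state. Gluing the past of one path to the
  future of another, both in state \<open>s\<close> at time \<open>0\<close>, maps the square of the measure restricted to that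
  event to \<open>lam s\<close> times the restricted measure: on windows this is \<open>path_weight_split\<close>. Under gluing,
  the intersection of a past event and a future event pulls back to a rectangle.\<close>

lemma markov_property_0:
  assumes s: "s \<in> S" and [measurable]: "B \<in> sets M" "D \<in> sets M"
    and B: "determined {..0} B" and D: "determined {0..} D"
  shows "ennreal (lam s) * emeasure M (state_at 0 s \<inter> B \<inter> D) = emeasure M (state_at 0 s \<inter> B) * emeasure M (state_at 0 s \<inter> D)"
proof -
  define A where "A = state_at 0 s"
  define N where "N = restrict_space M A"
  have [measurable]: "A \<in> sets M" by (simp add: A_def)
  have AM: "A \<subseteq> space M" by (auto simp: A_def)
  have fin: "finite_measure N"
    by (rule finite_measureI) (simp add: N_def emeasure_restrict_space space_restrict_space AM A_def
        Int_absorb1 emeasure_state_at s)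
  interpret N: finite_measure N by (rule fin)
  have space_N: "space N = A" using AM by (auto simp: N_def space_restrict_space)
  have sets_N: "X \<inter> A \<in> sets N" if "X \<in> sets M" for X
    using that AM by (auto simp: N_def sets_restrict_space)
  have emeasure_N: "emeasure N (X \<inter> A) = emeasure M (X \<inter> A)" if "X \<in> sets M" for X
    using that AM by (simp add: N_def emeasure_restrict_space)
  \<comment> \<open>the time \<open>0\<close> may be taken from either path, as both are in state \<open>s\<close> there\<close>
  define glue where "glue = (\<lambda>(x :: int \<Rightarrow> 's, y :: int \<Rightarrow> 's). \<lambda>i. if i \<le> 0 then x i else y i)"
  have glue_meas: "glue \<in> N \<Otimes>\<^sub>M N \<rightarrow>\<^sub>M path_space S"
  proof (rule measurable_PiM_single')
    fix i :: int
    have proj: "(\<lambda>x. x i) \<in> N \<rightarrow>\<^sub>M count_space S"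
      unfolding N_def using measurable_component_singleton[of i UNIV "\<lambda>_. count_space S"]
      by (intro measurable_restrict_space1) (simp add: measurable_cong_sets[OF sets_M refl])
    show "(\<lambda>p. glue p i) \<in> N \<Otimes>\<^sub>M N \<rightarrow>\<^sub>M count_space S"
      unfolding glue_def
      using measurable_compose[OF measurable_fst proj] measurable_compose[OF measurable_snd proj]
      by (cases "i \<le> 0") (simp_all add: case_prod_beta)
  qed (auto simp: glue_def space_pair_measure space_N PiE_UNIV_domain Pi_iff
        dest!: AM[unfolded space_M, THEN subsetD])
  have glue_in: "glue p \<in> space M" if "p \<in> space (N \<Otimes>\<^sub>M N)" for p
    using measurable_space[OF glue_meas that] by (simp add: space_M space_PiM)
  have glue_meas': "glue \<in> N \<Otimes>\<^sub>M N \<rightarrow>\<^sub>M M"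
    using glue_meas by (simp add: measurable_cong_sets[OF refl sets_M])
  have eq: "distr (N \<Otimes>\<^sub>M N) M glue = scale_measure (ennreal (lam s)) (density M (indicator A))"
  proof (rule measure_eqI_windows[OF countable_S])
    fix n z assume n: "1 \<le> (n::int)" and z: "z \<in> paths S"
    let ?W = "window S (- n) n z"
    let ?z = "z(0 := s)"
    have z': "?z \<in> paths S" using z s by (auto simp: PiE_UNIV_domain)
    have "glue -` ?W \<inter> space (N \<Otimes>\<^sub>M N) = (window S (- n) 0 z \<inter> A) \<times> (window S 1 n z \<inter> A)"
      (is "_ = ?L \<times> ?R")
    proof (intro set_eqI iffI)
      fix p assume p: "p \<in> glue -` ?W \<inter> space (N \<Otimes>\<^sub>M N)"
      obtain x y where xy: "p = (x, y)" by (cases p)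
      from p have "x \<in> A" "y \<in> A" by (auto simp: xy space_pair_measure space_N)
      then have "x \<in> paths S" "y \<in> paths S" using AM by (auto simp: space_M)
      moreover have "(if i \<le> 0 then x i else y i) = z i" if "i \<in> {- n..n}" for i
        using p that by (auto simp: xy glue_def window_def)
      then have "x i = z i" if "i \<in> {-n..0}" for i
        using that n by (metis atLeastAtMost_iff order.trans zero_le_one)
      moreover have "y i = z i" if "i \<in> {1..n}" for i
        using that n \<open>\<And>i. i \<in> {- n..n} \<Longrightarrow> (if i \<le> 0 then x i else y i) = z i\<close>[of i] by auto
      ultimately show "p \<in> ?L \<times> ?R" using \<open>x \<in> A\<close> \<open>y \<in> A\<close> by (auto simp: xy window_def)
    next
      fix p assume p: "p \<in> ?L \<times> ?R"
      then have "p \<in> space (N \<Otimes>\<^sub>M N)" by (auto simp: space_pair_measure space_N)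
      moreover from this have "glue p \<in> paths S" using glue_in by (simp add: space_M)
      ultimately show "p \<in> glue -` ?W \<inter> space (N \<Otimes>\<^sub>M N)"
        using p n by (auto simp: glue_def window_def)
    qed
    then have "emeasure (distr (N \<Otimes>\<^sub>M N) M glue) ?W = emeasure N ?L * emeasure N ?R"
      by (subst emeasure_distr[OF glue_meas']) (simp_all add: N.emeasure_pair_measure_Times sets_N)
    also have "\<dots> = ennreal (lam s) * emeasure M (A \<inter> ?W)"
    proof (cases "z 0 = s")
      case True
      have "?L = window S (- n) 0 z" using True n by (auto simp: window_def A_def space_M)
      moreover have "?R = window S 0 n z"
      proof -
        have "{0..n} = insert 0 {1..n}" using n by auto
        then show ?thesis using True by (auto simp: window_def A_def space_M)
      qed
      moreover have "A \<inter> ?W = ?W" using True n by (auto simp: window_def A_def space_M)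
      moreover have "path_weight P lam (- n) 0 z * path_weight P lam 0 n z = lam s * path_weight P lam (- n) n z"
      proof (cases "lam s = 0")
        case True
        then show ?thesis using \<open>z 0 = s\<close> by (simp add: path_weight_def)
      next
        case False
        then show ?thesis using n \<open>z 0 = s\<close> path_weight_split[of "- n" 0 n lam z P] by simp
      qed
      ultimately show ?thesis
        using n z s lam_nonneg[OF s] emeasure_N[of "window S (- n) 0 z"] emeasure_N[of "window S 1 n z"]
        by (simp add: emeasure_window path_weight_nonneg flip: ennreal_mult)
    next
      case False
      have notA: "x \<notin> A" if "x \<in> window S (- n) m z" "0 \<le> m" for x m
        using window_nth[OF that(1), of 0] False n that(2) by (simp add: A_def)
      have "?L = {}" using notA[of _ 0] by (simp add: disjoint_iff)
      moreover have "A \<inter> ?W = {}" using notA[of _ n] n by (simp add: disjoint_iff) blast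
      ultimately show ?thesis by simp
    qed
    also have "\<dots> = emeasure (scale_measure (ennreal (lam s)) (density M (indicator A))) ?W"
      by (simp add: emeasure_restricted)
    finally show "emeasure (distr (N \<Otimes>\<^sub>M N) M glue) ?W =
        emeasure (scale_measure (ennreal (lam s)) (density M (indicator A))) ?W" .
    then show "emeasure (distr (N \<Otimes>\<^sub>M N) M glue) ?W \<noteq> \<infinity>"
      using emeasure_mono[of "A \<inter> ?W" ?W M] n z emeasure_window[of "- n" n z]
      by (simp add: emeasure_restricted ennreal_mult_eq_top_iff) (metis ennreal_neq_top top_unique)
  qed (simp_all add: sets_M)
  have "glue -` (B \<inter> D) \<inter> space (N \<Otimes>\<^sub>M N) = (B \<inter> A) \<times> (D \<inter> A)"
  proof -
    have "glue p \<in> B \<longleftrightarrow> fst p \<in> B" "glue p \<in> D \<longleftrightarrow> snd p \<in> D" if "p \<in> space (N \<Otimes>\<^sub>M N)" for p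
    proof -
      have p: "fst p \<in> A" "snd p \<in> A" using that by (auto simp: space_pair_measure space_N)
      then show "glue p \<in> B \<longleftrightarrow> fst p \<in> B"
        using glue_in[OF that] AM by (intro determinedD[OF B]) (auto simp: glue_def case_prod_beta)
      show "glue p \<in> D \<longleftrightarrow> snd p \<in> D"
        using glue_in[OF that] AM p
        by (intro determinedD[OF D]) (auto simp: glue_def case_prod_beta A_def)
    qed
    then show ?thesis by (auto simp: space_pair_measure space_N)
  qed
  then have "emeasure (distr (N \<Otimes>\<^sub>M N) M glue) (B \<inter> D) = emeasure M (B \<inter> A) * emeasure M (D \<inter> A)"
    by (subst emeasure_distr[OF glue_meas']) (simp_all add: N.emeasure_pair_measure_Times sets_N emeasure_N)
  then show ?thesis
    unfolding eq by (simp add: emeasure_restricted A_def Int_commute Int_left_commute Int_assoc)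
qed

lemma coordinate_pred [measurable]: "Measurable.pred M (\<lambda>x. x i = s)"
  unfolding pred_def by (rule state_at_in_sets)

lemma determined_vimage_shift:
  assumes "determined J B" "\<And>j. j \<in> J \<Longrightarrow> j + n \<in> I"
  shows "determined I (shift_by n -` B \<inter> space M)"
  unfolding determined_def
proof (intro ballI impI)
  fix x y assume *: "x \<in> space M" "y \<in> space M" "\<forall>i\<in>I. x i = y i"
  then have "shift_by n x \<in> B \<longleftrightarrow> shift_by n y \<in> B"
    using assms(2) by (intro determinedD[OF assms(1)]) (auto simp: space_M)
  then show "x \<in> shift_by n -` B \<inter> space M \<longleftrightarrow> y \<in> shift_by n -` B \<inter> space M"
    using * by simp
qed

lemma markov_property:
  assumes s: "s \<in> S" and B: "B \<in> sets M" "determined {..j} B" and D: "D \<in> sets M" "determined {j..} D"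
  shows "ennreal (lam s) * emeasure M (state_at j s \<inter> B \<inter> D) =
    emeasure M (state_at j s \<inter> B) * emeasure M (state_at j s \<inter> D)"
proof -
  let ?T = "\<lambda>B. shift_by (- j) -` B \<inter> space M"
  have "determined {..0} (?T B)" by (rule determined_vimage_shift[OF B(2)]) simp
  moreover have "determined {0..} (?T D)" by (rule determined_vimage_shift[OF D(2)]) simp
  ultimately have "ennreal (lam s) * emeasure M (state_at 0 s \<inter> ?T B \<inter> ?T D) =
      emeasure M (state_at 0 s \<inter> ?T B) * emeasure M (state_at 0 s \<inter> ?T D)"
    using B D by (intro markov_property_0 s vimage_shift_in_sets)
  moreover have "state_at 0 s \<inter> ?T B \<inter> ?T D = ?T (state_at j s \<inter> B \<inter> D)"
    "state_at 0 s \<inter> ?T B = ?T (state_at j s \<inter> B)" "state_at 0 s \<inter> ?T D = ?T (state_at j s \<inter> D)"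
    by (auto simp: space_M)
  ultimately show ?thesis
    using B D by (simp only: emeasure_vimage_shift sets.Int state_at_in_sets)
qed

lemma AE_shift:
  assumes "AE x in M. Q x"
  shows "AE x in M. Q (shift_by n x)"
proof -
  have "AE x in distr M M (shift_by n). Q x" unfolding distr_shift by (rule assms)
  then show ?thesis by (rule AE_distrD[OF measurable_shift_M])
qed

text \<open>The Markov property for one step; a state of weight \<open>0\<close> is null and cannot be divided out.\<close>

lemma emeasure_next_state:
  assumes s: "s \<in> S" and t: "t \<in> S" and r: "r \<in> S"
  shows "emeasure M (state_at 0 r \<inter> state_at (int n) s \<inter> state_at (int n + 1) t) =
    emeasure M (state_at 0 r \<inter> state_at (int n) s) * ennreal (P s t)"
proof (cases "lam s = 0")
  case True
  then have "emeasure M (state_at (int n) s) = 0" using emeasure_state_at[OF s] by simp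
  then have null: "state_at (int n) s \<in> null_sets M" by auto
  have "emeasure M (state_at 0 r \<inter> state_at (int n) s \<inter> state_at (int n + 1) t) = 0"
    "emeasure M (state_at 0 r \<inter> state_at (int n) s) = 0"
    by (auto intro!: null_setsD1 null_sets_subset[OF null])
  then show ?thesis by simp
next
  case False
  let ?z = "\<lambda>i. if i = int n then s else t"
  have z: "?z \<in> paths S" using s t by (simp add: PiE_UNIV_domain)
  have "{int n..int n + 1} = {int n, int n + 1}" by auto
  then have "state_at (int n) s \<inter> state_at (int n + 1) t = window S (int n) (int n + 1) ?z"
    by (auto simp: window_def space_M)
  then have two: "emeasure M (state_at (int n) s \<inter> state_at (int n + 1) t) = ennreal (lam s * P s t)"
    using emeasure_window[OF _ z, of "int n" "int n + 1"] by (simp add: path_weight_def)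
  have "ennreal (lam s) * emeasure M (state_at (int n) s \<inter> state_at 0 r \<inter> state_at (int n + 1) t) =
      emeasure M (state_at (int n) s \<inter> state_at 0 r) * emeasure M (state_at (int n) s \<inter> state_at (int n + 1) t)"
    by (rule markov_property[OF s]) (auto simp: determined_def)
  moreover have "state_at (int n) s \<inter> state_at 0 r \<inter> state_at (int n + 1) t =
      state_at 0 r \<inter> state_at (int n) s \<inter> state_at (int n + 1) t"
    "state_at (int n) s \<inter> state_at 0 r = state_at 0 r \<inter> state_at (int n) s" by blast+
  ultimately have "ennreal (lam s) * emeasure M (state_at 0 r \<inter> state_at (int n) s \<inter> state_at (int n + 1) t) =
      ennreal (lam s) * (emeasure M (state_at 0 r \<inter> state_at (int n) s) * ennreal (P s t))"
    by (simp only: two ennreal_mult lam_nonneg P_nonneg s t mult.left_commute)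
  then show ?thesis
    using False lam_nonneg[OF s] by (simp add: ennreal_mult_cancel_left)
qed

lemma emeasure_one_step:
  assumes r: "r \<in> S" and t: "t \<in> S"
  shows "emeasure M (state_at 0 r \<inter> state_at (int n + 1) t) =
    (\<integral>\<^sup>+s. emeasure M (state_at 0 r \<inter> state_at (int n) s) * ennreal (P s t) \<partial>count_space S)"
proof -
  have "emeasure M (state_at 0 r \<inter> state_at (int n + 1) t) =
      emeasure M (\<Union>s\<in>S. state_at 0 r \<inter> state_at (int n) s \<inter> state_at (int n + 1) t)"
    using space_eq_Union_state_at[of "int n"] by (intro arg_cong[where f = "emeasure M"]) blast
  also have "\<dots> = (\<integral>\<^sup>+s. emeasure M (state_at 0 r \<inter> state_at (int n) s \<inter> state_at (int n + 1) t) \<partial>count_space S)"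
    by (rule emeasure_UN_countable) (auto simp: countable_S disjoint_family_on_def)
  also have "\<dots> = (\<integral>\<^sup>+s. emeasure M (state_at 0 r \<inter> state_at (int n) s) * ennreal (P s t) \<partial>count_space S)"
    by (intro nn_integral_cong emeasure_next_state r t) simp
  finally show ?thesis .
qed

end

section \<open>Recurrence and conservativity\<close>

text \<open>The assumption \<open>returns\<close> says that the expected number of returns to the base is infinite, and
  \<open>reaches\<close> is the part of irreducibility that has to be assumed: recurrence of the base then gives
  the way back.\<close>

locale recurrent_path_measure = path_measure S P lam M
  for S :: "'s set" and P lam M +
  fixes base :: 's
  assumes base_in_S: "base \<in> S"
    and lam_base_pos: "0 < lam base"
    and returns: "(\<Sum>n. emeasure M (state_at 0 base \<inter> state_at (int n) base)) = \<infinity>"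
    and reaches: "\<And>s. s \<in> S \<Longrightarrow> 0 < lam s \<Longrightarrow>
      \<exists>n. emeasure M (state_at 0 base \<inter> state_at (int n) s) \<noteq> 0"
begin

definition last_visit :: "int \<Rightarrow> (int \<Rightarrow> 's) set" where
  "last_visit n = {x \<in> space M. x n = base \<and> (\<forall>j>n. x j \<noteq> base)}"

lemma last_visit_in_sets [measurable]: "last_visit n \<in> sets M"
  unfolding last_visit_def by measurable

lemma vimage_shift_last_visit: "shift_by n -` last_visit m \<inter> space M = last_visit (m + n)"
proof -
  have "(\<forall>j>m. x (j + n) \<noteq> base) \<longleftrightarrow> (\<forall>j>m + n. x j \<noteq> base)" for x
  proof (intro iffI allI impI)
    fix j assume "\<forall>j>m. x (j + n) \<noteq> base" "m + n < j"
    then show "x j \<noteq> base" by (auto dest: spec[of _ "j - n"])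
  next
    fix j assume "\<forall>j>m + n. x j \<noteq> base" "m < j"
    then show "x (j + n) \<noteq> base" by simp
  qed
  then show ?thesis by (auto simp: last_visit_def space_M)
qed

text \<open>The sets of paths that are in the base at time \<open>0\<close> and last visit it at time \<open>n \<ge> 0\<close> are
  disjoint, so their measures have a finite sum. By the Markov property at time \<open>n\<close> these measures
  are the terms of \<open>returns\<close>, multiplied by the measure of a last visit at time \<open>0\<close>, up to a constant.\<close>

lemma emeasure_last_visit: "emeasure M (last_visit n) = 0"
proof -
  let ?A = "state_at 0 base"
  have shift: "emeasure M (last_visit n) = emeasure M (last_visit 0)" for n
    using emeasure_vimage_shift[of "last_visit 0" n] by (simp add: vimage_shift_last_visit)
  have "disjoint_family (\<lambda>n. ?A \<inter> last_visit (int n))"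
    unfolding disjoint_family_on_def
  proof (intro ballI impI)
    fix m n :: nat assume "m \<noteq> n"
    then show "(?A \<inter> last_visit (int m)) \<inter> (?A \<inter> last_visit (int n)) = {}"
      by (cases "m < n") (auto simp: last_visit_def)
  qed
  then have "(\<Sum>n. emeasure M (?A \<inter> last_visit (int n))) = emeasure M (\<Union>n. ?A \<inter> last_visit (int n))"
    by (intro suminf_emeasure) auto
  also have "\<dots> \<le> emeasure M ?A" by (intro emeasure_mono) auto
  also have "\<dots> = ennreal (lam base)" by (rule emeasure_state_at[OF base_in_S])
  finally have "(\<Sum>n. emeasure M (?A \<inter> last_visit (int n))) < \<infinity>"
    using le_less_trans ennreal_less_top by fastforce
  then have "ennreal (lam base) * (\<Sum>n. emeasure M (?A \<inter> last_visit (int n))) < \<infinity>"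
    by (simp add: ennreal_mult_less_top)
  moreover have "ennreal (lam base) * emeasure M (?A \<inter> last_visit (int n)) =
      emeasure M (?A \<inter> state_at (int n) base) * emeasure M (last_visit 0)" for n
  proof -
    have "determined {..int n} ?A" by (auto simp: determined_def)
    moreover have "determined {int n..} (last_visit (int n))"
      by (auto simp: determined_def last_visit_def)
    ultimately have "ennreal (lam base) * emeasure M (state_at (int n) base \<inter> ?A \<inter> last_visit (int n)) =
        emeasure M (state_at (int n) base \<inter> ?A) * emeasure M (state_at (int n) base \<inter> last_visit (int n))"
      by (intro markov_property base_in_S) auto
    moreover have "state_at (int n) base \<inter> last_visit (int n) = last_visit (int n)"
      "state_at (int n) base \<inter> ?A \<inter> last_visit (int n) = ?A \<inter> last_visit (int n)"
      by (auto simp: last_visit_def)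
    ultimately show ?thesis by (simp add: shift[of "int n"] Int_commute)
  qed
  ultimately have "(\<Sum>n. emeasure M (?A \<inter> state_at (int n) base)) * emeasure M (last_visit 0) < \<infinity>"
    by (simp flip: ennreal_suminf_cmult)
  then show ?thesis unfolding returns shift[of n]
    by (simp add: ennreal_top_mult split: if_splits)
qed

text \<open>If paths from a state \<open>s\<close> of positive weight avoided the base forever with positive
  probability, then so would paths that start in the base and reach \<open>s\<close>; such paths have a last visit.\<close>

lemma AE_visits_base: "AE x in M. \<forall>m. \<exists>n\<ge>m. x n = base"
proof -
  let ?A = "state_at 0 base"
  have null: "emeasure M {x \<in> space M. x 0 = s \<and> (\<forall>n\<ge>0. x n \<noteq> base)} = 0" (is "emeasure M ?Z = 0")
    if s: "s \<in> S" for s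
  proof (cases "lam s = 0")
    case True
    have "emeasure M ?Z \<le> emeasure M (state_at 0 s)" by (intro emeasure_mono) auto
    then show ?thesis using True by (simp add: emeasure_state_at s)
  next
    case False
    then have pos: "0 < lam s" using lam_nonneg[OF s] by simp
    from reaches[OF s this] obtain j where j: "emeasure M (?A \<inter> state_at (int j) s) \<noteq> 0" ..
    let ?D = "shift_by (int j) -` ?Z \<inter> space M"
    have Z [measurable]: "?Z \<in> sets M" by measurable
    have "?A \<inter> ?D \<subseteq> (\<Union>n. last_visit (int n))"
    proof
      fix x assume x: "x \<in> ?A \<inter> ?D"
      define n where "n = Max {n. n \<le> j \<and> x (int n) = base}"
      have "n \<in> {n. n \<le> j \<and> x (int n) = base}"
        unfolding n_def using x by (intro Max_in) auto
      moreover have "x i \<noteq> base" if "int n < i" for i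
      proof (cases "i \<le> int j")
        case True
        have "x (int (nat i)) \<noteq> base"
        proof
          assume "x (int (nat i)) = base"
          then have "nat i \<le> n" using True unfolding n_def by (intro Max_ge) auto
          then show False using that by simp
        qed
        then show ?thesis using that by simp
      next
        case False
        then show ?thesis using x by (auto dest: spec[of _ "i - int j"])
      qed
      ultimately show "x \<in> (\<Union>n. last_visit (int n))" using x by (auto simp: last_visit_def)
    qed
    moreover have "(\<Union>n. last_visit (int n)) \<in> null_sets M"
      by (intro null_sets_UN null_setsI) (auto simp: emeasure_last_visit)
    ultimately have 0: "emeasure M (?A \<inter> ?D) = 0"
      by (intro null_setsD1[OF null_sets_subset]) (auto intro: vimage_shift_in_sets)
    have "determined {..int j} ?A" by (auto simp: determined_def)
    moreover have "determined {0..} ?Z" by (auto simp: determined_def)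
    then have "determined {int j..} ?D" by (rule determined_vimage_shift) simp
    ultimately have "ennreal (lam s) * emeasure M (state_at (int j) s \<inter> ?A \<inter> ?D) =
        emeasure M (state_at (int j) s \<inter> ?A) * emeasure M (state_at (int j) s \<inter> ?D)"
      by (intro markov_property s vimage_shift_in_sets) auto
    moreover have "state_at (int j) s \<inter> ?D = ?D" "state_at (int j) s \<inter> ?A \<inter> ?D = ?A \<inter> ?D"
      by auto
    ultimately have "ennreal (lam s) * emeasure M (?A \<inter> ?D) = emeasure M (?A \<inter> state_at (int j) s) * emeasure M ?D"
      by (simp only: Int_commute)
    then have "emeasure M (?A \<inter> state_at (int j) s) * emeasure M ?D = 0"
      unfolding 0 mult_zero_right by (rule sym)
    from iffD1[OF mult_eq_0_iff this] have "emeasure M ?D = 0" using j by blast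
    then show ?thesis by (simp only: emeasure_vimage_shift[OF Z])
  qed
  let ?Z = "\<Union>s\<in>S. {x \<in> space M. x 0 = s \<and> (\<forall>n\<ge>0. x n \<noteq> base)}"
  have "AE x in M. \<exists>n\<ge>0. x n = base"
  proof (rule AE_I')
    show "?Z \<in> null_sets M"
      using countable_S null by (intro null_sets_UN') (auto intro!: null_setsI)
    show "{x \<in> space M. \<not> (\<exists>n\<ge>0. x n = base)} \<subseteq> ?Z"
      by (auto simp: space_M PiE_UNIV_domain)
  qed
  then have "AE x in M. \<exists>n\<ge>0. shift_by m x n = base" for m by (rule AE_shift)
  then have "AE x in M. \<forall>m. \<exists>n\<ge>0. shift_by m x n = base" by (simp add: AE_all_countable)
  then show ?thesis
  proof eventually_elim
    case (elim x)
    show ?case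
    proof
      fix m
      from elim obtain n where "n \<ge> 0" "x (n + m) = base" by auto
      then show "\<exists>n\<ge>m. x n = base" by (intro exI[of _ "n + m"]) auto
    qed
  qed
qed

text \<open>Let \<open>W\<close> be wandering. Its parts that visit the base at time \<open>n\<close>, moved by \<open>n\<close> steps, are disjoint
  subsets of the base event, which has finite measure. By Borel--Cantelli almost every point of \<open>W\<close>
  visits the base finitely often, so \<open>W\<close> is null.\<close>

theorem conservative_left_shift: "conservative M left_shift"
  unfolding conservative_def
proof
  fix B assume B [measurable]: "B \<in> sets M"
  \<comment> \<open>the part of \<open>B\<close> that never comes back, a wandering set\<close>
  define W where "W = B - (\<Union>n\<in>{1..}. (left_shift ^^ n) -` B \<inter> space M)"
  have W [measurable]: "W \<in> sets M"
    unfolding W_def left_shift_funpow using B by (intro sets.Diff sets.countable_UN'') (auto intro: vimage_shift_in_sets)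
  have WM: "W \<subseteq> space M" using sets.sets_into_space[OF W] .
  have wandering: "shift_by (int n) x \<notin> W" if "x \<in> W" "1 \<le> n" for x n
    using that WM by (auto simp: W_def left_shift_funpow)
  define V where "V = (\<lambda>n::nat. W \<inter> state_at (int n) base)"
  have V [measurable]: "V n \<in> sets M" for n by (simp add: V_def)
  let ?U = "\<lambda>n. shift_by (- int n) -` V n \<inter> space M"
  have "disjoint_family ?U"
  proof -
    have "?U m \<inter> ?U n = {}" if "m < n" for m n
    proof -
      have "x \<notin> ?U n" if x: "x \<in> ?U m" for x
      proof
        assume "x \<in> ?U n"
        then have "shift_by (int (n - m)) (shift_by (- int n) x) \<notin> W"
          using \<open>m < n\<close> by (intro wandering) (auto simp: V_def)
        then show False using x \<open>m < n\<close> by (simp add: V_def of_nat_diff)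
      qed
      then show ?thesis by blast
    qed
    then show ?thesis
      unfolding disjoint_family_on_def by (metis Int_commute linorder_neqE_nat)
  qed
  then have "(\<Sum>n. emeasure M (?U n)) = emeasure M (\<Union>n. ?U n)"
    by (intro suminf_emeasure) (auto intro: vimage_shift_in_sets)
  also have "\<dots> \<le> emeasure M (state_at 0 base)"
    by (intro emeasure_mono) (auto simp: V_def)
  also have "\<dots> < \<infinity>" using emeasure_state_at[OF base_in_S] by simp
  finally have fin: "(\<Sum>n. emeasure M (V n)) < \<infinity>" by (simp add: emeasure_vimage_shift)
  have finV: "emeasure M (V n) < \<infinity>" for n
    using emeasure_mono[of "V n" "state_at (int n) base" M] emeasure_state_at_finite[OF base_in_S, of "int n"]
    by (auto simp: V_def intro: le_less_trans)
  have "summable (\<lambda>n. measure M (V n))"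
  proof (rule summable_suminf_not_top)
    have "(\<Sum>n. ennreal (measure M (V n))) = (\<Sum>n. emeasure M (V n))"
      by (intro suminf_cong) (simp add: emeasure_eq_ennreal_measure[OF less_imp_neq[OF finV[unfolded infinity_ennreal_def]]])
    then show "(\<Sum>n. ennreal (measure M (V n))) \<noteq> \<top>" using fin by simp
  qed simp
  then have "AE x in M. \<forall>\<^sub>F n in sequentially. x \<in> space M - V n"
    using finV by (intro borel_cantelli_AE1) auto
  with AE_visits_base have "AE x in M. x \<notin> W"
  proof eventually_elim
    case (elim x)
    from elim(2) obtain N where N: "\<And>n. N \<le> n \<Longrightarrow> x \<notin> V n"
      by (auto simp: eventually_sequentially)
    from elim(1) obtain i where "int N \<le> i" "x i = base" by blast
    then have "x (int (nat i)) = base" "N \<le> nat i" by auto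
    then show ?case using N[of "nat i"] WM by (auto simp: V_def)
  qed
  then show "B - (\<Union>n\<in>{1..}. (left_shift ^^ n) -` B \<inter> space M) \<in> null_sets M"
    using W AE_iff_null_sets[OF W] by (simp add: W_def)
qed

end

section \<open>Recurrence and ergodicity\<close>

context recurrent_path_measure
begin

text \<open>Recurrence is built into the domain of the return map, so that the map is iterated without
  exceptional sets; the difference to the base event is null (\<open>AE_recurrent_paths\<close>).\<close>

definition recurrent_paths :: "(int \<Rightarrow> 's) set" where
  "recurrent_paths = {x \<in> space M. x 0 = base \<and> (\<forall>m. \<exists>n\<ge>m. x n = base)}"

definition return_time :: "(int \<Rightarrow> 's) \<Rightarrow> nat" where
  "return_time x = (LEAST n. 1 \<le> n \<and> x (int n) = base)"

definition return_map :: "(int \<Rightarrow> 's) \<Rightarrow> int \<Rightarrow> 's" where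
  "return_map x = shift_by (int (return_time x)) x"

text \<open>The preimage of \<open>B\<close> under the \<open>m\<close>-th return to the base.\<close>

definition returns_into :: "nat \<Rightarrow> (int \<Rightarrow> 's) set \<Rightarrow> (int \<Rightarrow> 's) set" where
  "returns_into m B = {x \<in> recurrent_paths. (return_map ^^ m) x \<in> B}"

lemma recurrent_paths_in_sets [measurable]: "recurrent_paths \<in> sets M"
  unfolding recurrent_paths_def by measurable

lemma recurrent_paths_space: "recurrent_paths \<subseteq> space M"
  by (auto simp: recurrent_paths_def)

lemma return_time_exists:
  assumes "x \<in> recurrent_paths"
  shows "\<exists>n. 1 \<le> n \<and> x (int n) = base"
proof -
  from assms obtain n where "1 \<le> n" "x n = base" by (auto simp: recurrent_paths_def)
  then show ?thesis by (intro exI[of _ "nat n"]) auto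
qed

lemma return_time:
  assumes "x \<in> recurrent_paths"
  shows "1 \<le> return_time x" "x (int (return_time x)) = base"
  using LeastI_ex[OF return_time_exists[OF assms]] unfolding return_time_def by auto

lemma return_time_minimal: "1 \<le> i \<Longrightarrow> i < return_time x \<Longrightarrow> x (int i) \<noteq> base"
  using not_less_Least[of i "\<lambda>n. 1 \<le> n \<and> x (int n) = base"] by (auto simp: return_time_def)

lemma return_time_eq_iff:
  assumes "x \<in> recurrent_paths"
  shows "return_time x = n \<longleftrightarrow> 1 \<le> n \<and> x (int n) = base \<and> (\<forall>i. 1 \<le> i \<longrightarrow> i < n \<longrightarrow> x (int i) \<noteq> base)"
  using return_time[OF assms] return_time_minimal[of _ x]
  by (metis linorder_neqE_nat)

lemma return_map_recurrent: "x \<in> recurrent_paths \<Longrightarrow> return_map x \<in> recurrent_paths"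
proof -
  assume x: "x \<in> recurrent_paths"
  have "\<exists>n\<ge>m. x (n + k) = base" for m k
  proof -
    from x obtain n where "m + k \<le> n" "x n = base" unfolding recurrent_paths_def by blast
    then show ?thesis by (intro exI[of _ "n - k"]) auto
  qed
  then show ?thesis
    using x return_time(2)[OF x] by (auto simp: recurrent_paths_def return_map_def space_M)
qed

lemma return_map_funpow_recurrent: "x \<in> recurrent_paths \<Longrightarrow> (return_map ^^ m) x \<in> recurrent_paths"
  by (induction m) (auto intro: return_map_recurrent)

lemma return_map_funpow_shift: "\<exists>n. (return_map ^^ m) x = shift_by n x"
proof (induction m)
  case 0
  show ?case by (intro exI[of _ 0]) simp
next
  case (Suc m)
  then obtain n where "(return_map ^^ m) x = shift_by n x" ..
  then show ?case by (auto simp: return_map_def[of "shift_by n x"])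
qed

lemma returns_into_Suc: "returns_into (Suc m) B = returns_into 1 (returns_into m B)"
  using return_map_recurrent by (auto simp: returns_into_def funpow_swap1)

lemma returns_into_Int_recurrent: "returns_into m (recurrent_paths \<inter> B) = returns_into m B"
  using return_map_funpow_recurrent by (auto simp: returns_into_def)

lemma returns_into_1_decomposition:
  "returns_into 1 B = (\<Union>n. {x \<in> recurrent_paths. return_time x = n} \<inter> (shift_by (int n) -` B \<inter> space M))"
  using recurrent_paths_space by (auto simp: returns_into_def return_map_def)

lemma return_time_in_sets [measurable]: "{x \<in> recurrent_paths. return_time x = n} \<in> sets M"
proof -
  have "{x \<in> recurrent_paths. return_time x = n} = recurrent_paths \<inter>
      {x \<in> space M. 1 \<le> n \<and> x (int n) = base \<and> (\<forall>i. 1 \<le> i \<longrightarrow> i < n \<longrightarrow> x (int i) \<noteq> base)}"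
    using return_time_eq_iff recurrent_paths_space by blast
  also have "\<dots> \<in> sets M" by measurable
  finally show ?thesis .
qed

lemma returns_into_1_in_sets: "B \<in> sets M \<Longrightarrow> returns_into 1 B \<in> sets M"
  unfolding returns_into_1_decomposition
  by (intro sets.countable_UN' sets.Int return_time_in_sets vimage_shift_in_sets) auto

lemma returns_into_in_sets: "B \<in> sets M \<Longrightarrow> returns_into m B \<in> sets M"
proof (induction m)
  case 0
  then show ?case by (simp add: returns_into_def Collect_conj_eq Collect_mem_eq)
next
  case (Suc m)
  then show ?case unfolding returns_into_Suc by (intro returns_into_1_in_sets)
qed

text \<open>Different return times lead to different images, since the return time of a path can be read
  off backwards from its image as the time since the preceding visit. Hence the pieces, moved
  forward by their return times, are disjoint subsets of \<open>B\<close>.\<close>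

lemma emeasure_returns_into_1_le:
  assumes [measurable]: "B \<in> sets M"
  shows "emeasure M (returns_into 1 B) \<le> emeasure M B"
proof -
  let ?V = "\<lambda>n. {x \<in> recurrent_paths. return_time x = n} \<inter> (shift_by (int n) -` B \<inter> space M)"
  let ?U = "\<lambda>n. shift_by (- int n) -` ?V n \<inter> space M"
  have V [measurable]: "?V n \<in> sets M" for n
    by (intro sets.Int return_time_in_sets vimage_shift_in_sets assms)
  have disj: "disjoint_family ?U"
  proof -
    have "?U m \<inter> ?U n = {}" if "m < n" for m n
    proof -
      have False if x: "x \<in> ?U m" "x \<in> ?U n" for x
      proof -
        \<comment> \<open>the path \<open>?y\<close> visits the base at time \<open>n - m\<close>, before its return time \<open>n\<close>\<close>
        let ?y = "shift_by (- int n) x"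
        have y: "?y \<in> recurrent_paths" "return_time ?y = n" using x(2) by auto
        have m: "shift_by (- int m) x \<in> recurrent_paths" "return_time (shift_by (- int m) x) = m" using x(1) by auto
        then have "1 \<le> m" using return_time(1) by force
        have "x (- int m) = base" using m(1) by (simp add: recurrent_paths_def)
        then have "?y (int (n - m)) = base" using \<open>m < n\<close> by (simp add: of_nat_diff)
        moreover have "1 \<le> n - m" "n - m < n" using \<open>m < n\<close> \<open>1 \<le> m\<close> by auto
        ultimately show False
          using return_time_minimal[of "n - m" ?y] y(2) by (simp only: not_True_eq_False)
      qed
      then show ?thesis by blast
    qed
    then show ?thesis
      unfolding disjoint_family_on_def by (metis (lifting) Int_commute linorder_neqE_nat)
  qed
  have "emeasure M (returns_into 1 B) = emeasure M (\<Union>n. ?V n)"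
    unfolding returns_into_1_decomposition ..
  also have "\<dots> \<le> (\<Sum>n. emeasure M (?V n))"
    by (rule emeasure_subadditive_countably) (use V in auto)
  also have "\<dots> = (\<Sum>n. emeasure M (?U n))"
    by (intro suminf_cong emeasure_vimage_shift[symmetric] V)
  also have "\<dots> = emeasure M (\<Union>n. ?U n)"
    by (rule suminf_emeasure[OF image_subsetI disj]) (rule vimage_shift_in_sets[OF V])
  also have "\<dots> \<le> emeasure M B"
    by (intro emeasure_mono) auto
  finally show ?thesis .
qed

lemma emeasure_returns_into_le:
  assumes "B \<in> sets M"
  shows "emeasure M (returns_into m B) \<le> emeasure M (recurrent_paths \<inter> B)"
proof -
  have "emeasure M (returns_into m B) \<le> emeasure M B" if "B \<in> sets M" for B
  proof (induction m)
    case 0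
    show ?case by (intro emeasure_mono that) (auto simp: returns_into_def)
  next
    case (Suc m)
    have "emeasure M (returns_into (Suc m) B) \<le> emeasure M (returns_into m B)"
      unfolding returns_into_Suc by (intro emeasure_returns_into_1_le returns_into_in_sets that)
    with Suc show ?case by (rule order_trans[rotated])
  qed
  from this[of "recurrent_paths \<inter> B"] show ?thesis
    using assms by (simp add: returns_into_Int_recurrent)
qed

lemma return_map_agree:
  assumes "x \<in> recurrent_paths" "y \<in> recurrent_paths" "\<And>i. j \<le> i \<Longrightarrow> x i = y i" "j \<le> 0" "j - 1 \<le> i"
  shows "return_map x i = return_map y i"
proof -
  have "return_time x = return_time y"
    unfolding return_time_eq_iff[OF assms(1)]
    using return_time[OF assms(2)] return_time_minimal[of _ y] assms(3,4) by auto
  moreover have "x (i + int (return_time x)) = y (i + int (return_time x))"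
    using return_time(1)[OF assms(1)] assms(5) by (intro assms(3)) auto
  ultimately show ?thesis by (simp add: return_map_def)
qed

lemma return_map_funpow_agree:
  assumes "x \<in> recurrent_paths" "y \<in> recurrent_paths" "\<And>i. 0 \<le> i \<Longrightarrow> x i = y i" "- int m \<le> i"
  shows "(return_map ^^ m) x i = (return_map ^^ m) y i"
  using assms(4)
proof (induction m arbitrary: i)
  case 0
  then show ?case using assms(3) by simp
next
  case (Suc m)
  have "return_map ((return_map ^^ m) x) i = return_map ((return_map ^^ m) y) i"
    by (rule return_map_agree[where j = "- int m"])
       (use Suc assms(1,2) in \<open>auto intro: return_map_funpow_recurrent\<close>)
  then show ?case by simp
qed

lemma recurrent_paths_agree:
  assumes "x \<in> recurrent_paths" "y \<in> space M" "\<And>i. 0 \<le> i \<Longrightarrow> x i = y i"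
  shows "y \<in> recurrent_paths"
proof -
  have "\<exists>n\<ge>m. y n = base" for m
  proof -
    from assms(1) obtain n where "max 0 m \<le> n" "x n = base" unfolding recurrent_paths_def by blast
    then show ?thesis using assms(3)[of n] by (intro exI[of _ n]) auto
  qed
  moreover have "y 0 = base" using assms(1) assms(3)[of 0] by (simp add: recurrent_paths_def)
  ultimately show ?thesis using assms(2) by (simp add: recurrent_paths_def)
qed

text \<open>Each return moves a path by at least one step, so \<open>m\<close> returns push a set that looks back at most
  \<open>m\<close> steps entirely into the future.\<close>

lemma determined_returns_into:
  assumes "determined {- int m..} B"
  shows "determined {0..} (returns_into m B)"
  unfolding determined_def
proof (intro ballI impI)
  fix x y assume xy: "x \<in> space M" "y \<in> space M" "\<forall>i\<in>{0..}. x i = y i"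
  show "x \<in> returns_into m B \<longleftrightarrow> y \<in> returns_into m B"
  proof (cases "x \<in> recurrent_paths")
    case True
    then have y: "y \<in> recurrent_paths" using xy by (auto intro: recurrent_paths_agree)
    have "(return_map ^^ m) x \<in> B \<longleftrightarrow> (return_map ^^ m) y \<in> B"
      using True y xy return_map_funpow_recurrent recurrent_paths_space
      by (intro determinedD[OF assms]) (auto intro!: return_map_funpow_agree)
    then show ?thesis using True y by (simp add: returns_into_def)
  next
    case False
    then have "y \<notin> recurrent_paths" using xy by (auto dest: recurrent_paths_agree[of y x])
    with False show ?thesis by (simp add: returns_into_def)
  qed
qed


lemma AE_recurrent_paths: "AE x in M. x 0 = base \<longrightarrow> x \<in> recurrent_paths"
  using AE_visits_base AE_space by eventually_elim (simp add: recurrent_paths_def)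

lemma emeasure_recurrent_Int:
  assumes "B \<in> sets M"
  shows "emeasure M (recurrent_paths \<inter> B) = emeasure M (state_at 0 base \<inter> B)"
proof (rule emeasure_eq_AE)
  show "AE x in M. x \<in> recurrent_paths \<inter> B \<longleftrightarrow> x \<in> state_at 0 base \<inter> B"
    using AE_recurrent_paths by eventually_elim (auto simp: recurrent_paths_def)
qed (use assms in auto)

lemma emeasure_recurrent_paths: "emeasure M recurrent_paths = ennreal (lam base)"
  using emeasure_recurrent_Int[of "space M"] recurrent_paths_space emeasure_state_at[OF base_in_S, of 0]
  by (simp add: Int_absorb2)

lemma emeasure_state_at_Int_finite: "emeasure M (state_at 0 base \<inter> B) < \<infinity>"
proof -
  have "emeasure M (state_at 0 base \<inter> B) \<le> emeasure M (state_at 0 base)" by (intro emeasure_mono) auto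
  then show ?thesis using emeasure_state_at_finite[OF base_in_S, of 0] by (rule le_less_trans)
qed

lemma emeasure_recurrent_subset_finite:
  assumes "X \<subseteq> recurrent_paths"
  shows "emeasure M X < \<infinity>"
proof -
  have "emeasure M X \<le> emeasure M recurrent_paths" using assms by (intro emeasure_mono) auto
  then show ?thesis by (simp add: emeasure_recurrent_paths le_less_trans)
qed

lemma determined_window:
  assumes "{a..b} \<subseteq> I"
  shows "determined I (window S a b z)"
  unfolding determined_def
proof (intro ballI impI)
  fix x y assume "x \<in> space M" "y \<in> space M" "\<forall>i\<in>I. x i = y i"
  moreover from this have "\<forall>i\<in>{a..b}. x i = y i" using assms by blast
  ultimately show "x \<in> window S a b z \<longleftrightarrow> y \<in> window S a b z" by (simp add: window_def space_M)
qed

text \<open>For \<open>D\<close> inside the base event at time \<open>0\<close>, this vanishes exactly when, given that event, \<open>D\<close> is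
  independent of the \<open>m\<close>-th return falling into \<open>B\<close>.\<close>

definition correlation_defect :: "(int \<Rightarrow> 's) set \<Rightarrow> nat \<Rightarrow> (int \<Rightarrow> 's) set \<Rightarrow> real" where
  "correlation_defect D m B =
    lam base * measure M (D \<inter> returns_into m B) - measure M D * measure M (returns_into m B)"

text \<open>For a window the defect is \<open>0\<close> as soon as \<open>m\<close> reaches its radius, by the Markov property. The sets
  for which the defect tends to \<open>0\<close> form a Dynkin system: for disjoint unions the limit is taken under
  the sum by Tannery's theorem, with a summable bound supplied by \<open>emeasure_returns_into_le\<close>.\<close>

lemma correlation_defect_tendsto_0:
  assumes D [measurable]: "D \<in> sets M" and past: "determined {..0} D" and DA: "D \<subseteq> state_at 0 base"
    and B: "B \<in> sets M"
  shows "(\<lambda>m. correlation_defect D m B) \<longlonglongrightarrow> 0"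
proof -
  let ?A = "state_at 0 base"
  note returns_into_in_sets [measurable]
  have sub: "returns_into m X \<subseteq> recurrent_paths" for m X by (auto simp: returns_into_def)
  have D_le: "measure M D \<le> lam base"
  proof -
    have "emeasure M D \<le> ennreal (lam base)"
      using emeasure_mono[OF DA, of M] emeasure_state_at[OF base_in_S, of 0] by simp
    then show ?thesis using lam_base_pos by (simp add: measure_def enn2real_leI)
  qed
  have DR: "measure M (D \<inter> recurrent_paths) = measure M D"
  proof -
    have "?A \<inter> D = D" using DA by blast
    then show ?thesis using emeasure_recurrent_Int[OF D] by (simp add: measure_def Int_commute)
  qed
  have R: "measure M recurrent_paths = lam base"
    using emeasure_recurrent_paths lam_base_pos by (simp add: measure_def)
  have sub_paths: "centered_windows S \<subseteq> Pow (paths S)" by (auto simp: centered_windows_def window_def)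
  show ?thesis
    using centered_windows_Int_stable sub_paths B[unfolded sets_M sets_path_space_centered_windows[OF countable_S]]
  proof (induction rule: sigma_sets_induct_disjoint)
    case (basic B)
    have zero: "correlation_defect D m B = 0" if B: "B \<in> sets M" "determined {- int m..} B" for m
    proof -
      have "ennreal (lam base) * emeasure M (?A \<inter> D \<inter> returns_into m B) =
          emeasure M (?A \<inter> D) * emeasure M (?A \<inter> returns_into m B)"
        by (intro markov_property_0 base_in_S D past returns_into_in_sets determined_returns_into B)
      moreover have "?A \<inter> D = D" "?A \<inter> returns_into m B = returns_into m B"
        using DA sub recurrent_paths_def by auto
      ultimately have "enn2real (ennreal (lam base) * emeasure M (D \<inter> returns_into m B)) =
          enn2real (emeasure M D * emeasure M (returns_into m B))" by simp
      then show ?thesis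
        using lam_base_pos by (simp add: correlation_defect_def measure_def enn2real_mult)
    qed
    show ?case
    proof (cases "B = {}")
      case True
      then show ?thesis by (simp add: correlation_defect_def returns_into_def)
    next
      case False
      with basic obtain n z where B: "B = window S (- n) n z" by (auto simp: centered_windows_def)
      have "correlation_defect D m B = 0" if "nat n \<le> m" for m
      proof (rule zero)
        show "B \<in> sets M" by (simp add: B)
        show "determined {- int m..} B"
          using that unfolding B by (intro determined_window) auto
      qed
      then have "\<forall>\<^sub>F m in sequentially. correlation_defect D m B = 0"
        by (auto simp: eventually_sequentially)
      then show ?thesis by (rule tendsto_eventually)
    qed
  next
    case empty
    show ?case by (simp add: correlation_defect_def returns_into_def)
  next
    case (compl B)
    then have [measurable]: "B \<in> sets M"
      by (simp add: sets_M sets_path_space_centered_windows[OF countable_S])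
    have "correlation_defect D m (paths S - B) = - correlation_defect D m B" for m
    proof -
      have eq: "returns_into m (paths S - B) = recurrent_paths - returns_into m B"
        using return_map_funpow_recurrent recurrent_paths_space
        by (auto simp: returns_into_def space_M)
      have "measure M (recurrent_paths - returns_into m B) = lam base - measure M (returns_into m B)"
        using sub[of m B] emeasure_recurrent_subset_finite[of recurrent_paths]
        by (subst measure_Diff) (auto simp: R)
      moreover have "D \<inter> (recurrent_paths - returns_into m B) = D \<inter> recurrent_paths - D \<inter> returns_into m B"
        by blast
      moreover have "measure M (D \<inter> recurrent_paths - D \<inter> returns_into m B) =
          measure M D - measure M (D \<inter> returns_into m B)"
        using sub[of m B] emeasure_recurrent_subset_finite[of "D \<inter> recurrent_paths"]
        by (subst measure_Diff) (auto simp: DR)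
      ultimately show ?thesis
        unfolding correlation_defect_def eq by (simp only:) (simp add: algebra_simps)
    qed
    then show ?case using tendsto_minus[OF compl.IH] by simp
  next
    case (union B)
    then have B [measurable]: "B i \<in> sets M" for i
      by (auto simp: sets_M sets_path_space_centered_windows[OF countable_S])
    have sums: "(\<lambda>i. measure M (X i)) sums measure M (\<Union>i. X i)"
      if "\<And>i. X i \<in> sets M" "disjoint_family X" "\<And>i. X i \<subseteq> recurrent_paths" for X
    proof (rule measure_UNION)
      have "(\<Union>i. X i) \<subseteq> recurrent_paths" using that(3) by blast
      then show "emeasure M (\<Union>i. X i) \<noteq> \<infinity>"
        using emeasure_recurrent_subset_finite less_imp_neq by blast
    qed (use that in auto)
    have disj: "disjoint_family (\<lambda>i. returns_into m (B i))" for m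
      using union.hyps unfolding disjoint_family_on_def returns_into_def by blast
    have UN: "returns_into m (\<Union>i. B i) = (\<Union>i. returns_into m (B i))" for m
      by (auto simp: returns_into_def)
    have defect_sums: "(\<lambda>i. correlation_defect D m (B i)) sums correlation_defect D m (\<Union>i. B i)" for m
    proof -
      have "(\<lambda>i. measure M (D \<inter> returns_into m (B i))) sums measure M (\<Union>i. D \<inter> returns_into m (B i))"
        using disj[of m] by (intro sums) (auto simp: disjoint_family_on_def intro: subsetD[OF sub])
      moreover have "(\<lambda>i. measure M (returns_into m (B i))) sums measure M (\<Union>i. returns_into m (B i))"
        using disj[of m] sub by (intro sums) auto
      ultimately show ?thesis
        unfolding correlation_defect_def UN Int_UN_distrib
        by (intro sums_diff sums_mult)
    qed
    have bound: "norm (correlation_defect D m X) \<le> 2 * lam base * measure M (recurrent_paths \<inter> X)"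
      if X: "X \<in> sets M" for m X
    proof -
      have fin: "emeasure M (recurrent_paths \<inter> X) < \<infinity>"
        by (rule emeasure_recurrent_subset_finite) auto
      have 1: "measure M (returns_into m X) \<le> measure M (recurrent_paths \<inter> X)"
        using emeasure_returns_into_le[OF X, of m] fin unfolding measure_def
        by (intro enn2real_mono) auto
      moreover have "measure M (D \<inter> returns_into m X) \<le> measure M (returns_into m X)"
        using emeasure_recurrent_subset_finite[OF sub, of m X] X unfolding measure_def
        by (intro enn2real_mono emeasure_mono) auto
      ultimately have 2: "measure M (D \<inter> returns_into m X) \<le> measure M (recurrent_paths \<inter> X)"
        by simp
      have "lam base * measure M (D \<inter> returns_into m X) \<le> lam base * measure M (recurrent_paths \<inter> X)"
        using 2 lam_base_pos by simp
      moreover have "measure M D * measure M (returns_into m X) \<le> lam base * measure M (recurrent_paths \<inter> X)"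
        using 1 D_le lam_base_pos by (intro mult_mono) auto
      moreover have "0 \<le> lam base * measure M (D \<inter> returns_into m X)"
        "0 \<le> measure M D * measure M (returns_into m X)" using lam_base_pos by auto
      ultimately show ?thesis unfolding correlation_defect_def real_norm_def by linarith
    qed
    have "disjoint_family (\<lambda>i. recurrent_paths \<inter> B i)"
      using union.hyps unfolding disjoint_family_on_def by blast
    then have "summable (\<lambda>i. measure M (recurrent_paths \<inter> B i))"
      by (intro sums_summable[OF sums]) auto
    then have "summable (\<lambda>i. 2 * lam base * measure M (recurrent_paths \<inter> B i))"
      by (rule summable_mult)
    moreover have "\<forall>\<^sub>F (i, m) in at_top \<times>\<^sub>F sequentially.
        norm (correlation_defect D m (B i)) \<le> 2 * lam base * measure M (recurrent_paths \<inter> B i)"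
      using bound[OF B] by (intro always_eventually) auto
    ultimately have "(\<lambda>m. \<Sum>i. correlation_defect D m (B i)) \<longlonglongrightarrow> (\<Sum>i. 0)"
      using tannerys_theorem[of "\<lambda>i m. correlation_defect D m (B i)" "\<lambda>_. 0" sequentially] union.IH by simp
    then show ?case using sums_unique[OF defect_sums] by simp
  qed
qed

definition invariant :: "(int \<Rightarrow> 's) set \<Rightarrow> bool" where
  "invariant E \<longleftrightarrow> E \<in> sets M \<and> (\<forall>n. \<forall>x\<in>space M. shift_by n x \<in> E \<longleftrightarrow> x \<in> E)"

text \<open>For an invariant set \<open>E\<close> the sets \<open>returns_into m E\<close> do not depend on \<open>m\<close>, so the defect is
  constant, and hence equal to its limit \<open>0\<close>.\<close>

lemma invariant_independent_of_past:
  assumes E: "invariant E" and D [measurable]: "D \<in> sets M" "determined {..0} D" "D \<subseteq> state_at 0 base"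
  shows "ennreal (lam base) * emeasure M (D \<inter> E) = emeasure M D * emeasure M (state_at 0 base \<inter> E)"
proof -
  let ?A = "state_at 0 base"
  have [measurable]: "E \<in> sets M" using E by (simp add: invariant_def)
  have "returns_into m E = recurrent_paths \<inter> E" for m
  proof -
    have "(return_map ^^ m) x \<in> E \<longleftrightarrow> x \<in> E" if "x \<in> recurrent_paths" for x
      using return_map_funpow_shift[of m x] E recurrent_paths_space that by (auto simp: invariant_def)
    then show ?thesis by (auto simp: returns_into_def)
  qed
  then have "(\<lambda>m::nat. correlation_defect D 0 E) \<longlonglongrightarrow> 0"
    using correlation_defect_tendsto_0[OF D, of E] by (simp add: correlation_defect_def)
  then have defect: "correlation_defect D 0 E = 0" by (simp add: LIMSEQ_const_iff)
  have "returns_into 0 E = recurrent_paths \<inter> E" by (auto simp: returns_into_def)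
  moreover have "?A \<inter> (D \<inter> E) = D \<inter> E" using D(3) by blast
  moreover have "measure M (recurrent_paths \<inter> X) = measure M (?A \<inter> X)" if "X \<in> sets M" for X
    using emeasure_recurrent_Int[OF that] by (simp add: measure_def)
  from this[of E] this[of "D \<inter> E"]
  have "measure M (recurrent_paths \<inter> E) = measure M (?A \<inter> E)"
    "measure M (D \<inter> (recurrent_paths \<inter> E)) = measure M (D \<inter> E)"
    using \<open>?A \<inter> (D \<inter> E) = D \<inter> E\<close> by (simp_all add: Int_left_commute)
  ultimately have eq: "lam base * measure M (D \<inter> E) = measure M D * measure M (?A \<inter> E)"
    using defect by (simp add: correlation_defect_def)
  have fin: "emeasure M X = ennreal (measure M X)" if "X \<subseteq> ?A" for X
    using emeasure_state_at_Int_finite[of X] that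
    by (intro emeasure_eq_ennreal_measure) (auto simp: Int_absorb1)
  have "emeasure M (D \<inter> E) = ennreal (measure M (D \<inter> E))" "emeasure M D = ennreal (measure M D)"
    "emeasure M (?A \<inter> E) = ennreal (measure M (?A \<inter> E))"
    using D(3) by (auto intro!: fin)
  then show ?thesis
    using eq lam_base_pos by (simp flip: ennreal_mult)
qed

text \<open>The event is cut according to the first visit to the base at or after time \<open>n\<close>. Moving each
  piece to that visit places it in the base at time \<open>0\<close> with all its information in the past, and
  leaves \<open>E\<close> unchanged.\<close>

lemma invariant_independent_of_window:
  assumes E: "invariant E" and D [measurable]: "D \<in> sets M" and det: "determined {..int n} D"
  shows "ennreal (lam base) * emeasure M (state_at 0 base \<inter> D \<inter> E) =
    emeasure M (state_at 0 base \<inter> D) * emeasure M (state_at 0 base \<inter> E)"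
proof -
  let ?A = "state_at 0 base"
  have [measurable]: "E \<in> sets M" using E by (simp add: invariant_def)
  \<comment> \<open>the first visit to the base at or after time \<open>n\<close> happens at time \<open>n + j\<close>\<close>
  define V where "V = (\<lambda>j. {x \<in> space M. x 0 = base \<and> x \<in> D \<and> x (int (n + j)) = base \<and>
    (\<forall>i<j. x (int (n + i)) \<noteq> base)})"
  have V [measurable]: "V j \<in> sets M" for j unfolding V_def by measurable
  have disj: "disjoint_family V"
    unfolding disjoint_family_on_def V_def by (auto, metis linorder_neqE_nat)
  have cover: "AE x in M. x \<in> ?A \<inter> D \<longleftrightarrow> x \<in> (\<Union>j. V j)"
    using AE_visits_base AE_space
  proof eventually_elim
    case (elim x)
    have "x \<in> (\<Union>j. V j)" if x: "x \<in> ?A \<inter> D"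
    proof -
      from elim obtain m where "int n \<le> m" "x m = base" by blast
      then have ex: "\<exists>j. x (int (n + j)) = base" by (intro exI[of _ "nat (m - int n)"]) simp
      have "x \<in> V (LEAST j. x (int (n + j)) = base)"
        using LeastI_ex[OF ex] not_less_Least[of _ "\<lambda>j. x (int (n + j)) = base"] x by (auto simp: V_def)
      then show ?thesis by blast
    qed
    then show ?case by (auto simp: V_def)
  qed
  have part: "ennreal (lam base) * emeasure M (V j \<inter> E) = emeasure M (V j) * emeasure M (?A \<inter> E)" for j
  proof -
    let ?T = "\<lambda>X. shift_by (- int (n + j)) -` X \<inter> space M"
    have "determined {..int (n + j)} (V j)"
      unfolding determined_def
    proof (intro ballI impI)
      fix x y assume xy: "x \<in> space M" "y \<in> space M" "\<forall>i\<in>{..int (n + j)}. x i = y i"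
      then have "x \<in> D \<longleftrightarrow> y \<in> D" by (intro determinedD[OF det]) auto
      then show "x \<in> V j \<longleftrightarrow> y \<in> V j" using xy by (auto simp: V_def)
    qed
    then have "determined {..0} (?T (V j))" by (rule determined_vimage_shift) simp
    moreover have "?T (V j) \<subseteq> ?A" by (auto simp: V_def)
    ultimately have "ennreal (lam base) * emeasure M (?T (V j) \<inter> E) = emeasure M (?T (V j)) * emeasure M (?A \<inter> E)"
      by (intro invariant_independent_of_past E vimage_shift_in_sets V)
    moreover have "?T (V j) \<inter> E = ?T (V j \<inter> E)" using E by (auto simp: invariant_def)
    ultimately show ?thesis by (simp only: emeasure_vimage_shift V sets.Int \<open>E \<in> sets M\<close>)
  qed
  have "emeasure M (?A \<inter> D \<inter> E) = emeasure M (\<Union>j. V j \<inter> E)"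
    using cover by (intro emeasure_eq_AE) auto
  also have "\<dots> = (\<Sum>j. emeasure M (V j \<inter> E))"
    using disj by (intro suminf_emeasure[symmetric]) (auto simp: disjoint_family_on_def)
  finally have "ennreal (lam base) * emeasure M (?A \<inter> D \<inter> E) = (\<Sum>j. emeasure M (V j)) * emeasure M (?A \<inter> E)"
    by (simp add: part flip: ennreal_suminf_cmult ennreal_suminf_multc)
  also have "(\<Sum>j. emeasure M (V j)) = emeasure M (\<Union>j. V j)"
    using disj by (intro suminf_emeasure) auto
  also have "\<dots> = emeasure M (?A \<inter> D)"
    using cover by (intro emeasure_eq_AE) auto
  finally show ?thesis .
qed

text \<open>By the preceding lemma and uniqueness of measures, \<open>E\<close> is independent of every measurable set
  given the base, in particular of itself; so its conditional probability \<open>p\<close> satisfies \<open>p = p * p\<close>.\<close>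

lemma invariant_at_base:
  assumes E: "invariant E"
  shows "emeasure M (state_at 0 base \<inter> E) = 0 \<or> emeasure M (state_at 0 base - E) = 0"
proof -
  let ?A = "state_at 0 base"
  have [measurable]: "E \<in> sets M" using E by (simp add: invariant_def)
  have "scale_measure (ennreal (lam base)) (density M (indicator (?A \<inter> E))) =
      scale_measure (emeasure M (?A \<inter> E)) (density M (indicator ?A))" (is "?N1 = ?N2")
  proof (rule measure_eqI_windows[OF countable_S])
    fix n z assume n: "1 \<le> (n :: int)"
    let ?W = "window S (- n) n z"
    have "determined {..int (nat n)} ?W" using n by (intro determined_window) auto
    then have "ennreal (lam base) * emeasure M (?A \<inter> ?W \<inter> E) = emeasure M (?A \<inter> ?W) * emeasure M (?A \<inter> E)"
      by (intro invariant_independent_of_window[where n = "nat n"] E) auto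
    then show "emeasure ?N1 ?W = emeasure ?N2 ?W"
      by (simp add: emeasure_restricted Int_assoc Int_commute Int_left_commute mult.commute)
    show "emeasure ?N1 ?W \<noteq> \<infinity>"
      using emeasure_state_at_Int_finite[of "E \<inter> ?W"]
      by (simp add: emeasure_restricted ennreal_mult_eq_top_iff Int_assoc less_top)
  qed (simp_all add: sets_M)
  then have "emeasure ?N1 E = emeasure ?N2 E" by simp
  then have eq: "ennreal (lam base) * emeasure M (?A \<inter> E) = emeasure M (?A \<inter> E) * emeasure M (?A \<inter> E)"
    by (simp add: emeasure_restricted Int_assoc)
  show ?thesis
  proof (cases "emeasure M (?A \<inter> E) = 0")
    case False
    then have "emeasure M (?A \<inter> E) = ennreal (lam base)"
      using eq emeasure_state_at_Int_finite[of E] unfolding mult.commute[of "ennreal (lam base)"]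
      by (auto simp: ennreal_mult_cancel_left less_top)
    moreover have "emeasure M (?A - E) = emeasure M ?A - emeasure M (?A \<inter> E)"
    proof -
      have "?A - E = ?A - ?A \<inter> E" by blast
      then show ?thesis using emeasure_state_at_Int_finite[of E] by (simp add: emeasure_Diff)
    qed
    ultimately show ?thesis by (simp add: emeasure_state_at[OF base_in_S])
  qed simp
qed

lemma invariant_null:
  assumes E: "invariant E" and 0: "emeasure M (state_at 0 base \<inter> E) = 0"
  shows "E \<in> null_sets M"
proof -
  have [measurable]: "E \<in> sets M" using E by (simp add: invariant_def)
  have "AE x in M. x \<notin> state_at 0 base \<inter> E"
    using 0 by (subst AE_iff_null_sets[symmetric]) (auto intro: null_setsI)
  then have "AE x in M. shift_by n x \<notin> state_at 0 base \<inter> E" for n by (rule AE_shift)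
  then have "AE x in M. \<forall>n. shift_by n x \<notin> state_at 0 base \<inter> E" by (simp add: AE_all_countable)
  with AE_visits_base AE_space have "AE x in M. x \<notin> E"
  proof eventually_elim
    case (elim x)
    from elim(1) obtain n where "x n = base" by blast
    then show ?case using elim(2) elim(3)[rule_format, of n] E by (auto simp: invariant_def space_M)
  qed
  then show ?thesis by (simp add: AE_iff_null_sets)
qed

theorem ergodic_left_shift: "ergodic M left_shift"
  unfolding ergodic_def
proof (intro ballI impI)
  fix E assume E [measurable]: "E \<in> sets M" and inv: "left_shift -` E \<inter> space M = E"
  have step: "shift_by 1 x \<in> E \<longleftrightarrow> x \<in> E" if "x \<in> space M" for x
    using inv that by (auto simp: left_shift_eq_shift_by)
  have nat: "shift_by (int n) x \<in> E \<longleftrightarrow> x \<in> E" if "x \<in> space M" for x n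
  proof (induction n)
    case (Suc n)
    have "shift_by 1 (shift_by (int n) x) \<in> E \<longleftrightarrow> shift_by (int n) x \<in> E"
      using that by (intro step) (simp add: space_M)
    moreover have "shift_by (int (Suc n)) x = shift_by 1 (shift_by (int n) x)" by (simp add: add.commute)
    ultimately show ?case using Suc by (simp only:)
  qed simp
  have "shift_by n x \<in> E \<longleftrightarrow> x \<in> E" if "x \<in> space M" for x n
  proof (cases "0 \<le> n")
    case True
    then show ?thesis using nat[OF that, of "nat n"] by simp
  next
    case False
    then show ?thesis using nat[of "shift_by n x" "nat (- n)"] that by (simp add: space_M)
  qed
  moreover have "space M - E \<in> sets M" by measurable
  ultimately have inv: "invariant E" "invariant (space M - E)"
    by (auto simp: invariant_def space_M)
  from invariant_at_base[OF inv(1)] show "E \<in> null_sets M \<or> space M - E \<in> null_sets M"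
  proof
    assume "emeasure M (state_at 0 base \<inter> E) = 0"
    then show ?thesis using invariant_null[OF inv(1)] by blast
  next
    assume "emeasure M (state_at 0 base - E) = 0"
    moreover have "state_at 0 base \<inter> (space M - E) = state_at 0 base - E" by blast
    ultimately show ?thesis using invariant_null[OF inv(2)] by simp
  qed
qed

end

section \<open>Existence of path measures\<close>

text \<open>If \<open>Q\<close> is the transition matrix of the reversed chain, a window may be read backwards. Stepping
  the reversal through all factors one by one also covers states of weight \<open>0\<close>.\<close>

lemma path_weight_reverse:
  assumes "a \<le> b" and balance: "\<And>s t. lam s * P s t = lam t * Q t s"
  shows "path_weight P lam a b z = lam (z b) * (\<Prod>i\<in>{a..<b}. Q (z (i + 1)) (z i))"
  using assms(1)
proof (induction b rule: int_ge_induct)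
  case base
  show ?case by (simp add: path_weight_def)
next
  case (step b)
  have "{a..<b + 1} = insert b {a..<b}" using step.hyps by auto
  then have "path_weight P lam a (b + 1) z = path_weight P lam a b z * P (z b) (z (b + 1))"
    by (simp add: path_weight_def)
  also have "\<dots> = (lam (z b) * P (z b) (z (b + 1))) * (\<Prod>i\<in>{a..<b}. Q (z (i + 1)) (z i))"
    by (simp add: step.IH)
  also have "\<dots> = lam (z (b + 1)) * (\<Prod>i\<in>{a..<b + 1}. Q (z (i + 1)) (z i))"
    using \<open>{a..<b + 1} = insert b {a..<b}\<close> by (simp add: balance[of "z b"])
  finally show ?case .
qed

text \<open>A chain is driven by independent random maps: \<open>\<omega> i\<close> is a map on the states, applied to the state
  at time \<open>i\<close> when going forward, and to the state at time \<open>i + 1\<close> when going backward.\<close>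

primrec forward_path :: "'s \<Rightarrow> (int \<Rightarrow> 's \<Rightarrow> 's) \<Rightarrow> nat \<Rightarrow> 's" where
  "forward_path s \<omega> 0 = s"
| "forward_path s \<omega> (Suc n) = \<omega> (int n) (forward_path s \<omega> n)"

primrec backward_path :: "'s \<Rightarrow> (int \<Rightarrow> 's \<Rightarrow> 's) \<Rightarrow> nat \<Rightarrow> 's" where
  "backward_path s \<omega> 0 = s"
| "backward_path s \<omega> (Suc n) = \<omega> (- int n - 1) (backward_path s \<omega> n)"

definition driven_path :: "'s \<times> (int \<Rightarrow> 's \<Rightarrow> 's) \<Rightarrow> int \<Rightarrow> 's" where
  "driven_path p i =
    (if 0 \<le> i then forward_path (fst p) (snd p) (nat i) else backward_path (fst p) (snd p) (nat (- i)))"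

lemma driven_path_0: "driven_path p 0 = fst p"
  by (simp add: driven_path_def)

lemma driven_path_step_forward:
  assumes "0 \<le> i"
  shows "driven_path p (i + 1) = snd p i (driven_path p i)"
proof -
  have "nat (i + 1) = Suc (nat i)" using assms by simp
  then show ?thesis using assms by (simp add: driven_path_def)
qed

lemma driven_path_step_backward:
  assumes "i < 0"
  shows "driven_path p i = snd p i (driven_path p (i + 1))"
proof -
  have "nat (- i) = Suc (nat (- i - 1))" "- int (nat (- i - 1)) - 1 = i" using assms by auto
  moreover have "driven_path p (i + 1) = backward_path (fst p) (snd p) (nat (- i - 1))"
    using assms by (cases "i + 1 = 0") (auto simp: driven_path_def)
  ultimately show ?thesis using assms by (simp add: driven_path_def)
qed

text \<open>A driven path follows \<open>z\<close> if and only if it starts right and each random map takes one prescribed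
  value. This is an event on independent coordinates, so its probability is a product.\<close>

lemma driven_path_in_window_iff:
  assumes "a \<le> 0" "0 \<le> b"
  shows "driven_path p \<in> window UNIV a b z \<longleftrightarrow>
    fst p = z 0 \<and> (\<forall>i\<in>{a..<b}. if 0 \<le> i then snd p i (z i) = z (i + 1) else snd p i (z (i + 1)) = z i)"
proof
  assume *: "driven_path p \<in> window UNIV a b z"
  then have nth: "driven_path p i = z i" if "a \<le> i" "i \<le> b" for i using that by (rule window_nth)
  have "fst p = z 0" using nth[of 0] assms by (simp add: driven_path_0)
  moreover have "if 0 \<le> i then snd p i (z i) = z (i + 1) else snd p i (z (i + 1)) = z i" if "i \<in> {a..<b}" for i
    using that nth[of i] nth[of "i + 1"] driven_path_step_forward[of i p] driven_path_step_backward[of i p] by auto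
  ultimately show "fst p = z 0 \<and> (\<forall>i\<in>{a..<b}. if 0 \<le> i then snd p i (z i) = z (i + 1) else snd p i (z (i + 1)) = z i)"
    by blast
next
  assume *: "fst p = z 0 \<and> (\<forall>i\<in>{a..<b}. if 0 \<le> i then snd p i (z i) = z (i + 1) else snd p i (z (i + 1)) = z i)"
  have forward: "driven_path p (int n) = z (int n)" if "int n \<le> b" for n
    using that
  proof (induction n)
    case 0
    then show ?case using * by (simp add: driven_path_0)
  next
    case (Suc n)
    have "driven_path p (int n + 1) = snd p (int n) (driven_path p (int n))"
      by (rule driven_path_step_forward) simp
    moreover have "snd p (int n) (z (int n)) = z (int n + 1)"
      using *[THEN conjunct2, rule_format, of "int n"] Suc.prems assms by simp
    ultimately show ?case using Suc by (simp add: add.commute)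
  qed
  have backward: "driven_path p (- int n) = z (- int n)" if "a \<le> - int n" for n
    using that
  proof (induction n)
    case 0
    then show ?case using * by (simp add: driven_path_0)
  next
    case (Suc n)
    have "driven_path p (- int n - 1) = snd p (- int n - 1) (driven_path p (- int n))"
      using driven_path_step_backward[of "- int n - 1" p] by simp
    moreover have "snd p (- int n - 1) (z (- int n)) = z (- int n - 1)"
      using *[THEN conjunct2, rule_format, of "- int n - 1"] Suc.prems assms by simp
    moreover have "- int (Suc n) = - int n - 1" "a \<le> - int n" using Suc.prems by simp_all
    ultimately show ?case using Suc.IH by (simp only:)
  qed
  have "driven_path p i = z i" if "a \<le> i" "i \<le> b" for i
    using forward[of "nat i"] backward[of "nat (- i)"] that by (cases "0 \<le> i") auto
  then show "driven_path p \<in> window UNIV a b z" by (simp add: window_def)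
qed

text \<open>The state at time \<open>0\<close> is distributed according to \<open>lam\<close>, and independent random maps drive it
  forward with kernel \<open>K\<close> and backward with the reversed kernel \<open>K'\<close>. By \<open>path_weight_reverse\<close>, windows
  containing time \<open>0\<close> have the required measure. Windows of radius at least \<open>1\<close> moved by one step
  still contain \<open>0\<close>, so the measure is stationary, and any window can be moved to \<open>0\<close>.\<close>

lemma exists_path_measure:
  fixes lam :: "'s :: countable \<Rightarrow> real" and K K' :: "'s \<Rightarrow> 's pmf"
  assumes lam: "\<And>s. 0 \<le> lam s"
    and balance: "\<And>s t. lam s * pmf (K s) t = lam t * pmf (K' t) s"
  obtains M where "path_measure UNIV (\<lambda>s. pmf (K s)) lam M"
proof -
  let ?P = "\<lambda>s. pmf (K s)"
  define start where "start = density (count_space UNIV) (\<lambda>s. ennreal (lam s))"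
  define kernel where "kernel = (\<lambda>i::int. if 0 \<le> i then K else K')"
  define maps where "maps = (\<lambda>i. \<Pi>\<^sub>M s\<in>(UNIV::'s set). measure_pmf (kernel i s))"
  define drive where "drive = (\<Pi>\<^sub>M i\<in>(UNIV::int set). maps i)"
  have pmf_sp: "product_prob_space (\<lambda>s. measure_pmf (kernel i s))" for i
    unfolding product_prob_space_def product_sigma_finite_def product_prob_space_axioms_def
    by (simp add: prob_space_imp_sigma_finite measure_pmf.prob_space_axioms)
  have maps_prob: "prob_space (maps i)" for i
    unfolding maps_def by (rule prob_space_PiM) (rule measure_pmf.prob_space_axioms)
  have drive_sp: "product_prob_space maps"
    unfolding product_prob_space_def product_sigma_finite_def product_prob_space_axioms_def
    by (simp add: prob_space_imp_sigma_finite maps_prob)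
  interpret drive: prob_space drive
    unfolding drive_def by (rule prob_space_PiM) (rule maps_prob)
  have maps_sets: "{f \<in> space (maps i). f s = t} \<in> sets (maps i)" for i s t
    unfolding maps_def by measurable
  have space_maps: "space (maps i) = UNIV" for i by (simp add: maps_def space_PiM)
  have space_drive: "space drive = UNIV" by (simp add: drive_def space_PiM space_maps)
  have space_start: "space start = UNIV" by (simp add: start_def)
  have emeasure_maps: "emeasure (maps i) {f. f s = t} = ennreal (pmf (kernel i s) t)" for i s t
    using product_prob_space.emeasure_PiM_Collect_single[OF pmf_sp, of s UNIV "{t}" i]
    by (simp add: maps_def space_PiM emeasure_pmf_single)
  have eval [measurable]: "(\<lambda>\<omega>. \<omega> i s) \<in> drive \<rightarrow>\<^sub>M count_space UNIV" for i s
  proof -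
    have "(\<lambda>f. f s) \<in> maps i \<rightarrow>\<^sub>M count_space UNIV"
      unfolding maps_def using measurable_component_singleton[of s UNIV "\<lambda>s. measure_pmf (kernel i s)"]
      by (simp add: measurable_cong_sets[OF refl sets_measure_pmf_count_space])
    moreover have "(\<lambda>\<omega>. \<omega> i) \<in> drive \<rightarrow>\<^sub>M maps i"
      unfolding drive_def by (rule measurable_component_singleton) simp
    ultimately show ?thesis by (rule measurable_compose[rotated])
  qed
  have fst_meas [measurable]: "fst \<in> start \<Otimes>\<^sub>M drive \<rightarrow>\<^sub>M count_space UNIV"
    using measurable_fst[of start drive] by (simp add: start_def measurable_cong_sets)
  have forward [measurable]: "(\<lambda>p. forward_path (fst p) (snd p) n) \<in> start \<Otimes>\<^sub>M drive \<rightarrow>\<^sub>M count_space UNIV" for n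
  proof (induction n)
    case (Suc n)
    then show ?case
      by (auto intro!: measurable_compose_countable[OF _ Suc] measurable_compose[OF measurable_snd eval])
  qed simp
  have backward [measurable]: "(\<lambda>p. backward_path (fst p) (snd p) n) \<in> start \<Otimes>\<^sub>M drive \<rightarrow>\<^sub>M count_space UNIV" for n
  proof (induction n)
    case (Suc n)
    then show ?case
      by (auto intro!: measurable_compose_countable[OF _ Suc] measurable_compose[OF measurable_snd eval])
  qed simp
  have path_meas: "driven_path \<in> start \<Otimes>\<^sub>M drive \<rightarrow>\<^sub>M path_space UNIV"
    by (rule measurable_PiM_single') (auto simp: driven_path_def cong: if_cong)
  define N where "N = distr (start \<Otimes>\<^sub>M drive) (path_space UNIV) driven_path"
  have window_0: "emeasure N (window UNIV a b z) = ennreal (path_weight ?P lam a b z)"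
    if ab: "a \<le> 0" "0 \<le> b" for a b z
  proof -
    define F where "F = (\<lambda>i::int. if 0 \<le> i then {f. f (z i) = z (i + 1)} else {f. f (z (i + 1)) = z i})"
    have F: "F i \<in> sets (maps i)" for i
      using maps_sets[of i] by (simp add: F_def space_maps)
    have "driven_path -` window UNIV a b z \<inter> space (start \<Otimes>\<^sub>M drive) =
        {z 0} \<times> {\<omega> \<in> space drive. \<forall>i\<in>{a..<b}. \<omega> i \<in> F i}"
    proof (intro set_eqI)
      fix p :: "'s \<times> (int \<Rightarrow> 's \<Rightarrow> 's)"
      have "f \<in> F i \<longleftrightarrow> (if 0 \<le> i then f (z i) = z (i + 1) else f (z (i + 1)) = z i)" for f i
        by (simp add: F_def)
      then show "p \<in> driven_path -` window UNIV a b z \<inter> space (start \<Otimes>\<^sub>M drive) \<longleftrightarrow>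
          p \<in> {z 0} \<times> {\<omega> \<in> space drive. \<forall>i\<in>{a..<b}. \<omega> i \<in> F i}"
        by (cases p) (simp add: driven_path_in_window_iff[OF ab] space_pair_measure space_start space_drive)
    qed
    then have "emeasure N (window UNIV a b z) =
        emeasure (start \<Otimes>\<^sub>M drive) ({z 0} \<times> {\<omega> \<in> space drive. \<forall>i\<in>{a..<b}. \<omega> i \<in> F i})"
      unfolding N_def by (subst emeasure_distr[OF path_meas]) simp_all
    also have "\<dots> = emeasure start {z 0} * emeasure drive {\<omega> \<in> space drive. \<forall>i\<in>{a..<b}. \<omega> i \<in> F i}"
    proof (rule drive.emeasure_pair_measure_Times)
      show "{\<omega> \<in> space drive. \<forall>i\<in>{a..<b}. \<omega> i \<in> F i} \<in> sets drive"
        using F unfolding drive_def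
        by (intro sets.sets_Collect_finite_All sets_Collect_single') (auto simp: space_maps)
    qed (simp add: start_def)
    also have "emeasure start {z 0} = ennreal (lam (z 0))"
      by (simp add: start_def emeasure_density nn_integral_count_space_indicator[symmetric])
    also have "emeasure drive {\<omega> \<in> space drive. \<forall>i\<in>{a..<b}. \<omega> i \<in> F i} = (\<Prod>i\<in>{a..<b}. emeasure (maps i) (F i))"
      unfolding drive_def by (rule product_prob_space.emeasure_PiM_Collect[OF drive_sp]) (auto simp: F)
    also have "\<dots> = (\<Prod>i\<in>{a..<b}. ennreal (if 0 \<le> i then pmf (K (z i)) (z (i + 1)) else pmf (K' (z (i + 1))) (z i)))"
      by (intro prod.cong refl) (simp add: F_def emeasure_maps kernel_def)
    also have "\<dots> = ennreal (\<Prod>i\<in>{a..<b}. if 0 \<le> i then pmf (K (z i)) (z (i + 1)) else pmf (K' (z (i + 1))) (z i))"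
      by (rule prod_ennreal) auto
    also have "(\<Prod>i\<in>{a..<b}. if 0 \<le> i then pmf (K (z i)) (z (i + 1)) else pmf (K' (z (i + 1))) (z i)) =
        (\<Prod>i\<in>{0..<b}. pmf (K (z i)) (z (i + 1))) * (\<Prod>i\<in>{a..<0}. pmf (K' (z (i + 1))) (z i))"
    proof -
      have "{a..<b} = {0..<b} \<union> {a..<0}" using ab by auto
      then show ?thesis by (simp add: prod.union_disjoint ivl_disj_int)
    qed
    also have "ennreal (lam (z 0)) * ennreal \<dots> = ennreal (path_weight ?P lam a b z)"
    proof -
      have eq: "path_weight ?P lam a 0 z = lam (z 0) * (\<Prod>i\<in>{a..<0}. pmf (K' (z (i + 1))) (z i))"
        by (rule path_weight_reverse[OF ab(1) balance])
      have "lam (z 0) * ((\<Prod>i\<in>{0..<b}. pmf (K (z i)) (z (i + 1))) * (\<Prod>i\<in>{a..<0}. pmf (K' (z (i + 1))) (z i))) =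
          path_weight ?P lam a b z"
      proof -
        have "{a..<b} = {a..<0} \<union> {0..<b}" using ab by auto
        then have "path_weight ?P lam a b z =
            path_weight ?P lam a 0 z * (\<Prod>i\<in>{0..<b}. pmf (K (z i)) (z (i + 1)))"
          by (simp add: path_weight_def prod.union_disjoint ivl_disj_int)
        then show ?thesis by (simp add: eq)
      qed
      then show ?thesis by (simp add: lam prod_nonneg flip: ennreal_mult)
    qed
    finally show ?thesis .
  qed
  have sets_N: "sets N = sets (path_space UNIV)" by (simp add: N_def)
  have shift_meas: "shift_by n \<in> N \<rightarrow>\<^sub>M N" for n
    using measurable_shift_by[of n UNIV] measurable_cong_sets[OF sets_N sets_N] by blast
  have space_N: "space N = UNIV" using sets_eq_imp_space_eq[OF sets_N] by (simp add: space_PiM)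
  have vimage: "shift_by n -` window UNIV a b z = window UNIV (a + n) (b + n) (shift_by (- n) z)" for n a b and z :: "int \<Rightarrow> 's"
    using vimage_shift_window[where S = UNIV] by simp
  have shift_1: "distr N N (shift_by n) = N" if n: "\<bar>n\<bar> \<le> 1" for n
  proof (rule measure_eqI_windows[of UNIV])
    fix m z assume "1 \<le> (m::int)"
    then have "emeasure N (window UNIV (- m + n) (m + n) (shift_by (- n) z)) = emeasure N (window UNIV (- m) m z)"
      using n by (subst (1 2) window_0) (simp_all add: path_weight_shift)
    then show "emeasure (distr N N (shift_by n)) (window UNIV (- m) m z) = emeasure N (window UNIV (- m) m z)"
      by (subst emeasure_distr[OF shift_meas]) (simp_all add: sets_N space_N vimage)
    then show "emeasure (distr N N (shift_by n)) (window UNIV (- m) m z) \<noteq> \<infinity>"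
      using \<open>1 \<le> m\<close> by (simp add: window_0)
  qed (simp_all add: sets_N)
  have emeasure_shift_1: "emeasure N (window UNIV (a + n) (b + n) (shift_by (- n) z)) = emeasure N (window UNIV a b z)"
    if "\<bar>n\<bar> \<le> 1" for n a b z
    using emeasure_distr[OF shift_meas, of "window UNIV a b z" n] shift_1[OF that]
    by (simp add: sets_N space_N vimage)
  have shift_nat: "emeasure N (window UNIV (a + n * int m) (b + n * int m) (shift_by (- n * int m) z)) = emeasure N (window UNIV a b z)"
    if "\<bar>n\<bar> \<le> 1" for n a b z m
  proof (induction m)
    case (Suc m)
    have "emeasure N (window UNIV (a + n * int m + n) (b + n * int m + n) (shift_by (- n) (shift_by (- n * int m) z))) =
        emeasure N (window UNIV (a + n * int m) (b + n * int m) (shift_by (- n * int m) z))"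
      by (rule emeasure_shift_1[OF that])
    moreover have "shift_by (- n) (shift_by (- n * int m) z) = shift_by (- n * int (Suc m)) z"
      by (rule ext) (simp add: algebra_simps)
    moreover have "a + n * int m + n = a + n * int (Suc m)" "b + n * int m + n = b + n * int (Suc m)"
      by (simp_all add: algebra_simps)
    ultimately show ?case using Suc by (simp only:)
  qed simp
  show ?thesis
  proof (rule that, unfold_locales)
    fix a b z assume "a \<le> (b::int)"
    \<comment> \<open>the left end of the window is brought to time \<open>0\<close> by repeated moves by one step\<close>
    have "\<exists>n m. \<bar>n\<bar> \<le> 1 \<and> a + n * int m = 0"
      by (rule exI[of _ "- sgn a"], rule exI[of _ "nat \<bar>a\<bar>"]) (auto simp: sgn_if)
    then obtain n m where n: "\<bar>n\<bar> \<le> 1" "a + n * int m = 0" by blast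
    have "emeasure N (window UNIV a b z) =
        emeasure N (window UNIV (a + n * int m) (b + n * int m) (shift_by (- n * int m) z))"
      by (rule shift_nat[OF n(1), symmetric])
    also have "\<dots> = ennreal (path_weight ?P lam a b z)"
    proof -
      have "path_weight ?P lam (a + n * int m) (b + n * int m) (shift_by (- n * int m) z) =
          path_weight ?P lam a b z" by (simp add: path_weight_shift)
      moreover have "a + n * int m \<le> 0" "0 \<le> b + n * int m" using n(2) \<open>a \<le> b\<close> by linarith+
      ultimately show ?thesis by (simp only: window_0)
    qed
    finally show "emeasure N (window UNIV a b z) = ennreal (path_weight ?P lam a b z)" .
  qed (simp_all add: lam sets_N)
qed

section \<open>Cartesian powers of a shift\<close>

lemma funpow_commute_on:
  assumes "\<And>x. x \<in> X \<Longrightarrow> f x \<in> X" "\<And>x. x \<in> X \<Longrightarrow> h (f x) = g (h x)" "x \<in> X"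
  shows "(f ^^ n) x \<in> X \<and> h ((f ^^ n) x) = (g ^^ n) (h x)"
  using assms by (induction n) auto

text \<open>A conjugacy that is bijective everywhere, not only almost everywhere. It transports the
  condition \<open>R -` A = A\<close> of ergodicity literally.\<close>

locale point_isomorphism =
  fixes M :: "'a measure" and R :: "'a \<Rightarrow> 'a" and N :: "'b measure" and Q :: "'b \<Rightarrow> 'b"
    and f :: "'a \<Rightarrow> 'b" and g :: "'b \<Rightarrow> 'a"
  assumes f_measurable [measurable]: "f \<in> M \<rightarrow>\<^sub>M N" and g_measurable [measurable]: "g \<in> N \<rightarrow>\<^sub>M M"
    and distr_f: "distr M N f = N"
    and g_f: "\<And>x. x \<in> space M \<Longrightarrow> g (f x) = x"
    and f_g: "\<And>y. y \<in> space N \<Longrightarrow> f (g y) = y"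
    and R_space: "\<And>x. x \<in> space M \<Longrightarrow> R x \<in> space M"
    and f_R: "\<And>x. x \<in> space M \<Longrightarrow> f (R x) = Q (f x)"
begin

lemma f_space: "x \<in> space M \<Longrightarrow> f x \<in> space N"
  by (rule measurable_space[OF f_measurable])

lemma g_space: "y \<in> space N \<Longrightarrow> g y \<in> space M"
  by (rule measurable_space[OF g_measurable])

lemma null_sets_transfer:
  assumes "B \<in> null_sets N" "A \<in> sets M" "\<And>x. x \<in> A \<Longrightarrow> f x \<in> B"
  shows "A \<in> null_sets M"
proof -
  have "f -` B \<inter> space M \<in> null_sets M"
    using null_setsD1[OF assms(1)] null_setsD2[OF assms(1)] emeasure_distr[OF f_measurable, of B]
    by (auto simp: distr_f intro!: null_setsI)
  moreover have "A \<subseteq> f -` B \<inter> space M"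
    using assms(3) sets.sets_into_space[OF assms(2)] by blast
  ultimately show ?thesis using assms(2) by (meson null_sets_subset)
qed

lemma image_set:
  assumes "A \<in> sets M"
  obtains B where "B \<in> sets N" "\<And>x. x \<in> space M \<Longrightarrow> f x \<in> B \<longleftrightarrow> x \<in> A"
proof
  show "g -` A \<inter> space N \<in> sets N" using assms by measurable
  show "f x \<in> g -` A \<inter> space N \<longleftrightarrow> x \<in> A" if "x \<in> space M" for x
    using that by (simp add: g_f f_space)
qed

lemma conservative_transfer:
  assumes "conservative N Q" and R: "R \<in> M \<rightarrow>\<^sub>M M"
  shows "conservative M R"
  unfolding conservative_def
proof
  fix A assume A [measurable]: "A \<in> sets M"
  then obtain B where B: "B \<in> sets N" "\<And>x. x \<in> space M \<Longrightarrow> f x \<in> B \<longleftrightarrow> x \<in> A" by (rule image_set) blast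
  have funpow: "(R ^^ n) x \<in> space M \<and> f ((R ^^ n) x) = (Q ^^ n) (f x)" if "x \<in> space M" for n x
    using R_space f_R that by (rule funpow_commute_on)
  have Rn: "R ^^ n \<in> M \<rightarrow>\<^sub>M M" for n by (rule measurable_compose_n[OF R])
  show "A - (\<Union>n\<in>{1..}. (R ^^ n) -` A \<inter> space M) \<in> null_sets M"
  proof (rule null_sets_transfer)
    show "B - (\<Union>n\<in>{1..}. (Q ^^ n) -` B \<inter> space N) \<in> null_sets N"
      using assms(1) B(1) by (auto simp: conservative_def)
    show "A - (\<Union>n\<in>{1..}. (R ^^ n) -` A \<inter> space M) \<in> sets M"
      by (intro sets.Diff sets.countable_UN'' measurable_sets[OF Rn] A) auto
    fix x assume x: "x \<in> A - (\<Union>n\<in>{1..}. (R ^^ n) -` A \<inter> space M)"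
    then have xM: "x \<in> space M" using sets.sets_into_space[OF A] by blast
    have "(Q ^^ n) (f x) \<notin> B" if "1 \<le> n" for n
      using x that funpow[OF xM, of n] B(2)[of "(R ^^ n) x"] xM by auto
    then show "f x \<in> B - (\<Union>n\<in>{1..}. (Q ^^ n) -` B \<inter> space N)"
      using x xM B(2) by auto
  qed
qed

lemma ergodic_transfer:
  assumes "ergodic N Q" and Q_space: "\<And>y. y \<in> space N \<Longrightarrow> Q y \<in> space N"
  shows "ergodic M R"
  unfolding ergodic_def
proof (intro ballI impI)
  fix A assume A [measurable]: "A \<in> sets M" and inv: "R -` A \<inter> space M = A"
  from A obtain B where B: "B \<in> sets N" "\<And>x. x \<in> space M \<Longrightarrow> f x \<in> B \<longleftrightarrow> x \<in> A" by (rule image_set) blast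
  have "Q y \<in> B \<longleftrightarrow> y \<in> B" if y: "y \<in> space N" for y
  proof -
    have "Q y = f (R (g y))" using y by (simp add: f_R g_space f_g)
    then have "Q y \<in> B \<longleftrightarrow> R (g y) \<in> A" using y by (simp add: B(2) R_space g_space)
    also have "\<dots> \<longleftrightarrow> g y \<in> A" using inv g_space[OF y] by blast
    also have "\<dots> \<longleftrightarrow> y \<in> B" using B(2)[OF g_space[OF y]] y by (simp add: f_g)
    finally show ?thesis .
  qed
  then have "Q -` B \<inter> space N = B" using sets.sets_into_space[OF B(1)] by auto
  with assms(1) B(1) have "B \<in> null_sets N \<or> space N - B \<in> null_sets N" by (auto simp: ergodic_def)
  then show "A \<in> null_sets M \<or> space M - A \<in> null_sets M"
  proof
    assume "B \<in> null_sets N"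
    then have "A \<in> null_sets M"
      using A B(2) sets.sets_into_space[OF A] by (intro null_sets_transfer) auto
    then show ?thesis ..
  next
    assume "space N - B \<in> null_sets N"
    then have "space M - A \<in> null_sets M"
      using B(2) f_space by (intro null_sets_transfer) auto
    then show ?thesis ..
  qed
qed

end

lemma prod_ennreal_nonzero:
  fixes f :: "'a \<Rightarrow> ennreal"
  assumes "finite I" "\<And>i. i \<in> I \<Longrightarrow> f i \<noteq> 0"
  shows "prod f I \<noteq> 0"
  using assms by (induction I rule: finite_induct) auto

text \<open>A tuple of paths is turned into a path of tuples, which identifies a power of a shift with the
  shift of the product chain.\<close>

definition gather :: "nat \<Rightarrow> (nat \<Rightarrow> int \<Rightarrow> 's) \<Rightarrow> int \<Rightarrow> nat \<Rightarrow> 's" where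
  "gather k x = (\<lambda>j. \<lambda>c\<in>{..<k}. x c j)"

definition scatter :: "nat \<Rightarrow> (int \<Rightarrow> nat \<Rightarrow> 's) \<Rightarrow> nat \<Rightarrow> int \<Rightarrow> 's" where
  "scatter k y = (\<lambda>c\<in>{..<k}. \<lambda>j. y j c)"

abbreviation state_tuples :: "nat \<Rightarrow> 's set \<Rightarrow> (nat \<Rightarrow> 's) set" where
  "state_tuples k S \<equiv> {..<k} \<rightarrow>\<^sub>E S"

definition power_matrix :: "nat \<Rightarrow> ('s \<Rightarrow> 's \<Rightarrow> real) \<Rightarrow> (nat \<Rightarrow> 's) \<Rightarrow> (nat \<Rightarrow> 's) \<Rightarrow> real" where
  "power_matrix k P s t = (\<Prod>c<k. P (s c) (t c))"

definition power_vector :: "nat \<Rightarrow> ('s \<Rightarrow> real) \<Rightarrow> (nat \<Rightarrow> 's) \<Rightarrow> real" where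
  "power_vector k lam s = (\<Prod>c<k. lam (s c))"

lemma path_weight_power:
  "path_weight (power_matrix k P) (power_vector k lam) a b z = (\<Prod>c<k. path_weight P lam a b (\<lambda>j. z j c))"
  unfolding path_weight_def power_matrix_def power_vector_def
  by (subst prod.swap) (simp add: prod.distrib)

context path_measure
begin

lemma product_sigma_finite_M: "product_sigma_finite (\<lambda>_::nat. M)"
  unfolding product_sigma_finite_def by (simp add: sigma_finite)

lemma countable_state_tuples: "countable (state_tuples k S)"
  by (intro countable_PiE countable_S) auto

lemma space_power_space: "space (power_space k M) = {..<k} \<rightarrow>\<^sub>E paths S"
  by (simp add: power_space_def space_PiM space_M)

lemma power_space_component:
  assumes "x \<in> space (power_space k M)" "c < k"
  shows "x c j \<in> S"
proof -
  have "x c \<in> paths S" using assms PiE_mem[of x "{..<k}" _ c] by (simp add: space_power_space)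
  then show ?thesis by (auto simp: PiE_UNIV_domain)
qed

lemma tuple_path_component:
  assumes "y \<in> paths (state_tuples k S)" "c < k"
  shows "y j c \<in> S"
proof -
  have "y j \<in> state_tuples k S" using assms by (auto simp: PiE_UNIV_domain)
  then show ?thesis using assms(2) PiE_mem[of "y j" "{..<k}" _ c] by simp
qed

lemma gather_in_paths: "x \<in> space (power_space k M) \<Longrightarrow> gather k x \<in> paths (state_tuples k S)"
  by (simp add: gather_def PiE_UNIV_domain restrict_PiE_iff power_space_component)

lemma scatter_in_space: "y \<in> paths (state_tuples k S) \<Longrightarrow> scatter k y \<in> space (power_space k M)"
  using tuple_path_component[of y k]
  by (simp add: scatter_def space_power_space restrict_PiE_iff PiE_UNIV_domain Pi_iff)

lemma scatter_gather: "x \<in> space (power_space k M) \<Longrightarrow> scatter k (gather k x) = x"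
  using PiE_arb[of x "{..<k}"] by (auto simp: scatter_def gather_def space_power_space fun_eq_iff)

lemma gather_scatter:
  assumes "y \<in> paths (state_tuples k S)"
  shows "gather k (scatter k y) = y"
proof
  fix j
  have "y j \<in> state_tuples k S" using assms by (auto simp: PiE_UNIV_domain)
  then show "gather k (scatter k y) j = y j"
    using PiE_arb[of "y j" "{..<k}"] by (auto simp: scatter_def gather_def fun_eq_iff)
qed

lemma vimage_gather_window:
  "gather k -` window (state_tuples k S) a b z \<inter> space (power_space k M) =
    (\<Pi>\<^sub>E c\<in>{..<k}. window S a b (\<lambda>j. z j c))" if "z \<in> paths (state_tuples k S)"
proof (intro set_eqI iffI)
  fix x assume x: "x \<in> gather k -` window (state_tuples k S) a b z \<inter> space (power_space k M)"
  show "x \<in> (\<Pi>\<^sub>E c\<in>{..<k}. window S a b (\<lambda>j. z j c))"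
  proof (rule PiE_I)
    fix c assume c: "c \<in> {..<k}"
    have "x c i = z i c" if "i \<in> {a..b}" for i
    proof -
      have "gather k x i = z i" using x that by (intro window_nth[of _ "state_tuples k S" a b]) simp_all
      then have "gather k x i c = z i c" by simp
      then show ?thesis using c by (simp add: gather_def)
    qed
    moreover have "x c i \<in> S" for i using x c by (intro power_space_component[of x k c]) simp_all
    ultimately show "x c \<in> window S a b (\<lambda>j. z j c)"
      by (simp add: window_def PiE_UNIV_domain Pi_iff)
  next
    fix c assume "c \<notin> {..<k}"
    then show "x c = undefined" using x PiE_arb[of x "{..<k}" "\<lambda>_. paths S" c] by (simp add: space_power_space)
  qed
next
  fix x assume x: "x \<in> (\<Pi>\<^sub>E c\<in>{..<k}. window S a b (\<lambda>j. z j c))"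
  moreover have "(\<Pi>\<^sub>E c\<in>{..<k}. window S a b (\<lambda>j. z j c)) \<subseteq> {..<k} \<rightarrow>\<^sub>E paths S"
    by (rule PiE_mono) (simp add: window_def)
  ultimately have space: "x \<in> space (power_space k M)" by (auto simp: space_power_space)
  have "gather k x i = z i" if "i \<in> {a..b}" for i
  proof
    fix c
    have "z i \<in> state_tuples k S" using \<open>z \<in> paths (state_tuples k S)\<close> by (auto simp: PiE_UNIV_domain)
    then show "gather k x i c = z i c"
      using PiE_mem[OF x, of c] PiE_arb[of "z i" "{..<k}" "\<lambda>_. S" c] that
      by (cases "c < k") (simp_all add: gather_def window_def)
  qed
  then show "x \<in> gather k -` window (state_tuples k S) a b z \<inter> space (power_space k M)"
    using space gather_in_paths[OF space] by (simp add: window_def)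
qed

lemma measurable_gather: "gather k \<in> power_space k M \<rightarrow>\<^sub>M path_space (state_tuples k S)"
proof (rule measurable_PiM_single')
  fix j
  show "(\<lambda>x. gather k x j) \<in> power_space k M \<rightarrow>\<^sub>M count_space (state_tuples k S)"
  proof (subst measurable_count_space_eq_countable[OF countable_state_tuples], intro conjI ballI)
    show "(\<lambda>x. gather k x j) \<in> space (power_space k M) \<rightarrow> state_tuples k S"
      using gather_in_paths by (auto simp: PiE_UNIV_domain)
    fix s assume s: "s \<in> state_tuples k S"
    have "gather k x \<in> window (state_tuples k S) j j (\<lambda>_. s) \<longleftrightarrow> gather k x j = s"
      if "x \<in> space (power_space k M)" for x
      by (simp add: window_def gather_in_paths[OF that])
    then have "(\<lambda>x. gather k x j) -` {s} \<inter> space (power_space k M) =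
        gather k -` window (state_tuples k S) j j (\<lambda>_. s) \<inter> space (power_space k M)" by blast
    also have "\<dots> = (\<Pi>\<^sub>E c\<in>{..<k}. window S j j (\<lambda>_. s c))"
      by (rule vimage_gather_window) (simp add: PiE_UNIV_domain s)
    also have "\<dots> \<in> sets (power_space k M)"
      unfolding power_space_def by (intro sets_PiM_I_finite) auto
    finally show "(\<lambda>x. gather k x j) -` {s} \<inter> space (power_space k M) \<in> sets (power_space k M)" .
  qed
qed (use gather_in_paths in \<open>auto simp: PiE_UNIV_domain\<close>)

definition gathered :: "nat \<Rightarrow> (int \<Rightarrow> nat \<Rightarrow> 's) measure" where
  "gathered k = distr (power_space k M) (path_space (state_tuples k S)) (gather k)"

lemma emeasure_power_box:
  assumes "\<And>c. c < k \<Longrightarrow> A c \<in> sets M"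
  shows "emeasure (power_space k M) (\<Pi>\<^sub>E c\<in>{..<k}. A c) = (\<Prod>c<k. emeasure M (A c))"
  unfolding power_space_def
  by (rule product_sigma_finite.emeasure_PiM[OF product_sigma_finite_M]) (auto simp: assms)

lemma path_measure_gathered:
  "path_measure (state_tuples k S) (power_matrix k P) (power_vector k lam) (gathered k)"
proof
  fix a b z assume "a \<le> (b::int)" and z: "z \<in> paths (state_tuples k S)"
  have comp: "(\<lambda>j. z j c) \<in> paths S" if "c < k" for c
    using tuple_path_component[OF z that] by (simp add: PiE_UNIV_domain Pi_iff)
  have "emeasure (gathered k) (window (state_tuples k S) a b z) =
      (\<Prod>c<k. emeasure M (window S a b (\<lambda>j. z j c)))"
    unfolding gathered_def
    by (subst emeasure_distr[OF measurable_gather]) (simp_all add: vimage_gather_window z emeasure_power_box)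
  also have "\<dots> = (\<Prod>c<k. ennreal (path_weight P lam a b (\<lambda>j. z j c)))"
    using comp \<open>a \<le> b\<close> by (intro prod.cong refl emeasure_window) auto
  also have "\<dots> = ennreal (path_weight (power_matrix k P) (power_vector k lam) a b z)"
    unfolding path_weight_power using comp by (intro prod_ennreal path_weight_nonneg) auto
  finally show "emeasure (gathered k) (window (state_tuples k S) a b z) =
      ennreal (path_weight (power_matrix k P) (power_vector k lam) a b z)" .
next
  fix s t assume "s \<in> state_tuples k S" "t \<in> state_tuples k S"
  then show "0 \<le> power_matrix k P s t"
    unfolding power_matrix_def by (intro prod_nonneg P_nonneg) auto
next
  fix s assume "s \<in> state_tuples k S"
  then show "0 \<le> power_vector k lam s"
    unfolding power_vector_def by (intro prod_nonneg lam_nonneg) auto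
qed (simp_all add: countable_state_tuples gathered_def)

lemma measurable_scatter: "scatter k \<in> path_space (state_tuples k S) \<rightarrow>\<^sub>M power_space k M"
  unfolding power_space_def
proof (rule measurable_PiM_single')
  fix c assume c: "c \<in> {..<k}"
  have "(\<lambda>y. \<lambda>j. y j c) \<in> path_space (state_tuples k S) \<rightarrow>\<^sub>M path_space S"
  proof (rule measurable_PiM_single')
    fix j :: int
    have "(\<lambda>s. s c) \<in> count_space (state_tuples k S) \<rightarrow>\<^sub>M count_space S" using c by auto
    then show "(\<lambda>y. y j c) \<in> path_space (state_tuples k S) \<rightarrow>\<^sub>M count_space S"
      by (rule measurable_compose[OF measurable_component_singleton, rotated]) simp
  qed (use c tuple_path_component[of _ k] in \<open>simp add: space_PiM PiE_UNIV_domain[of "\<lambda>_. S"] Pi_iff\<close>)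
  then show "(\<lambda>y. scatter k y c) \<in> path_space (state_tuples k S) \<rightarrow>\<^sub>M M"
    using c by (simp add: scatter_def measurable_cong_sets[OF refl sets_M])
qed (use scatter_in_space[of _ k] in \<open>simp add: space_PiM space_power_space space_M\<close>)

lemma measurable_power_map:
  assumes R: "R \<in> M \<rightarrow>\<^sub>M M"
  shows "power_map k R \<in> power_space k M \<rightarrow>\<^sub>M power_space k M"
  unfolding power_map_def power_space_def
proof (rule measurable_restrict)
  fix c assume "c \<in> {..<k}"
  then show "(\<lambda>x. R (x c)) \<in> (\<Pi>\<^sub>M i\<in>{..<k}. M) \<rightarrow>\<^sub>M M"
    by (rule measurable_compose[OF measurable_component_singleton[of c "{..<k}" "\<lambda>_. M"] R])
qed

lemma point_isomorphism_gather:
  "point_isomorphism (power_space k M) (power_map k left_shift) (gathered k) left_shift (gather k) (scatter k)"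
proof
  have sets: "sets (gathered k) = sets (path_space (state_tuples k S))" by (simp add: gathered_def)
  have space: "space (gathered k) = paths (state_tuples k S)"
    using sets_eq_imp_space_eq[OF sets] by (simp add: space_PiM)
  show "gather k \<in> power_space k M \<rightarrow>\<^sub>M gathered k"
    using measurable_gather by (simp add: measurable_cong_sets[OF refl sets])
  show "scatter k \<in> gathered k \<rightarrow>\<^sub>M power_space k M"
    using measurable_scatter by (simp add: measurable_cong_sets[OF sets refl])
  show "distr (power_space k M) (gathered k) (gather k) = gathered k"
    unfolding gathered_def by (rule distr_cong) simp_all
  show "scatter k (gather k x) = x" if "x \<in> space (power_space k M)" for x by (rule scatter_gather[OF that])
  show "gather k (scatter k y) = y" if "y \<in> space (gathered k)" for y
    using that by (simp add: gather_scatter space)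
  show "power_map k left_shift x \<in> space (power_space k M)" if "x \<in> space (power_space k M)" for x
    by (rule measurable_space[OF measurable_power_map that]) (simp add: left_shift_eq_shift_by)
  show "gather k (power_map k left_shift x) = left_shift (gather k x)" for x :: "nat \<Rightarrow> int \<Rightarrow> 's"
    by (simp add: gather_def power_map_def left_shift_def fun_eq_iff restrict_def)
qed

text \<open>The coordinates of the product chain move independently, so its two-time probabilities are
  products. This computes the expected number of returns of a power.\<close>

lemma emeasure_gathered_two_states:
  assumes "s \<in> state_tuples k S" "t \<in> state_tuples k S"
  shows "emeasure (gathered k) (window (state_tuples k S) i i (\<lambda>_. s) \<inter> window (state_tuples k S) j j (\<lambda>_. t)) =
    (\<Prod>c<k. emeasure M (state_at i (s c) \<inter> state_at j (t c)))" (is "emeasure _ (?V \<inter> ?W) = _")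
proof -
  have paths: "(\<lambda>_. s) \<in> paths (state_tuples k S)" "(\<lambda>_. t) \<in> paths (state_tuples k S)"
    by (simp_all add: PiE_UNIV_domain assms)
  have "gather k -` (?V \<inter> ?W) \<inter> space (power_space k M) =
      (gather k -` ?V \<inter> space (power_space k M)) \<inter> (gather k -` ?W \<inter> space (power_space k M))" by blast
  also have "\<dots> = (\<Pi>\<^sub>E c\<in>{..<k}. state_at i (s c) \<inter> state_at j (t c))"
    unfolding vimage_gather_window[OF paths(1)] vimage_gather_window[OF paths(2)] state_at_eq_window
    by (rule PiE_Int)
  finally have "emeasure (gathered k) (?V \<inter> ?W) =
      emeasure (power_space k M) (\<Pi>\<^sub>E c\<in>{..<k}. state_at i (s c) \<inter> state_at j (t c))"
    unfolding gathered_def by (subst emeasure_distr[OF measurable_gather]) (simp_all add: sets.Int)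
  then show ?thesis by (simp add: emeasure_power_box)
qed

text \<open>The recurrence criterion is applied to the product chain, with the constant tuple as base. All
  coordinates have to arrive at prescribed states simultaneously, which is why \<open>reaches\<close> is required
  for all sufficiently large times, an aperiodicity condition.\<close>

theorem power_conservative_ergodic:
  assumes base: "base \<in> S" "0 < lam base"
    and returns: "(\<Sum>n. emeasure M (state_at 0 base \<inter> state_at (int n) base) ^ k) = \<infinity>"
    and reaches: "\<And>s. s \<in> S \<Longrightarrow> 0 < lam s \<Longrightarrow>
      \<exists>N. \<forall>n\<ge>N. emeasure M (state_at 0 base \<inter> state_at (int n) s) \<noteq> 0"
  shows "conservative (power_space k M) (power_map k left_shift)"
    and "ergodic (power_space k M) (power_map k left_shift)"
proof -
  let ?o = "\<lambda>c\<in>{..<k}. base"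
  have o: "?o \<in> state_tuples k S" using base by auto
  interpret G: path_measure "state_tuples k S" "power_matrix k P" "power_vector k lam" "gathered k"
    by (rule path_measure_gathered)
  have two: "emeasure (gathered k) (G.state_at 0 ?o \<inter> G.state_at j t) =
      (\<Prod>c<k. emeasure M (state_at 0 base \<inter> state_at j (t c)))" if "t \<in> state_tuples k S" for j t
    unfolding G.state_at_eq_window emeasure_gathered_two_states[OF o that] by (intro prod.cong) simp_all
  interpret G: recurrent_path_measure "state_tuples k S" "power_matrix k P" "power_vector k lam" "gathered k" ?o
  proof
    show "?o \<in> state_tuples k S" by (rule o)
    show "0 < power_vector k lam ?o" unfolding power_vector_def using base(2) by (intro prod_pos) auto
    show "(\<Sum>n. emeasure (gathered k) (G.state_at 0 ?o \<inter> G.state_at (int n) ?o)) = \<infinity>"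
      using returns by (simp add: two[OF o])
    fix s assume s: "s \<in> state_tuples k S" "0 < power_vector k lam s"
    have "0 < lam (s c)" if "c < k" for c
    proof -
      have "lam (s c) \<noteq> 0"
      proof
        assume "lam (s c) = 0"
        then have "power_vector k lam s = 0"
          unfolding power_vector_def using that by (intro prod_zero) auto
        then show False using s(2) by simp
      qed
      moreover have "0 \<le> lam (s c)" using s(1) that by (intro lam_nonneg) auto
      ultimately show ?thesis by simp
    qed
    then have "\<forall>c\<in>{..<k}. \<exists>N. \<forall>n\<ge>N. emeasure M (state_at 0 base \<inter> state_at (int n) (s c)) \<noteq> 0"
      using s(1) by (intro ballI reaches) auto
    from bchoice[OF this] obtain N
      where N: "\<forall>c\<in>{..<k}. \<forall>n\<ge>N c. emeasure M (state_at 0 base \<inter> state_at (int n) (s c)) \<noteq> 0" ..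
    \<comment> \<open>a common time at which every coordinate may arrive\<close>
    define n where "n = (\<Sum>c<k. N c)"
    have "N c \<le> n" if "c < k" for c
      unfolding n_def using that by (intro member_le_sum) auto
    then have "emeasure (gathered k) (G.state_at 0 ?o \<inter> G.state_at (int n) s) \<noteq> 0"
      unfolding two[OF s(1)] using N by (intro prod_ennreal_nonzero) auto
    then show "\<exists>n. emeasure (gathered k) (G.state_at 0 ?o \<inter> G.state_at (int n) s) \<noteq> 0" ..
  qed
  interpret I: point_isomorphism "power_space k M" "power_map k left_shift" "gathered k" left_shift "gather k" "scatter k"
    by (rule point_isomorphism_gather)
  show "conservative (power_space k M) (power_map k left_shift)"
    by (rule I.conservative_transfer[OF G.conservative_left_shift measurable_power_map])
       (simp add: left_shift_eq_shift_by)
  show "ergodic (power_space k M) (power_map k left_shift)"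
    by (rule I.ergodic_transfer[OF G.ergodic_left_shift]) (simp add: left_shift_eq_shift_by G.space_M)
qed

end

section \<open>Transience and non-ergodicity\<close>

text \<open>By Borel--Cantelli almost every point of \<open>A\<close> returns to \<open>A\<close> finitely often, and so has a last
  visit. The set of points of \<open>A\<close> that never return is null by conservativity, hence so are its
  preimages, which contain all points with a last visit.\<close>

lemma conservative_summable_returns_null:
  assumes cons: "conservative M R" and R [measurable]: "R \<in> M \<rightarrow>\<^sub>M M"
    and pres: "distr M M R = M"
    and A [measurable]: "A \<in> sets M" and fin: "(\<Sum>n. emeasure M (A \<inter> ((R ^^ n) -` A \<inter> space M))) < \<infinity>"
  shows "A \<in> null_sets M"
proof -
  let ?A = "\<lambda>n. A \<inter> ((R ^^ n) -` A \<inter> space M)"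
  have AM: "A \<subseteq> space M" by (rule sets.sets_into_space[OF A])
  have Rn [measurable]: "R ^^ n \<in> M \<rightarrow>\<^sub>M M" for n by (rule measurable_compose_n[OF R])
  have distr_n: "distr M M (R ^^ n) = M" for n
  proof (induction n)
    case 0
    show ?case by (simp add: distr_id[unfolded id_def] id_def)
  next
    case (Suc n)
    have "distr M M (R ^^ Suc n) = distr (distr M M (R ^^ n)) M R"
      by (subst distr_distr) simp_all
    then show ?case by (simp only: Suc pres)
  qed
  \<comment> \<open>points of \<open>A\<close> that never return\<close>
  define L where "L = A - (\<Union>n\<in>{1..}. (R ^^ n) -` A \<inter> space M)"
  have L: "L \<in> null_sets M" using cons A by (auto simp: conservative_def L_def)
  have Ln: "AE x in M. (R ^^ n) x \<notin> L" for n
  proof -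
    have "AE x in distr M M (R ^^ n). x \<notin> L" unfolding distr_n using L by (rule AE_not_in)
    then show ?thesis by (rule AE_distrD[OF Rn])
  qed
  have finA: "emeasure M (?A n) < \<infinity>" for n
  proof -
    have "emeasure M (?A n) \<le> (\<Sum>n. emeasure M (?A n))"
      using sum_le_suminf[of "\<lambda>n. emeasure M (?A n)" "{n}"] by simp
    then show ?thesis using fin by (rule le_less_trans)
  qed
  have "summable (\<lambda>n. measure M (?A n))"
  proof (rule summable_suminf_not_top)
    have "(\<Sum>n. ennreal (measure M (?A n))) = (\<Sum>n. emeasure M (?A n))"
      by (intro suminf_cong) (simp add: emeasure_eq_ennreal_measure[OF less_imp_neq[OF finA[unfolded infinity_ennreal_def]]])
    then show "(\<Sum>n. ennreal (measure M (?A n))) \<noteq> \<top>" using fin by simp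
  qed simp
  then have "AE x in M. \<forall>\<^sub>F n in sequentially. x \<in> space M - ?A n"
    using finA by (intro borel_cantelli_AE1) auto
  moreover have "AE x in M. \<forall>n. (R ^^ n) x \<notin> L" using Ln by (simp add: AE_all_countable)
  ultimately have "AE x in M. x \<notin> A"
    using AE_space
  proof eventually_elim
    case (elim x)
    show ?case
    proof
      assume x: "x \<in> A"
      from elim(1) obtain N where N: "\<And>n. N \<le> n \<Longrightarrow> x \<notin> ?A n" by (auto simp: eventually_sequentially)
      have fin: "finite {n. (R ^^ n) x \<in> A}"
      proof (rule finite_subset)
        show "{n. (R ^^ n) x \<in> A} \<subseteq> {..<N}"
        proof
          fix n assume "n \<in> {n. (R ^^ n) x \<in> A}"
          then have "x \<in> ?A n" using x AM by auto
          then show "n \<in> {..<N}" using N[of n] by (meson lessThan_iff not_le)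
        qed
      qed simp
      define n where "n = Max {n. (R ^^ n) x \<in> A}"
      have "0 \<in> {n. (R ^^ n) x \<in> A}" using x by simp
      then have n: "(R ^^ n) x \<in> A" using Max_in[OF fin] unfolding n_def by blast
      have "(R ^^ m) ((R ^^ n) x) \<notin> A" if "1 \<le> m" for m
      proof
        assume "(R ^^ m) ((R ^^ n) x) \<in> A"
        then have "(R ^^ (m + n)) x \<in> A" by (simp add: funpow_add)
        then have "m + n \<le> n" unfolding n_def using fin by (intro Max_ge) auto
        then show False using that by simp
      qed
      then have "(R ^^ n) x \<in> L" using n by (auto simp: L_def)
      then show False using elim(2) by blast
    qed
  qed
  then show ?thesis by (simp add: AE_iff_null_sets)
qed

text \<open>The two-sided orbit of \<open>B\<close> is invariant and meets the wandering set \<open>W\<close> in \<open>B\<close> only. So it is null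
  together with \<open>B\<close>, or its complement, which contains \<open>W - B\<close>, is null.\<close>

lemma ergodic_wandering_atom:
  assumes erg: "ergodic M R" and R: "R \<in> M \<rightarrow>\<^sub>M M" and R': "R' \<in> M \<rightarrow>\<^sub>M M"
    and inv: "\<And>x. x \<in> space M \<Longrightarrow> R' (R x) = x" "\<And>x. x \<in> space M \<Longrightarrow> R (R' x) = x"
    and W: "\<And>x n. x \<in> W \<Longrightarrow> 1 \<le> n \<Longrightarrow> (R ^^ n) x \<notin> W" "W \<in> sets M"
    and B: "B \<in> sets M" "B \<subseteq> W"
  shows "B \<in> null_sets M \<or> W - B \<in> null_sets M"
proof -
  have Rn: "R ^^ n \<in> M \<rightarrow>\<^sub>M M" "R' ^^ n \<in> M \<rightarrow>\<^sub>M M" for n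
    by (rule measurable_compose_n[OF R], rule measurable_compose_n[OF R'])
  have WM: "W \<subseteq> space M" by (rule sets.sets_into_space[OF W(2)])
  have space_n: "(R ^^ n) x \<in> space M" "(R' ^^ n) x \<in> space M" if "x \<in> space M" for x n
    using measurable_space[OF Rn(1) that] measurable_space[OF Rn(2) that] .
  define E where "E = (\<Union>n. (R ^^ n) -` B \<inter> space M) \<union> (\<Union>n. (R' ^^ n) -` B \<inter> space M)"
  have E: "E \<in> sets M"
    unfolding E_def by (intro sets.Un sets.countable_UN'' measurable_sets[OF Rn(1) B(1)] measurable_sets[OF Rn(2) B(1)]) auto
  have E_iff: "x \<in> E \<longleftrightarrow> (\<exists>n. (R ^^ n) x \<in> B \<or> (R' ^^ n) x \<in> B)" if "x \<in> space M" for x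
    using that by (auto simp: E_def)
  have "R x \<in> E \<longleftrightarrow> x \<in> E" if x: "x \<in> space M" for x
  proof -
    have fwd: "(R ^^ n) (R x) = (R ^^ Suc n) x" for n by (simp add: funpow_swap1)
    have bwd: "(R' ^^ Suc n) (R x) = (R' ^^ n) x" for n using inv(1)[OF x] by (simp add: funpow_swap1)
    have "R x \<in> E \<longleftrightarrow> (\<exists>n. (R ^^ Suc n) x \<in> B) \<or> R x \<in> B \<or> (\<exists>n. (R' ^^ n) x \<in> B)"
      unfolding E_iff[OF measurable_space[OF R x]] ex_disj_distrib fwd
      using bwd by (metis funpow_0 nat.exhaust)
    also have "\<dots> \<longleftrightarrow> (\<exists>n. (R ^^ n) x \<in> B) \<or> (\<exists>n. (R' ^^ n) x \<in> B)"
      by (metis funpow_0 funpow_simps_right(2) nat.exhaust o_apply fwd)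
    also have "\<dots> \<longleftrightarrow> x \<in> E" unfolding E_iff[OF x] by blast
    finally show ?thesis .
  qed
  then have "R -` E \<inter> space M = E" using sets.sets_into_space[OF E] by auto
  with erg E have dich: "E \<in> null_sets M \<or> space M - E \<in> null_sets M" by (auto simp: ergodic_def)
  have "B \<subseteq> E"
  proof
    fix x assume "x \<in> B"
    then show "x \<in> E" using B(2) WM by (subst E_iff) (auto intro: exI[of _ 0])
  qed
  have "x \<in> B" if x: "x \<in> E" "x \<in> W" for x
  proof -
    have xM: "x \<in> space M" using x WM by blast
    then obtain n where "(R ^^ n) x \<in> B \<or> (R' ^^ n) x \<in> B" using x E_iff by blast
    moreover have "(R ^^ n) ((R' ^^ n) x) = x" for n
    proof (induction n)
      case (Suc n)
      have "(R ^^ Suc n) ((R' ^^ Suc n) x) = (R ^^ n) (R (R' ((R' ^^ n) x)))" by (simp add: funpow_swap1)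
      then show ?case using Suc inv(2)[OF space_n(2)[OF xM]] by simp
    qed simp
    ultimately have "\<not> 1 \<le> n"
      using W(1)[of x n] W(1)[of "(R' ^^ n) x" n] x B(2) by (metis subsetD)
    then have "n = 0" by simp
    then show ?thesis using \<open>(R ^^ n) x \<in> B \<or> (R' ^^ n) x \<in> B\<close> by simp
  qed
  then have "W - B \<subseteq> space M - E" using WM by blast
  with dich \<open>B \<subseteq> E\<close> show ?thesis
    using B(1) W(2) by (meson null_sets_subset sets.Diff)
qed

context path_measure
begin

lemma preserves_left_shift: "preserves_measure M left_shift"
  by (simp add: preserves_measure_def left_shift_eq_shift_by distr_shift)

lemma singleton_in_sets:
  assumes "z \<in> space M"
  shows "{z} \<in> sets M"
proof -
  have "{z} = (\<Inter>i. state_at i (z i))" using assms by (auto simp: fun_eq_iff)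
  also have "\<dots> \<in> sets M" by (intro sets.countable_INT) auto
  finally show ?thesis .
qed

text \<open>A path of positive measure returns to itself by conservativity, so it is periodic. Its orbit is
  a finite invariant set of positive finite measure, which ergodicity does not admit in a space of
  infinite measure.\<close>

lemma emeasure_singleton:
  assumes cons: "conservative M left_shift" and erg: "ergodic M left_shift"
    and inf: "emeasure M (space M) = \<infinity>" and z: "z \<in> space M"
  shows "emeasure M {z} = 0"
proof (rule ccontr)
  assume pos: "emeasure M {z} \<noteq> 0"
  have shift_space: "shift_by i z \<in> space M" for i using z by (simp add: space_M)
  have fin: "emeasure M {x} < \<infinity>" if "x \<in> space M" for x
  proof -
    have "emeasure M {x} \<le> emeasure M (state_at 0 (x 0))" using that by (intro emeasure_mono) auto
    also have "\<dots> < \<infinity>" using that by (intro emeasure_state_at_finite) (auto simp: space_M PiE_UNIV_domain)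
    finally show ?thesis .
  qed
  have "{z} - (\<Union>n\<in>{1..}. (left_shift ^^ n) -` {z} \<inter> space M) \<in> null_sets M"
    using cons singleton_in_sets[OF z] by (auto simp: conservative_def)
  then have "z \<in> (\<Union>n\<in>{1..}. (left_shift ^^ n) -` {z} \<inter> space M)"
    using pos by (metis Diff_empty Diff_insert0 empty_Diff insert_Diff_if null_setsD1)
  then obtain n where n: "1 \<le> n" "shift_by (int n) z = z" by (auto simp: left_shift_funpow)
  have period_nat: "shift_by (int n * int q) z = z" for q :: nat
  proof (induction q)
    case (Suc q)
    have "shift_by (int n * int (Suc q)) z = shift_by (int n) (shift_by (int n * int q) z)"
      by (rule ext) (simp add: algebra_simps)
    then show ?case using Suc n by (simp only:)
  qed simp
  have period: "shift_by (int n * q) z = z" for q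
  proof (cases "0 \<le> q")
    case True
    then show ?thesis using period_nat[of "nat q"] by simp
  next
    case False
    then have "shift_by (int n * q) z = shift_by (int n * q) (shift_by (int n * - q) z)"
      using period_nat[of "nat (- q)"] by simp
    also have "\<dots> = z" by (rule ext) simp
    finally show ?thesis .
  qed
  define Orb where "Orb = range (\<lambda>i. shift_by i z)"
  have "shift_by i z \<in> (\<lambda>i. shift_by (int i) z) ` {..<n}" for i
  proof
    have "shift_by i z = shift_by (i mod int n) (shift_by (int n * (i div int n)) z)"
      by (simp only: shift_by_shift_by mod_mult_div_eq)
    then show "shift_by i z = shift_by (int (nat (i mod int n))) z"
      using n(1) by (simp only: period) simp
    show "nat (i mod int n) \<in> {..<n}" using n(1) by (simp add: nat_less_iff)
  qed
  then have "Orb \<subseteq> (\<lambda>i. shift_by (int i) z) ` {..<n}" unfolding Orb_def by blast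
  then have finite_Orb: "finite Orb" by (rule finite_subset) simp
  have Orb_space: "Orb \<subseteq> space M" using shift_space by (auto simp: Orb_def)
  have Orb_sets: "Orb \<in> sets M"
    using sets.finite_UN[OF finite_Orb, of "\<lambda>x. {x}" M] singleton_in_sets Orb_space by auto
  have "left_shift -` Orb \<inter> space M = Orb"
  proof (intro set_eqI iffI)
    fix x assume "x \<in> left_shift -` Orb \<inter> space M"
    then obtain i where "shift_by 1 x = shift_by i z" by (auto simp: Orb_def left_shift_eq_shift_by)
    then have "shift_by (- 1) (shift_by 1 x) = shift_by (- 1) (shift_by i z)" by simp
    then show "x \<in> Orb" by (auto simp: Orb_def)
  next
    fix x assume "x \<in> Orb"
    then show "x \<in> left_shift -` Orb \<inter> space M"
      using Orb_space by (auto simp: Orb_def left_shift_eq_shift_by)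
  qed
  then have "Orb \<in> null_sets M \<or> space M - Orb \<in> null_sets M"
    using erg Orb_sets by (auto simp: ergodic_def)
  moreover have "Orb \<notin> null_sets M"
  proof
    assume null: "Orb \<in> null_sets M"
    have "z \<in> Orb" using rangeI[of "\<lambda>i. shift_by i z" 0] by (simp add: Orb_def)
    then have "{z} \<subseteq> Orb" by simp
    from null_setsD1[OF null_sets_subset[OF null singleton_in_sets[OF z] this]] show False using pos by contradiction
  qed
  ultimately have "emeasure M (space M - Orb) = 0" by auto
  moreover have "emeasure M (space M) \<le> emeasure M (space M - Orb) + emeasure M Orb"
    using emeasure_subadditive[of "space M - Orb" M Orb] Orb_sets Orb_space
    by (simp add: Un_absorb2 sets.compl_sets)
  moreover have "emeasure M Orb < \<infinity>"
  proof -
    have "emeasure M Orb \<le> (\<Sum>x\<in>Orb. emeasure M {x})"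
      using emeasure_subadditive_finite[OF finite_Orb, of "\<lambda>x. {x}" M] singleton_in_sets Orb_space by auto
    also have "\<dots> < \<infinity>" using fin Orb_space finite_Orb by (auto simp: less_top)
    finally show ?thesis .
  qed
  ultimately show False using inf by simp
qed

lemma distr_power_map_shift: "distr (power_space k M) (power_space k M) (power_map k (shift_by n)) = power_space k M"
proof -
  let ?D = "distr (power_space k M) (power_space k M) (power_map k (shift_by n))"
  interpret product_sigma_finite "\<lambda>_::nat. M" by (rule product_sigma_finite_M)
  have meas: "power_map k (shift_by n) \<in> power_space k M \<rightarrow>\<^sub>M power_space k M"
    by (rule measurable_power_map) simp
  have "?D = (\<Pi>\<^sub>M i\<in>{..<k}. M)"
  proof (rule PiM_eqI)
    fix A assume A: "\<And>i. i \<in> {..<k} \<Longrightarrow> A i \<in> sets M"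
    have "power_map k (shift_by n) -` Pi\<^sub>E {..<k} A \<inter> space (power_space k M) =
        (\<Pi>\<^sub>E c\<in>{..<k}. shift_by n -` A c \<inter> space M)"
      unfolding power_map_def power_space_def space_PiM by (auto simp: PiE_iff)
    then have "emeasure ?D (Pi\<^sub>E {..<k} A) =
        emeasure (power_space k M) (\<Pi>\<^sub>E c\<in>{..<k}. shift_by n -` A c \<inter> space M)"
      using A by (subst emeasure_distr[OF meas]) (auto simp: power_space_def intro!: sets_PiM_I_finite)
    also have "\<dots> = (\<Prod>i<k. emeasure M (A i))"
      using A by (subst emeasure_power_box) (simp_all add: vimage_shift_in_sets emeasure_vimage_shift)
    finally show "emeasure ?D (Pi\<^sub>E {..<k} A) =
        (\<Prod>i\<in>{..<k}. emeasure M (A i))" .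
  qed (simp_all add: power_space_def)
  then show ?thesis by (simp add: power_space_def)
qed

abbreviation (input) twisted_space :: "nat \<Rightarrow> ((nat \<Rightarrow> int \<Rightarrow> 's) \<times> (int \<Rightarrow> 's)) measure" where
  "twisted_space k \<equiv> power_space k M \<Otimes>\<^sub>M M"

text \<open>The iterates of \<open>T \<times> \<dots> \<times> T \<times> T\<^sup>-\<^sup>1\<close>, with all integer exponents so that inverses and returns are
  computed by adding exponents.\<close>

definition twisted_shift :: "nat \<Rightarrow> int \<Rightarrow> (nat \<Rightarrow> int \<Rightarrow> 's) \<times> (int \<Rightarrow> 's) \<Rightarrow> (nat \<Rightarrow> int \<Rightarrow> 's) \<times> (int \<Rightarrow> 's)" where
  "twisted_shift k n = map_prod (power_map k (shift_by n)) (shift_by (- n))"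

lemma twisted_shift_1: "map_prod (power_map k left_shift) (inv left_shift) = twisted_shift k 1"
  by (simp add: twisted_shift_def left_shift_eq_shift_by[symmetric] inv_left_shift_eq_shift_by)

lemma measurable_twisted_shift: "twisted_shift k n \<in> twisted_space k \<rightarrow>\<^sub>M twisted_space k"
  unfolding twisted_shift_def map_prod_def case_prod_beta
  by (intro measurable_Pair measurable_compose[OF measurable_fst measurable_power_map]
      measurable_compose[OF measurable_snd measurable_shift_M] measurable_shift_M)

lemma twisted_shift_compose: "twisted_shift k m (twisted_shift k n p) = twisted_shift k (m + n) p"
proof -
  have "power_map k (shift_by m) (power_map k (shift_by n) x) = power_map k (shift_by (m + n)) x"
    for x :: "nat \<Rightarrow> int \<Rightarrow> 's"
    by (rule ext) (simp add: power_map_def)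
  then show ?thesis by (cases p) (simp add: twisted_shift_def)
qed

lemma twisted_shift_0:
  assumes "p \<in> space (twisted_space k)"
  shows "twisted_shift k 0 p = p"
proof -
  have "fst p \<in> {..<k} \<rightarrow>\<^sub>E paths S"
    using assms by (simp add: space_pair_measure space_power_space mem_Times_iff)
  then have "power_map k (shift_by 0) (fst p) = fst p"
    using PiE_arb[of "fst p" "{..<k}"] by (auto simp: power_map_def fun_eq_iff)
  then show ?thesis by (simp add: twisted_shift_def map_prod_def case_prod_beta)
qed

lemma twisted_shift_funpow:
  assumes "p \<in> space (twisted_space k)"
  shows "(twisted_shift k 1 ^^ n) p = twisted_shift k (int n) p"
  using assms by (induction n) (simp_all add: twisted_shift_0 twisted_shift_compose)

lemma distr_twisted_shift: "distr (twisted_space k) (twisted_space k) (twisted_shift k n) = twisted_space k"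
proof -
  have "distr (power_space k M) (power_space k M) (power_map k (shift_by n)) \<Otimes>\<^sub>M distr M M (shift_by (- n)) =
      distr (power_space k M \<Otimes>\<^sub>M M) (power_space k M \<Otimes>\<^sub>M M) (\<lambda>(x, y). (power_map k (shift_by n) x, shift_by (- n) y))"
    by (rule pair_measure_distr[OF measurable_power_map measurable_shift_M])
       (simp_all add: distr_shift sigma_finite)
  then show ?thesis by (simp add: distr_power_map_shift distr_shift twisted_shift_def map_prod_def)
qed

lemma emeasure_twisted_box:
  assumes "A \<in> sets (power_space k M)" "B \<in> sets M"
  shows "emeasure (twisted_space k) (A \<times> B) = emeasure (power_space k M) A * emeasure M B"
  using assms by (rule sigma_finite_measure.emeasure_pair_measure_Times[OF sigma_finite])

text \<open>A return of the last coordinate under the inverse shift concerns the times \<open>0\<close> and \<open>- n\<close>; by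
  stationarity it is as likely as one at the times \<open>0\<close> and \<open>n\<close>. So the measures of the \<open>n\<close>-th returns
  are the \<open>k + 1\<close>-st powers of the measures for a single coordinate.\<close>

lemma not_conservative_twisted:
  assumes base: "base \<in> S" "0 < lam base"
    and returns: "(\<Sum>n. emeasure M (state_at 0 base \<inter> state_at (int n) base) ^ Suc k) < \<infinity>"
  shows "\<not> conservative (twisted_space k) (twisted_shift k 1)"
proof
  assume cons: "conservative (twisted_space k) (twisted_shift k 1)"
  let ?B = "state_at 0 base"
  define A where "A = (\<Pi>\<^sub>E c\<in>{..<k}. ?B) \<times> ?B"
  have box: "(\<Pi>\<^sub>E c\<in>{..<k}. X) \<in> sets (power_space k M)" if "X \<in> sets M" for X
    unfolding power_space_def using that by (intro sets_PiM_I_finite) auto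
  have A: "A \<in> sets (twisted_space k)" unfolding A_def by (intro pair_measureI box) auto
  have AM: "A \<subseteq> space (twisted_space k)" by (rule sets.sets_into_space[OF A])
  have "A \<inter> ((twisted_shift k 1 ^^ n) -` A \<inter> space (twisted_space k)) =
      (\<Pi>\<^sub>E c\<in>{..<k}. ?B \<inter> state_at (int n) base) \<times> (?B \<inter> state_at (- int n) base)" for n
  proof -
    have "(twisted_shift k 1 ^^ n) p = twisted_shift k (int n) p" if "p \<in> A" for p
      using that AM by (intro twisted_shift_funpow) blast
    then have "A \<inter> ((twisted_shift k 1 ^^ n) -` A \<inter> space (twisted_space k)) = {p \<in> A. twisted_shift k (int n) p \<in> A}"
      using AM by fastforce
    also have "\<dots> = (\<Pi>\<^sub>E c\<in>{..<k}. ?B \<inter> state_at (int n) base) \<times> (?B \<inter> state_at (- int n) base)"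
    proof -
      have X: "x \<in> (\<Pi>\<^sub>E c\<in>{..<k}. ?B) \<and> power_map k (shift_by (int n)) x \<in> (\<Pi>\<^sub>E c\<in>{..<k}. ?B) \<longleftrightarrow>
          x \<in> (\<Pi>\<^sub>E c\<in>{..<k}. ?B \<inter> state_at (int n) base)" for x
        unfolding power_map_def restrict_PiE_iff by (auto simp: PiE_iff space_M)
      have Y: "y \<in> ?B \<and> shift_by (- int n) y \<in> ?B \<longleftrightarrow> y \<in> ?B \<inter> state_at (- int n) base" for y
        by (auto simp: space_M)
      show ?thesis
      proof (rule set_eqI)
        fix p :: "(nat \<Rightarrow> int \<Rightarrow> 's) \<times> (int \<Rightarrow> 's)"
        obtain x y where p: "p = (x, y)" by (cases p)
        have "p \<in> A \<and> twisted_shift k (int n) p \<in> A \<longleftrightarrow>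
            p \<in> (\<Pi>\<^sub>E c\<in>{..<k}. ?B \<inter> state_at (int n) base) \<times> (?B \<inter> state_at (- int n) base)"
          unfolding p A_def twisted_shift_def map_prod_simp mem_Times_iff fst_conv snd_conv
          using X[of x] Y[of y] by argo
        then show "p \<in> {p \<in> A. twisted_shift k (int n) p \<in> A} \<longleftrightarrow>
            p \<in> (\<Pi>\<^sub>E c\<in>{..<k}. ?B \<inter> state_at (int n) base) \<times> (?B \<inter> state_at (- int n) base)"
          by (subst mem_Collect_eq)
      qed
    qed
    finally show ?thesis .
  qed
  moreover have "emeasure M (?B \<inter> state_at (- int n) base) = emeasure M (?B \<inter> state_at (int n) base)" for n
  proof -
    have "shift_by (- int n) -` (?B \<inter> state_at (int n) base) \<inter> space M = ?B \<inter> state_at (- int n) base"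
      by (auto simp: space_M)
    then show ?thesis using emeasure_vimage_shift[of "?B \<inter> state_at (int n) base" "- int n"] by simp
  qed
  ultimately have "emeasure (twisted_space k) (A \<inter> ((twisted_shift k 1 ^^ n) -` A \<inter> space (twisted_space k))) =
      emeasure M (?B \<inter> state_at (int n) base) ^ Suc k" for n
    by (simp add: emeasure_twisted_box box emeasure_power_box mult.commute)
  then have "A \<in> null_sets (twisted_space k)"
    using returns by (intro conservative_summable_returns_null[OF cons measurable_twisted_shift distr_twisted_shift A]) simp
  moreover have "emeasure (twisted_space k) A = ennreal (lam base) ^ Suc k"
    by (simp add: A_def emeasure_twisted_box box emeasure_power_box emeasure_state_at base mult.commute)
  ultimately show False using base(2) by (simp add: null_sets_def ennreal_eq_0_iff)
qed

text \<open>If the map were ergodic, a wandering set of positive measure would be an atom. For each time \<open>i\<close> it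
  would then be concentrated on one value of the last coordinate at time \<open>i\<close>, hence on a single path
  in the last coordinate, and such a set is null.\<close>

lemma not_ergodic_twisted:
  assumes not_cons: "\<not> conservative (twisted_space k) (twisted_shift k 1)"
    and points: "\<And>z. z \<in> space M \<Longrightarrow> emeasure M {z} = 0"
  shows "\<not> ergodic (twisted_space k) (twisted_shift k 1)"
proof
  assume erg: "ergodic (twisted_space k) (twisted_shift k 1)"
  let ?N = "twisted_space k" and ?R = "twisted_shift k 1"
  from not_cons obtain A where A: "A \<in> sets ?N" and nonnull: "A - (\<Union>n\<in>{1..}. (?R ^^ n) -` A \<inter> space ?N) \<notin> null_sets ?N"
    by (auto simp: conservative_def)
  define W where "W = A - (\<Union>n\<in>{1..}. (?R ^^ n) -` A \<inter> space ?N)"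
  have Rn: "?R ^^ n \<in> ?N \<rightarrow>\<^sub>M ?N" for n by (rule measurable_compose_n[OF measurable_twisted_shift])
  have W: "W \<in> sets ?N"
    unfolding W_def by (intro sets.Diff A sets.countable_UN'' measurable_sets[OF Rn A]) auto
  have WN: "W \<subseteq> space ?N" by (rule sets.sets_into_space[OF W])
  have wandering: "(?R ^^ n) x \<notin> W" if "x \<in> W" "1 \<le> n" for x n
    using that WN unfolding W_def by blast
  define slice where "slice = (\<lambda>i s. {p \<in> space ?N. snd p i = s})"
  have slice: "slice i s \<in> sets ?N" for i s
  proof -
    have "slice i s = snd -` state_at i s \<inter> space ?N" by (auto simp: slice_def space_pair_measure)
    then show ?thesis using measurable_sets[OF measurable_snd state_at_in_sets] by simp
  qed
  have atom: "W \<inter> slice i s \<in> null_sets ?N \<or> W - W \<inter> slice i s \<in> null_sets ?N" for i s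
  proof (rule ergodic_wandering_atom[OF erg measurable_twisted_shift measurable_twisted_shift])
    show "twisted_shift k (- 1) (?R p) = p" "?R (twisted_shift k (- 1) p) = p" if "p \<in> space ?N" for p
      using that by (simp_all add: twisted_shift_compose twisted_shift_0)
  qed (use W slice wandering in auto)
  have "\<exists>s\<in>S. W - slice i s \<in> null_sets ?N" for i
  proof (rule ccontr)
    assume *: "\<not> ?thesis"
    have "W \<inter> slice i s \<in> null_sets ?N" if "s \<in> S" for s
      using atom[of i s] * that by (simp add: Diff_Int)
    then have "(\<Union>s\<in>S. W \<inter> slice i s) \<in> null_sets ?N"
      using countable_S by (intro null_sets_UN') auto
    moreover have "(\<Union>s\<in>S. W \<inter> slice i s) = W"
    proof -
      have "snd p i \<in> S" if "p \<in> space ?N" for p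
        using that by (auto simp: space_pair_measure space_M PiE_UNIV_domain)
      then show ?thesis using WN unfolding slice_def by blast
    qed
    ultimately show False using nonnull by (simp add: W_def)
  qed
  then obtain z where z: "\<And>i. z i \<in> S" "\<And>i. W - slice i (z i) \<in> null_sets ?N" by metis
  have zM: "z \<in> space M" using z(1) by (simp add: space_M PiE_UNIV_domain)
  have "space (power_space k M) \<times> {z} \<in> null_sets ?N"
    using points[OF zM] singleton_in_sets[OF zM]
    by (intro null_setsI) (simp_all add: emeasure_twisted_box)
  moreover have "(\<Union>i. W - slice i (z i)) \<in> null_sets ?N" using z(2) by (intro null_sets_UN)
  ultimately have "space (power_space k M) \<times> {z} \<union> (\<Union>i. W - slice i (z i)) \<in> null_sets ?N" by (rule null_sets.Un)
  moreover have "W \<subseteq> space (power_space k M) \<times> {z} \<union> (\<Union>i. W - slice i (z i))"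
  proof
    fix p assume p: "p \<in> W"
    then have "p \<in> space ?N" using WN by blast
    then show "p \<in> space (power_space k M) \<times> {z} \<union> (\<Union>i. W - slice i (z i))"
      using p by (cases p) (auto simp: slice_def space_pair_measure fun_eq_iff)
  qed
  ultimately have "W \<in> null_sets ?N" using W null_sets_subset by blast
  then show False using nonnull by (simp add: W_def)
qed

end

section \<open>Renewal sequences that are log-convex\<close>

text \<open>The renewal equation, solved for the distribution of the gaps: \<open>gap u n\<close> is the probability of a
  gap of length \<open>n + 1\<close>. The shift by one makes the index range over all natural numbers.\<close>

fun gap :: "(nat \<Rightarrow> real) \<Rightarrow> nat \<Rightarrow> real" where
  "gap u n = u (Suc n) - (\<Sum>i<n. gap u i * u (n - i))"

declare gap.simps [simp del]

locale log_convex_sequence =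
  fixes u :: "nat \<Rightarrow> real"
  assumes u_0: "u 0 = 1"
    and u_pos: "\<And>n. 0 < u n"
    and u_log_convex: "\<And>n. u (Suc n) * u (Suc n) \<le> u n * u (Suc (Suc n))"
    and u_lim: "u \<longlonglongrightarrow> 0"
    and u_not_summable: "\<not> summable u"
begin

lemma renewal_equation: "u (Suc n) = (\<Sum>i\<le>n. gap u i * u (n - i))"
  by (subst lessThan_Suc_atMost[symmetric]) (simp add: gap.simps[of u n] u_0)

text \<open>The form of log-convexity that enters Kaluza's argument: the ratios of consecutive terms
  increase.\<close>

lemma ratio_mono:
  assumes "i \<le> n"
  shows "u (Suc i) * u n \<le> u (Suc n) * u i"
  using assms
proof (induction n rule: dec_induct)
  case base
  show ?case by simp
next
  case (step n)
  have "u (Suc i) * u n * u (Suc n) \<le> u (Suc n) * u i * u (Suc n)"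
    using step.IH u_pos[of "Suc n"] by (intro mult_right_mono) auto
  also have "\<dots> = u i * (u (Suc n) * u (Suc n))" by (simp add: ac_simps)
  also have "\<dots> \<le> u i * (u n * u (Suc (Suc n)))"
    using u_log_convex[of n] u_pos[of i] by (intro mult_left_mono) auto
  finally have "u n * (u (Suc i) * u (Suc n)) \<le> u n * (u (Suc (Suc n)) * u i)"
    by (simp add: ac_simps)
  then show ?case using u_pos[of n] by simp
qed

text \<open>Kaluza's theorem. Multiplying each term of the renewal equation for \<open>u (m + 1)\<close> by the ratio
  \<open>u (m + 2) / u (m + 1)\<close> yields terms that dominate those of the renewal equation for \<open>u (m + 2)\<close>,
  since earlier ratios are smaller. So \<open>u (m + 2)\<close> is at least the sum of these, and what remains
  of it is \<open>gap u (m + 1)\<close>.\<close>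

lemma gap_nonneg: "0 \<le> gap u n"
proof (induction n rule: less_induct)
  case (less n)
  show ?case
  proof (cases n)
    case 0
    then show ?thesis using u_pos[of 1] by (simp add: gap.simps[of u 0])
  next
    case (Suc m)
    have "(\<Sum>i\<le>m. gap u i * u (Suc m - i)) * u (Suc m) \<le> (\<Sum>i\<le>m. gap u i * u (m - i)) * u (Suc (Suc m))"
      unfolding sum_distrib_right
    proof (rule sum_mono)
      fix i assume "i \<in> {..m}"
      then have "i \<le> m" by simp
      then have "u (Suc m - i) * u (Suc m) \<le> u (Suc (Suc m)) * u (m - i)"
        using ratio_mono[of "m - i" "Suc m"] by (simp add: Suc_diff_le)
      moreover have "0 \<le> gap u i" using less[of i] \<open>i \<le> m\<close> Suc by simp
      ultimately show "gap u i * u (Suc m - i) * u (Suc m) \<le> gap u i * u (m - i) * u (Suc (Suc m))"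
        using mult_left_mono[of "u (Suc m - i) * u (Suc m)" "u (Suc (Suc m)) * u (m - i)" "gap u i"]
        by (simp add: ac_simps)
    qed
    also have "\<dots> = u (Suc (Suc m)) * u (Suc m)" by (simp add: renewal_equation[of m])
    finally show ?thesis
      using u_pos[of "Suc m"] Suc by (simp add: gap.simps[of u "Suc m"] lessThan_Suc_atMost)
  qed
qed

text \<open>One increase would force all later ratios to be at least \<open>1\<close>, contrary to the limit \<open>0\<close>.\<close>

lemma decseq_u: "u (Suc n) \<le> u n"
proof (rule ccontr)
  assume "\<not> u (Suc n) \<le> u n"
  then have less: "u n < u (Suc n)" by simp
  have mono: "u m \<le> u (Suc m)" if "n \<le> m" for m
  proof -
    have "u (Suc n) * u m \<le> u (Suc m) * u n" by (rule ratio_mono[OF that])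
    also have "\<dots> \<le> u (Suc m) * u (Suc n)" using less u_pos[of "Suc m"] by simp
    finally show ?thesis using u_pos[of "Suc n"] by (simp add: ac_simps)
  qed
  have "u n \<le> u m" if "n \<le> m" for m
    using that by (induction m rule: dec_induct) (auto intro: order_trans mono)
  then have "u n \<le> 0"
    by (intro LIMSEQ_le_const[OF u_lim]) auto
  then show False using u_pos[of n] by simp
qed

lemma u_le_1: "u n \<le> 1"
  using u_0 decseq_u by (induction n) (auto intro: order_trans)

definition tail :: "nat \<Rightarrow> real" where
  "tail n = 1 - (\<Sum>i<n. gap u i)"

text \<open>At each time there is a most recent renewal. In this form the tails are related to \<open>u\<close> before
  it is known that the gaps have total probability \<open>1\<close>.\<close>

lemma tail_renewal: "(\<Sum>i\<le>n. tail i * u (n - i)) = 1"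
proof (induction n)
  case 0
  show ?case by (simp add: tail_def u_0)
next
  case (Suc n)
  have "(\<Sum>i\<le>Suc n. tail i * u (Suc n - i)) = u (Suc n) + (\<Sum>i\<le>n. tail (Suc i) * u (n - i))"
    by (subst sum.atMost_Suc_shift) (simp add: tail_def)
  also have "(\<Sum>i\<le>n. tail (Suc i) * u (n - i)) = (\<Sum>i\<le>n. tail i * u (n - i)) - (\<Sum>i\<le>n. gap u i * u (n - i))"
    unfolding sum_subtractf[symmetric] by (intro sum.cong) (auto simp: tail_def algebra_simps)
  finally show ?case using Suc by (simp add: renewal_equation[of n])
qed

lemma tail_antimono: "i \<le> j \<Longrightarrow> tail j \<le> tail i"
  unfolding tail_def by (simp add: gap_nonneg sum_mono2)

lemma u_sums_unbounded: "\<exists>n. c < (\<Sum>i\<le>n. u i)"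
proof (rule ccontr)
  assume "\<nexists>n. c < (\<Sum>i\<le>n. u i)"
  then have "(\<Sum>i\<le>n. u i) \<le> c" for n by (simp add: not_less)
  then have "summable u"
    using u_pos less_imp_le by (intro bounded_imp_summable[where B = c]) blast+
  with u_not_summable show False ..
qed

lemma sum_atMost_rev: "(\<Sum>i\<le>n. u (n - i)) = (\<Sum>i\<le>n. u i)"
  using sum.nat_diff_reindex[of u "Suc n"] by (simp add: lessThan_Suc_atMost)

text \<open>A negative tail would persist, since tails decrease. Against the divergent partial sums of \<open>u\<close> it
  would make the sum in \<open>tail_renewal\<close> negative.\<close>

lemma tail_nonneg: "0 \<le> tail j"
proof (rule ccontr)
  assume neg: "\<not> 0 \<le> tail j"
  have "tail i \<le> 1" for i using tail_antimono[of 0 i] by (simp add: tail_def)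
  obtain n where n: "real j / (- tail j) < (\<Sum>i\<le>n. u i)" using u_sums_unbounded by blast
  have "1 = (\<Sum>i\<le>n + j. tail i * u (n + j - i))" by (simp add: tail_renewal)
  also have "\<dots> = (\<Sum>i<j. tail i * u (n + j - i)) + (\<Sum>i\<le>n. tail (i + j) * u (n - i))"
  proof -
    have "{..n + j} = {..<j} \<union> {j..n+j}" by auto
    then have "(\<Sum>i\<le>n + j. tail i * u (n + j - i)) =
      (\<Sum>i<j. tail i * u (n + j - i)) + (\<Sum>i\<in>{j..n+j}. tail i * u (n + j - i))"
      by (simp add: sum.union_disjoint ivl_disj_int)
    moreover have "(\<Sum>i\<in>{0+j..n+j}. tail i * u (n + j - i)) = (\<Sum>i\<in>{0..n}. tail (i + j) * u (n - i))"
      by (subst sum.shift_bounds_cl_nat_ivl) simp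
    ultimately show ?thesis by (simp add: atLeast0AtMost)
  qed
  also have "\<dots> \<le> (\<Sum>i<j. 1) + (\<Sum>i\<le>n. tail j * u (n - i))"
  proof (intro add_mono sum_mono)
    fix i
    show "tail i * u (n + j - i) \<le> 1"
      using mult_mono[OF \<open>tail i \<le> 1\<close> u_le_1[of "n + j - i"]] u_pos[of "n + j - i"] by simp
    show "tail (i + j) * u (n - i) \<le> tail j * u (n - i)"
      using u_pos[of "n - i"] by (intro mult_right_mono tail_antimono) auto
  qed
  also have "\<dots> = j + tail j * (\<Sum>i\<le>n. u i)"
    by (simp add: sum_distrib_left[symmetric] sum_atMost_rev)
  also have "\<dots> < 0"
    using n neg by (simp add: field_simps)
  finally show False by simp
qed

text \<open>Tails bounded below by a positive constant would make the sum in \<open>tail_renewal\<close> unbounded, since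
  \<open>u\<close> is not summable.\<close>

lemma tail_lim: "tail \<longlonglongrightarrow> 0"
proof (rule LIMSEQ_I)
  fix e :: real assume "0 < e"
  have "\<exists>n. tail n < e"
  proof (rule ccontr)
    assume "\<not> ?thesis"
    then have ge: "e \<le> tail n" for n by (simp add: not_less)
    obtain n where n: "1 / e < (\<Sum>i\<le>n. u i)" using u_sums_unbounded by blast
    have "e * (\<Sum>i\<le>n. u i) \<le> (\<Sum>i\<le>n. tail i * u (n - i))"
      unfolding sum_atMost_rev[symmetric] sum_distrib_left
      using ge u_pos by (intro sum_mono mult_right_mono) (auto intro: less_imp_le)
    then show False using n \<open>0 < e\<close> by (simp add: tail_renewal field_simps)
  qed
  then obtain n where "tail n < e" ..
  then have "norm (tail m - 0) < e" if "n \<le> m" for m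
    using tail_nonneg[of m] tail_antimono[OF that] by simp
  then show "\<exists>no. \<forall>n\<ge>no. norm (tail n - 0) < e" by blast
qed

lemma gap_sums: "gap u sums 1"
  unfolding sums_def using tendsto_diff[OF tendsto_const[of 1] tail_lim] by (simp add: tail_def)

lemma gap_tail_sums: "(\<lambda>m. gap u (i + m)) sums tail i"
  using sums_split_initial_segment[OF gap_sums, of i] by (simp add: tail_def add.commute)

text \<open>The mean gap is infinite: a summable tail, convolved with a sequence that tends to \<open>0\<close>, would
  tend to \<open>0\<close>, but by \<open>tail_renewal\<close> the convolution is constantly \<open>1\<close>.\<close>

lemma tail_not_summable: "\<not> summable tail"
proof
  assume summable: "summable tail"
  define a where "a = (\<lambda>i n. if i \<le> n then tail i * u (n - i) else 0)"
  have lim: "a i \<longlonglongrightarrow> 0" for i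
  proof -
    have "(\<lambda>n. tail i * u (n - i)) \<longlonglongrightarrow> tail i * 0"
      by (intro tendsto_mult_left, rule LIMSEQ_offset[where k = i]) (simp add: u_lim)
    moreover have "\<forall>\<^sub>F n in sequentially. tail i * u (n - i) = a i n"
      using eventually_ge_at_top[of i] by eventually_elim (simp add: a_def)
    ultimately show ?thesis by (simp add: tendsto_cong)
  qed
  have bound: "\<forall>\<^sub>F (i, n) in at_top \<times>\<^sub>F sequentially. norm (a i n) \<le> tail i"
    using tail_nonneg u_le_1 u_pos
    by (intro always_eventually) (auto simp: a_def abs_mult less_imp_le intro!: mult_left_le)
  have "(\<lambda>n. \<Sum>i. a i n) \<longlonglongrightarrow> (\<Sum>i. 0)"
    using tannerys_theorem[OF lim bound summable] by simp
  moreover have "(\<Sum>i. a i n) = 1" for n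
    by (subst suminf_finite[of "{..n}"]) (auto simp: a_def tail_renewal)
  ultimately show False by (simp add: LIMSEQ_const_iff)
qed

end

lemma log_convex_sequence_powr:
  assumes "1 \<le> k"
  shows "log_convex_sequence (\<lambda>n. real (Suc n) powr (- 1 / real k))"
proof
  fix n
  have "real (Suc n) * real (Suc (Suc (Suc n))) \<le> real (Suc (Suc n)) * real (Suc (Suc n))"
    by (simp add: algebra_simps)
  then have "(real (Suc (Suc n)) * real (Suc (Suc n))) powr (- 1 / real k)
      \<le> (real (Suc n) * real (Suc (Suc (Suc n)))) powr (- 1 / real k)"
    by (intro powr_mono2') auto
  then show "real (Suc (Suc n)) powr (- 1 / real k) * real (Suc (Suc n)) powr (- 1 / real k)
      \<le> real (Suc n) powr (- 1 / real k) * real (Suc (Suc (Suc n))) powr (- 1 / real k)"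
    by (simp only: powr_mult of_nat_0_le_iff)
next
  show "(\<lambda>n. real (Suc n) powr (- 1 / real k)) \<longlonglongrightarrow> 0"
    using assms by (intro tendsto_neg_powr filterlim_compose[OF filterlim_real_sequentially filterlim_Suc]) auto
next
  show "\<not> summable (\<lambda>n. real (Suc n) powr (- 1 / real k))"
    using assms by (subst summable_Suc_iff) (auto simp: summable_real_powr_iff field_simps)
qed auto

section \<open>The renewal chain of ages and residual times\<close>

lemma pmf_has_sum_1:
  fixes p :: "nat pmf"
  shows "(pmf p has_sum 1) UNIV"
proof -
  have "(\<Sum>n. ennreal (pmf p n)) = 1"
    using nn_integral_pmf_eq_1[of p] by (simp add: nn_integral_count_space_nat)
  moreover from this have "summable (pmf p)"
    by (intro summable_suminf_not_top) auto
  ultimately have "pmf p sums 1"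
    by (simp add: sums_iff suminf_ennreal2)
  then show ?thesis by (intro sums_nonneg_imp_has_sum) auto
qed

text \<open>The state of age \<open>i\<close> and residual time \<open>m\<close> lies in a gap of length \<open>i + m + 1\<close>.\<close>

definition state :: "nat \<Rightarrow> nat \<Rightarrow> nat" where
  "state i m = prod_encode (i, m)"

definition age :: "nat \<Rightarrow> nat" where
  "age s = fst (prod_decode s)"

definition residual :: "nat \<Rightarrow> nat" where
  "residual s = snd (prod_decode s)"

lemma age_state [simp]: "age (state i m) = i"
  and residual_state [simp]: "residual (state i m) = m"
  and state_age_residual [simp]: "state (age s) (residual s) = s"
  by (simp_all add: age_def residual_def state_def)

lemma state_eq_iff [simp]: "state i m = state i' m' \<longleftrightarrow> i = i' \<and> m = m'"
  by (simp add: state_def)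

lemma state_cases: obtains i m where "s = state i m"
  by (metis state_age_residual)

definition flip :: "nat \<Rightarrow> nat" where
  "flip s = state (residual s) (age s)"

lemma flip_state [simp]: "flip (state i m) = state m i"
  by (simp add: flip_def)

lemma flip_flip [simp]: "flip (flip s) = s"
  by (simp add: flip_def)

lemma inj_flip: "inj flip"
  by (rule inj_on_inverseI[where g = flip]) simp

context log_convex_sequence
begin

definition gap_pmf :: "nat pmf" where
  "gap_pmf = embed_pmf (gap u)"

lemma pmf_gap_pmf [simp]: "pmf gap_pmf n = gap u n"
  unfolding gap_pmf_def
proof (rule pmf_embed_pmf)
  show "(\<integral>\<^sup>+x. ennreal (gap u x) \<partial>count_space UNIV) = 1"
    using gap_sums gap_nonneg by (simp add: nn_integral_count_space_nat suminf_ennreal2 sums_iff)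
qed (rule gap_nonneg)

definition step :: "nat \<Rightarrow> nat pmf" where
  "step s = (if residual s = 0 then map_pmf (state 0) gap_pmf
     else return_pmf (state (Suc (age s)) (residual s - 1)))"

definition weight :: "nat \<Rightarrow> real" where
  "weight s = gap u (age s + residual s)"

lemma weight_nonneg: "0 \<le> weight s"
  by (simp add: weight_def gap_nonneg)

lemma pmf_step:
  "pmf (step (state i m)) (state i' m') =
    (if m = 0 then if i' = 0 then gap u m' else 0 else if i' = Suc i \<and> m = Suc m' then 1 else 0)"
proof (cases "m = 0")
  case True
  have inj: "inj (state 0)" by (auto intro: injI)
  have "pmf (map_pmf (state 0) gap_pmf) (state 0 m') = gap u m'"
    using pmf_map_inj'[OF inj, of gap_pmf m'] by simp
  moreover have "pmf (map_pmf (state 0) gap_pmf) (state i' m') = 0" if "i' \<noteq> 0"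
    using that by (intro pmf_map_outside) auto
  ultimately show ?thesis using True by (simp add: step_def)
next
  case False
  then show ?thesis by (cases m) (auto simp: step_def pmf_return indicator_def)
qed

text \<open>Read backwards, a gap is passed with age and residual time exchanged, and a renewal joins two
  independent gaps in either direction.\<close>

lemma skew_balance: "weight s * pmf (step s) t = weight t * pmf (step (flip t)) (flip s)"
proof -
  obtain i m i' m' where "s = state i m" "t = state i' m'" by (metis state_cases)
  then show ?thesis by (auto simp: pmf_step weight_def)
qed

lemma pmf_map_flip: "pmf (map_pmf flip p) s = pmf p (flip s)"
  using pmf_map_inj'[OF inj_flip, of p "flip s"] by simp

text \<open>By \<open>skew_balance\<close>, the sum runs over the transition probabilities out of the flipped state.\<close>

lemma weight_invariant: "((\<lambda>s. weight s * pmf (step s) t) has_sum weight t) UNIV"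
proof -
  have "((\<lambda>s. pmf (step (flip t)) (flip s)) has_sum 1) UNIV"
    using pmf_has_sum_1[of "map_pmf flip (step (flip t))"] by (simp add: pmf_map_flip[abs_def] pmf_map_flip)
  from has_sum_cmult_right[OF this, of "weight t"] show ?thesis by (simp add: skew_balance)
qed

lemma weight_sums_unbounded: "\<exists>F. finite F \<and> c < (\<Sum>s\<in>F. weight s)"
proof (rule ccontr)
  assume "\<not> ?thesis"
  then have le: "(\<Sum>s\<in>F. weight s) \<le> c" if "finite F" for F using that by (auto simp: not_less)
  have "(\<Sum>i\<le>n. tail i) \<le> c" for n
  proof (rule LIMSEQ_le_const2)
    show "(\<lambda>l. \<Sum>i\<le>n. \<Sum>m<l. gap u (i + m)) \<longlonglongrightarrow> (\<Sum>i\<le>n. tail i)"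
      using gap_tail_sums by (intro tendsto_sum) (simp add: sums_def)
    have "(\<Sum>i\<le>n. \<Sum>m<l. gap u (i + m)) \<le> c" for l
    proof -
      have "(\<Sum>i\<le>n. \<Sum>m<l. gap u (i + m)) = (\<Sum>s\<in>case_prod state ` ({..n} \<times> {..<l}). weight s)"
        by (subst sum.reindex) (auto simp: inj_on_def sum.cartesian_product weight_def intro!: sum.cong)
      also have "\<dots> \<le> c" by (rule le) simp
      finally show ?thesis .
    qed
    then show "\<exists>N. \<forall>l\<ge>N. (\<Sum>i\<le>n. \<Sum>m<l. gap u (i + m)) \<le> c" by blast
  qed
  then have "summable tail" using tail_nonneg by (intro bounded_imp_summable) auto
  with tail_not_summable show False ..
qed

lemma infsum_weight: "(\<Sum>\<^sub>\<infinity>s\<in>UNIV. ennreal (weight s)) = \<infinity>"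
proof -
  have "ennreal (real n) \<le> (\<Sum>\<^sub>\<infinity>s\<in>UNIV. ennreal (weight s))" for n
  proof -
    obtain F where F: "finite F" "real n < (\<Sum>s\<in>F. weight s)" using weight_sums_unbounded by blast
    have "ennreal (real n) \<le> ennreal (\<Sum>s\<in>F. weight s)" using F by (intro ennreal_leI) simp
    also have "\<dots> = (\<Sum>s\<in>F. ennreal (weight s))" by (simp add: sum_ennreal weight_nonneg)
    also have "\<dots> \<le> (\<Sum>\<^sub>\<infinity>s\<in>UNIV. ennreal (weight s))"
      using F(1) by (subst nonneg_infsum_complete) (auto intro: SUP_upper)
    finally show ?thesis .
  qed
  then show ?thesis by (metis ennreal_of_nat_eq_real_of_nat ennreal_Ex_less_of_nat infinity_ennreal_def leD less_top)
qed

abbreviation renewal_base :: nat where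
  "renewal_base \<equiv> state 0 0"

lemma weight_renewal_base: "weight renewal_base = u 1"
  by (simp add: weight_def gap.simps[of u 0])

end

locale renewal_path_measure = log_convex_sequence u + path_measure UNIV "\<lambda>s. pmf (step s)" weight M
  for u :: "nat \<Rightarrow> real" and M :: "(int \<Rightarrow> nat) measure"
begin

lemma emeasure_space_infinite: "emeasure M (space M) = \<infinity>"
proof -
  have "ennreal (real n) \<le> emeasure M (space M)" for n
  proof -
    obtain F where F: "finite F" "real n < (\<Sum>s\<in>F. weight s)" using weight_sums_unbounded by blast
    have "ennreal (real n) \<le> ennreal (\<Sum>s\<in>F. weight s)" using F by (intro ennreal_leI) simp
    also have "\<dots> = (\<Sum>s\<in>F. emeasure M (state_at 0 s))"
      by (simp add: sum_ennreal weight_nonneg emeasure_state_at)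
    also have "\<dots> = emeasure M (\<Union>s\<in>F. state_at 0 s)"
      using F(1) by (intro sum_emeasure) (auto simp: disjoint_family_on_def)
    also have "\<dots> \<le> emeasure M (space M)" by (rule emeasure_space)
    finally show ?thesis .
  qed
  then show ?thesis by (metis ennreal_of_nat_eq_real_of_nat ennreal_Ex_less_of_nat infinity_ennreal_def leD less_top)
qed

text \<open>The base is the only state of a gap of length \<open>1\<close>, so a renewal is certain at time \<open>1\<close>. The chain
  is in \<open>state i m\<close> at time \<open>n + 1\<close> if a renewal happens at time \<open>n + 1 - i\<close> and draws a gap of length
  \<open>i + m + 1\<close>; the renewal has probability \<open>u (n - i)\<close> because the count starts at time \<open>1\<close>.\<close>

lemma emeasure_base_then_state:
  "emeasure M (state_at 0 renewal_base \<inter> state_at (int (Suc n)) (state i m)) =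
    ennreal (u 1 * (if i \<le> n then gap u (i + m) * u (n - i) else 0))"
proof (induction n arbitrary: i m)
  case 0
  have "emeasure M (state_at 0 renewal_base \<inter> state_at (int 0) renewal_base \<inter> state_at (int 0 + 1) (state i m)) =
      emeasure M (state_at 0 renewal_base \<inter> state_at (int 0) renewal_base) * ennreal (pmf (step renewal_base) (state i m))"
    by (rule emeasure_next_state) auto
  then show ?case
    using u_pos[of 1]
    by (simp add: emeasure_state_at weight_renewal_base pmf_step u_0 gap_nonneg flip: ennreal_mult)
next
  case (Suc n)
  let ?p = "\<lambda>s. emeasure M (state_at 0 renewal_base \<inter> state_at (int (Suc n)) s)"
  have one_step: "emeasure M (state_at 0 renewal_base \<inter> state_at (int (Suc (Suc n))) t) =
      (\<integral>\<^sup>+s. ?p s * ennreal (pmf (step s) t) \<partial>count_space UNIV)" for t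
    using emeasure_one_step[of renewal_base t "Suc n"] by (simp add: ac_simps)
  show ?case
  proof (cases i)
    case 0
    have zero: "?p s * ennreal (pmf (step s) (state i m)) = 0" if "s \<notin> (\<lambda>j. state j 0) ` {..n}" for s
    proof -
      obtain j l where s: "s = state j l" by (rule state_cases)
      with that have "l \<noteq> 0 \<or> n < j" by force
      then show ?thesis
      proof
        assume "l \<noteq> 0"
        then show ?thesis using 0 by (simp add: s pmf_step)
      next
        assume "n < j"
        then show ?thesis using Suc.IH[of j l] by (simp add: s)
      qed
    qed
    have "(\<integral>\<^sup>+s. ?p s * ennreal (pmf (step s) (state i m)) \<partial>count_space UNIV) =
        (\<Sum>s\<in>(\<lambda>j. state j 0) ` {..n}. ?p s * ennreal (pmf (step s) (state i m)))"
      by (rule nn_integral_count_space'[OF _ zero]) auto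
    also have "\<dots> = (\<Sum>j\<le>n. ?p (state j 0) * ennreal (pmf (step (state j 0)) (state i m)))"
      by (subst sum.reindex) (auto simp: inj_on_def)
    also have "\<dots> = (\<Sum>j\<le>n. ennreal (u 1 * (gap u j * u (n - j)) * gap u m))"
      using u_pos gap_nonneg less_imp_le[OF u_pos]
      by (intro sum.cong refl) (simp add: Suc.IH[unfolded of_nat_Suc] Suc.IH pmf_step 0 ennreal_mult)
    also have "\<dots> = ennreal (\<Sum>j\<le>n. u 1 * (gap u j * u (n - j)) * gap u m)"
      using gap_nonneg less_imp_le[OF u_pos] by (intro sum_ennreal) auto
    also have "(\<Sum>j\<le>n. u 1 * (gap u j * u (n - j)) * gap u m) = u 1 * (gap u m * u (Suc n))"
      by (simp add: renewal_equation[of n] sum_distrib_left sum_distrib_right ac_simps)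
    finally show ?thesis unfolding one_step using 0 by simp
  next
    case (Suc i')
    have zero: "?p s * ennreal (pmf (step s) (state i m)) = 0" if "s \<notin> {state i' (Suc m)}" for s
    proof -
      obtain j l where s: "s = state j l" by (rule state_cases)
      show ?thesis using that Suc by (auto simp: s pmf_step)
    qed
    have "(\<integral>\<^sup>+s. ?p s * ennreal (pmf (step s) (state i m)) \<partial>count_space UNIV) =
        (\<Sum>s\<in>{state i' (Suc m)}. ?p s * ennreal (pmf (step s) (state i m)))"
      by (rule nn_integral_count_space'[OF _ zero]) auto
    also have "\<dots> = ?p (state i' (Suc m))" by (simp add: pmf_step Suc)
    also have "\<dots> = ennreal (u 1 * (if i' \<le> n then gap u (i' + Suc m) * u (n - i') else 0))"
      by (rule Suc.IH)
    finally show ?thesis unfolding one_step using Suc by simp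
  qed
qed

lemma emeasure_return:
  "emeasure M (state_at 0 renewal_base \<inter> state_at (int (Suc n)) renewal_base) = ennreal ((u 1)\<^sup>2 * u n)"
  using emeasure_base_then_state[of n 0 0] by (simp add: gap.simps[of u 0] power2_eq_square ac_simps)

lemma eventually_reaches:
  assumes "0 < weight s"
  shows "\<exists>N. \<forall>n\<ge>N. emeasure M (state_at 0 renewal_base \<inter> state_at (int n) s) \<noteq> 0"
proof (intro exI allI impI)
  obtain i m where s: "s = state i m" by (rule state_cases)
  fix n assume "Suc (age s) \<le> n"
  then obtain n' where n: "n = Suc n'" "i \<le> n'" by (cases n) (auto simp: s)
  have "0 < u 1 * (gap u (i + m) * u (n' - i))"
    using assms u_pos by (simp add: s weight_def)
  then have "ennreal (u 1 * (gap u (i + m) * u (n' - i))) \<noteq> 0"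
    by (simp only: ennreal_eq_0_iff not_le not_less)
  then show "emeasure M (state_at 0 renewal_base \<inter> state_at (int n) s) \<noteq> 0"
    using n(2) by (simp only: n(1) s emeasure_base_then_state if_True not_False_eq_True)
qed

definition reversal :: "(int \<Rightarrow> nat) \<Rightarrow> int \<Rightarrow> nat" where
  "reversal x = (\<lambda>j. flip (x (- j)))"

lemma measurable_reversal: "reversal \<in> M \<rightarrow>\<^sub>M M"
proof -
  have "reversal \<in> path_space UNIV \<rightarrow>\<^sub>M path_space UNIV"
    unfolding reversal_def by (rule measurable_PiM_single') auto
  then show ?thesis using measurable_cong_sets[OF sets_M sets_M] by blast
qed

text \<open>A reversed path follows \<open>z\<close> if the path follows the reversal of \<open>z\<close>; reading its weight backwards
  by \<open>skew_balance\<close> gives the weight of \<open>z\<close>.\<close>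

lemma distr_reversal: "distr M M reversal = M"
proof (rule measure_eqI_windows[OF countable_S])
  fix n :: int and z :: "int \<Rightarrow> nat" assume n: "1 \<le> n"
  have "(\<forall>i\<in>{- n..n}. reversal x i = z i) \<longleftrightarrow> (\<forall>i\<in>{- n..n}. x i = reversal z i)" for x
  proof -
    have "(\<forall>i\<in>{- n..n}. reversal x i = z i) \<longleftrightarrow> (\<forall>i\<in>{- n..n}. reversal x (- i) = z (- i))"
      by (metis atLeastAtMost_iff minus_le_iff neg_le_iff_le minus_minus)
    also have "\<dots> \<longleftrightarrow> (\<forall>i\<in>{- n..n}. x i = reversal z i)"
      by (intro ball_cong refl) (metis flip_flip minus_minus reversal_def)
    finally show ?thesis .
  qed
  then have "reversal -` window UNIV (- n) n z \<inter> space M = window UNIV (- n) n (reversal z)"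
    by (auto simp: window_def space_M)
  then have "emeasure (distr M M reversal) (window UNIV (- n) n z) = ennreal (path_weight (\<lambda>s. pmf (step s)) weight (- n) n (reversal z))"
    using n by (subst emeasure_distr[OF measurable_reversal]) (simp_all add: emeasure_window)
  also have "path_weight (\<lambda>s. pmf (step s)) weight (- n) n (reversal z) =
      weight (reversal z n) * (\<Prod>i\<in>{- n..<n}. pmf (step (flip (reversal z (i + 1)))) (flip (reversal z i)))"
    using n by (intro path_weight_reverse skew_balance) simp
  also have "\<dots> = weight (z (- n)) * (\<Prod>i\<in>{- n..<n}. pmf (step (z (- (i + 1)))) (z (- i)))"
    by (simp add: reversal_def weight_def flip_def add.commute)
  also have "(\<Prod>i\<in>{- n..<n}. pmf (step (z (- (i + 1)))) (z (- i))) = (\<Prod>i\<in>{- n..<n}. pmf (step (z i)) (z (i + 1)))"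
    by (rule prod.reindex_bij_witness[of _ "\<lambda>i. - (i + 1)" "\<lambda>i. - (i + 1)"]) auto
  also have "ennreal (weight (z (- n)) * \<dots>) = emeasure M (window UNIV (- n) n z)"
    using n by (simp add: emeasure_window path_weight_def)
  finally show "emeasure (distr M M reversal) (window UNIV (- n) n z) = emeasure M (window UNIV (- n) n z)" .
  then show "emeasure (distr M M reversal) (window UNIV (- n) n z) \<noteq> \<infinity>"
    using n by (simp add: emeasure_window)
qed (simp_all add: sets_M)

lemma isomorphic_inverse: "isomorphic M left_shift M (inv left_shift)"
  unfolding isomorphic_def
proof (rule exI[of _ reversal], rule exI[of _ reversal], intro conjI)
  show "AE x in M. reversal (left_shift x) = inv left_shift (reversal x)"
    by (simp add: reversal_def left_shift_def inv_left_shift)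
  show "AE x in M. reversal (reversal x) = x" "AE x in M. reversal (reversal x) = x"
    by (simp_all add: reversal_def)
qed (simp_all only: measurable_reversal distr_reversal)

lemma is_markov_shift: "markov_shift UNIV (\<lambda>s. pmf (step s)) weight M"
proof
  fix k n and s :: "nat \<Rightarrow> nat"
  let ?z = "\<lambda>i. s (nat (i - k))"
  have "(\<forall>j\<le>n. x (int j + k) = s j) \<longleftrightarrow> (\<forall>i\<in>{k..k + int n}. x i = ?z i)" for x :: "int \<Rightarrow> nat"
  proof (intro iffI ballI allI impI)
    fix i assume "\<forall>j\<le>n. x (int j + k) = s j" "i \<in> {k..k + int n}"
    then show "x i = ?z i" by (auto dest: spec[of _ "nat (i - k)"])
  next
    fix j assume "\<forall>i\<in>{k..k + int n}. x i = ?z i" "j \<le> n"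
    then show "x (int j + k) = s j" by (auto dest: bspec[of _ _ "int j + k"])
  qed
  then have "cylinder UNIV k n s = window UNIV k (k + int n) ?z"
    by (simp add: cylinder_def window_def)
  moreover have "(\<Prod>i\<in>{k..<k + int n}. pmf (step (?z i)) (?z (i + 1))) = (\<Prod>j<n. pmf (step (s j)) (s (Suc j)))"
    by (rule prod.reindex_bij_witness[of _ "\<lambda>j. int j + k" "\<lambda>i. nat (i - k)"]) (auto simp: nat_add_distrib nat_diff_distrib' Suc_nat_eq_nat_zadd1 algebra_simps)
  ultimately show "emeasure M (cylinder UNIV k n s) = ennreal (weight (s 0) * (\<Prod>j<n. pmf (step (s j)) (s (Suc j))))"
    using emeasure_window[of k "k + int n" ?z] by (simp add: path_weight_def)
qed (simp_all add: pmf_has_sum_1 weight_nonneg weight_invariant infsum_weight sets_M)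

text \<open>Apart from the constant factor \<open>(u 1)\<^sup>2\<close>, the measure at time \<open>n + 1\<close> is \<open>u n\<close>. The term at time \<open>0\<close>
  is the weight of the base and does not affect convergence.\<close>

lemma returns_finite_iff:
  "(\<Sum>n. emeasure M (state_at 0 renewal_base \<inter> state_at (int n) renewal_base) ^ p) < \<infinity> \<longleftrightarrow>
    summable (\<lambda>n. u n ^ p)"
proof -
  let ?a = "\<lambda>n. emeasure M (state_at 0 renewal_base \<inter> state_at (int n) renewal_base)"
  \<comment> \<open>the return measures as real numbers, with time \<open>0\<close> treated apart\<close>
  define r where "r = (\<lambda>n. case n of 0 \<Rightarrow> u 1 | Suc n \<Rightarrow> (u 1)\<^sup>2 * u n)"
  have r_nonneg: "0 \<le> r n" for n
    using less_imp_le[OF u_pos] by (cases n) (simp_all add: r_def)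
  have "?a n = ennreal (r n)" for n
  proof (cases n)
    case 0
    then show ?thesis by (simp add: r_def emeasure_state_at weight_renewal_base)
  next
    case (Suc m)
    show ?thesis unfolding Suc emeasure_return by (simp add: r_def)
  qed
  then have "(\<Sum>n. ?a n ^ p) =
      (\<Sum>n. ennreal (r n ^ p))"
    by (simp only: ennreal_power r_nonneg)
  moreover have "(\<Sum>n. ennreal (r n ^ p)) < \<infinity> \<longleftrightarrow> summable (\<lambda>n. r n ^ p)"
  proof
    assume "(\<Sum>n. ennreal (r n ^ p)) < \<infinity>"
    then have "(\<Sum>n. ennreal (r n ^ p)) \<noteq> \<top>" by simp
    then show "summable (\<lambda>n. r n ^ p)"
      by (rule summable_suminf_not_top[rotated]) (rule zero_le_power[OF r_nonneg])
  next
    assume "summable (\<lambda>n. r n ^ p)"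
    then have "(\<Sum>n. ennreal (r n ^ p)) \<noteq> \<top>"
      by (rule ennreal_suminf_neq_top) (rule zero_le_power[OF r_nonneg])
    then show "(\<Sum>n. ennreal (r n ^ p)) < \<infinity>" by (simp add: less_top)
  qed
  moreover have "summable (\<lambda>n. r n ^ p) \<longleftrightarrow> summable (\<lambda>n. r (Suc n) ^ p)"
    by (rule summable_Suc_iff[symmetric])
  moreover have "\<dots> \<longleftrightarrow> summable (\<lambda>n. u n ^ p)"
    using u_pos[of 1] by (simp add: r_def power_mult_distrib summable_cmult_iff)
  ultimately show ?thesis by simp
qed

lemma left_shift_conservative_ergodic:
  "conservative M left_shift" "ergodic M left_shift"
proof -
  interpret recurrent_path_measure UNIV "\<lambda>s. pmf (step s)" weight M renewal_base
  proof
    show "0 < weight renewal_base" by (simp add: weight_renewal_base u_pos)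
    show "(\<Sum>n. emeasure M (state_at 0 renewal_base \<inter> state_at (int n) renewal_base)) = \<infinity>"
      using returns_finite_iff[of 1] u_not_summable by (simp flip: less_top)
    show "\<exists>n. emeasure M (state_at 0 renewal_base \<inter> state_at (int n) s) \<noteq> 0" if "0 < weight s" for s
      using eventually_reaches[OF that] by blast
  qed simp
  show "conservative M left_shift" "ergodic M left_shift"
    by (rule conservative_left_shift, rule ergodic_left_shift)
qed

lemma power_left_shift_conservative_ergodic:
  assumes "\<not> summable (\<lambda>n. u n ^ k)"
  shows "conservative (power_space k M) (power_map k left_shift)"
    and "ergodic (power_space k M) (power_map k left_shift)"
proof -
  have "(\<Sum>n. emeasure M (state_at 0 renewal_base \<inter> state_at (int n) renewal_base) ^ k) = \<infinity>"
    using returns_finite_iff[of k] assms by (simp flip: less_top)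
  then show "conservative (power_space k M) (power_map k left_shift)"
    "ergodic (power_space k M) (power_map k left_shift)"
    using weight_renewal_base u_pos[of 1] eventually_reaches
    by (simp_all add: power_conservative_ergodic[where base = renewal_base])
qed

lemma twisted_not_conservative_not_ergodic:
  assumes "summable (\<lambda>n. u n ^ Suc k)"
  shows "\<not> conservative (power_space k M \<Otimes>\<^sub>M M) (map_prod (power_map k left_shift) (inv left_shift))"
    and "\<not> ergodic (power_space k M \<Otimes>\<^sub>M M) (map_prod (power_map k left_shift) (inv left_shift))"
proof -
  have not_cons: "\<not> conservative (power_space k M \<Otimes>\<^sub>M M) (twisted_shift k 1)"
    by (rule not_conservative_twisted[of renewal_base])
       (use assms returns_finite_iff[of "Suc k"] in \<open>simp_all add: weight_renewal_base u_pos\<close>)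
  then show "\<not> conservative (power_space k M \<Otimes>\<^sub>M M) (map_prod (power_map k left_shift) (inv left_shift))"
    by (simp only: twisted_shift_1 not_False_eq_True)
  show "\<not> ergodic (power_space k M \<Otimes>\<^sub>M M) (map_prod (power_map k left_shift) (inv left_shift))"
    unfolding twisted_shift_1
    by (rule not_ergodic_twisted[OF not_cons])
       (rule emeasure_singleton[OF left_shift_conservative_ergodic emeasure_space_infinite])
qed

end

section \<open>A shift whose power is recurrent and whose twisted power is transient\<close>

theorem corollary6p6:
  fixes k :: nat
  assumes "k \<ge> 1"
  shows "\<exists>(S :: nat set) P lam M.
    markov_shift S P lam M \<and>
    sigma_finite_measure M \<and> emeasure M (space M) = \<infinity> \<and> preserves_measure M left_shift \<and>
    conservative M left_shift \<and> ergodic M left_shift \<and>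
    isomorphic M left_shift M (inv left_shift) \<and>
    conservative (power_space k M) (power_map k left_shift) \<and>
    ergodic (power_space k M) (power_map k left_shift) \<and>
    \<not> conservative (power_space k M \<Otimes>\<^sub>M M) (map_prod (power_map k left_shift) (inv left_shift)) \<and>
    \<not> ergodic (power_space k M \<Otimes>\<^sub>M M) (map_prod (power_map k left_shift) (inv left_shift))"
proof -
  define u where "u = (\<lambda>n. real (Suc n) powr (- 1 / real k))"
  interpret log_convex_sequence u
    unfolding u_def by (rule log_convex_sequence_powr[OF assms])
  \<comment> \<open>\<open>u n ^ p\<close> is \<open>(n + 1) powr (- p / k)\<close>, so the threshold of summability is \<open>p = k\<close>\<close>
  have summable_iff: "summable (\<lambda>n. u n ^ p) \<longleftrightarrow> k < p" for p
  proof -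
    have "u n ^ p = real (Suc n) powr (- (real p / real k))" for n
      by (simp add: u_def powr_power)
    then have "summable (\<lambda>n. u n ^ p) \<longleftrightarrow> summable (\<lambda>n. real n powr (- (real p / real k)))"
      using summable_Suc_iff[of "\<lambda>n. real n powr (- (real p / real k))"] by simp
    also have "\<dots> \<longleftrightarrow> k < p"
      using assms by (simp add: summable_real_powr_iff field_simps)
    finally show ?thesis .
  qed
  obtain M where "path_measure UNIV (\<lambda>s. pmf (step s)) weight M"
  proof (rule exists_path_measure)
    show "weight s * pmf (step s) t = weight t * pmf (map_pmf flip (step (flip t))) s" for s t
      by (simp add: skew_balance[of s t] pmf_map_flip)
  qed (rule weight_nonneg)
  then interpret path_measure UNIV "\<lambda>s. pmf (step s)" weight M .
  interpret renewal_path_measure u M ..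
  show ?thesis
    using is_markov_shift sigma_finite emeasure_space_infinite preserves_left_shift left_shift_conservative_ergodic
      isomorphic_inverse power_left_shift_conservative_ergodic[of k] twisted_not_conservative_not_ergodic[of k]
      summable_iff[of k] summable_iff[of "Suc k"]
    by (intro exI[of _ UNIV] exI[of _ "\<lambda>s. pmf (step s)"] exI[of _ weight] exI[of _ M] conjI) simp_all
qed

end
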